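(* Let $n=2m$, $G=SL(n,\mathbb{C})$, and let $Z=G/P$ be the flag manifold of a symmetric dimension sequence $(d_1,\dots,d_s,d_s,\dots,d_1)$ or $(d_1,\dots,d_s,e',d_s,\dots,d_1)$. Let $D\subset Z$ be the open $SL(m,\mathbb{H})$-orbit with base cycle $C_0$, and let $S_w$ be an Iwasawa–Schubert variety in $Z$ with $\dim S_w+\dim C_0=\dim Z$ and $S_w\cap C_0\ne\emptyset$. Then $S_w$ intersects $C_0$ in precisely one point. If $s=s_1\dots s_m\in\Sigma_m$ is the element corresponding to $w$, then the intersection point is the partial flag associated with the ordered basis $$(e_{s_1},e_{s_2},\dots,e_{s_m},\mathbf{j}(e_{s_m}),\dots,\mathbf{j}(e_{s_1}))$$ of $\mathbb{C}^n$.
   Context: Let $\mathbf{j}(v)=J\bar v$ on $\mathbb{C}^{2m}$ with $J=\begin{pmatrix}0&I_m\\-I_m&0\end{pmatrix}$, so $\mathbf{j}(e_i)=-e_{m+i}$ for $1\le i\le m$. $G_0=SL(m,\mathbb{H})=\{X\in G:\mathbf{j}X=X\mathbf{j}\}$, $K_0=SU(2m)\cap G_0=Sp(m)$. The flag manifold of a dimension sequence $(c_1,\dots,c_r)$ consists of the flags $0\subset V_1\subset\dots\subset V_r=\mathbb{C}^n$ with $\dim V_i/V_{i-1}=c_i$; the partial flag associated with an ordered basis has $V_i$ spanned by the first $c_1+\dots+c_i$ basis vectors. $G_0$ has exactly one open orbit $D$ in $Z$; its base cycle $C_0$ is its unique $K_0$-orbit that is a complex submanifold. Let $(u_1,\dots,u_n)=(e_1,\mathbf{j}(e_1),e_2,\mathbf{j}(e_2),\dots,e_m,\mathbf{j}(e_m))$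 and let $B_I\subset G$ be the (Iwasawa–)Borel subgroup stabilizing the complete flag of this ordered basis. Iwasawa–Schubert varieties in $Z$ are indexed by minimal representatives $w\in\Sigma_n$ (one-line notation, increasing inside each consecutive block of the dimension sequence): $S_w$ is the closure of the $B_I$-orbit of the partial flag associated with the ordered basis $(u_{w(1)},\dots,u_{w(n)})$. Correspondence $w\mapsto s$: write $w=B_1\dots B_s(B_{e'})\tilde B_s\dots\tilde B_1$ in blocks, with $B_j,\tilde B_j$ of length $d_j$ and $B_{e'}$ of length $e'$. Let $\hat w$ be obtained from $w$ by reversing each $\tilde B_j$ and, if present, replacing $B_{e'}=k'_1\dots k'_{e'}$ by $k'_1k'_3\dots k'_{e'-1}k'_{e'}\dots k'_4k'_2$. Writing $\hat w=k_1\dots k_ml_m\dots l_1$, the $w$ parametrizing Schubert varieties as in the claim have all $k_i$ odd and $l_i=k_i+1$; then $s_i=(k_i+1)/2$ for $1\le i\le m$. *)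

theory Defs
  imports "HOL-Analysis.Analysis" "HOL-Combinatorics.Permutations"
begin

text \<open>
  The space of column vectors with \<open>n = 2 * CARD('m)\<close> entries is indexed by \<open>'m + 'm\<close>: for a
  bijection \<open>nu\<close> from \<open>{1..CARD('m)}\<close> onto \<open>'m\<close>, the index \<open>Inl (nu i)\<close> is position \<open>i\<close> and
  \<open>Inr (nu i)\<close> is position \<open>m + i\<close>.
\<close>

type_synonym 'm cvec = "complex ^ ('m + 'm)"
type_synonym 'm cmat = "complex ^ ('m + 'm) ^ ('m + 'm)"

text \<open>A flag is the list \<open>[V\<^sub>1, \<dots>, V\<^sub>r]\<close>; the zero space at the start is omitted.\<close>

type_synonym 'm flag = "'m cvec set list"


section \<open>The quaternionic structure and the groups\<close>

definition Jmat :: "'m::finite cmat" where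
  "Jmat = (\<chi> a b. case (a, b) of
      (Inl i, Inr k) \<Rightarrow> if i = k then 1 else 0
    | (Inr i, Inl k) \<Rightarrow> if i = k then - 1 else 0
    | _ \<Rightarrow> 0)"

definition jj :: "'m::finite cvec \<Rightarrow> 'm cvec" where
  "jj v = Jmat *v (\<chi> a. cnj (v $ a))"

definition SL :: "'m::finite cmat set" where
  "SL = {g. det g = 1}"

definition SL_quat :: "'m::finite cmat set" where
  "SL_quat = {g \<in> SL. \<forall>v. jj (g *v v) = g *v jj v}"

definition SU :: "'m::finite cmat set" where
  "SU = {g \<in> SL. map_matrix cnj (transpose g) ** g = mat 1}"

definition Sp_compact :: "'m::finite cmat set" where
  "Sp_compact = SU \<inter> SL_quat"


section \<open>Flag manifolds\<close>

definition flag_manifold :: "nat list \<Rightarrow> 'm::finite flag set" where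
  "flag_manifold c = {F. length F = length c \<and> last ({0} # F) = UNIV \<and>
     (\<forall>i<length c. vec.subspace (F ! i) \<and> ({0} # F) ! i \<subseteq> F ! i \<and>
        vec.dim (F ! i) = vec.dim (({0} # F) ! i) + c ! i)}"

definition flag_of :: "nat list \<Rightarrow> (nat \<Rightarrow> 'm::finite cvec) \<Rightarrow> 'm flag" where
  "flag_of c b = map (\<lambda>k. vec.span (b ` {1..sum_list (take k c)})) [1..<Suc (length c)]"

definition act :: "'m::finite cmat \<Rightarrow> 'm flag \<Rightarrow> 'm flag" where
  "act g F = map (\<lambda>V. (\<lambda>v. g *v v) ` V) F"

definition orbit :: "'m::finite cmat set \<Rightarrow> 'm flag \<Rightarrow> 'm flag set" where
  "orbit H F = (\<lambda>g. act g F) ` H"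

text \<open>The quotient topology of \<open>G / P\<close>, written so that no base point has to be chosen.\<close>

definition flag_topology :: "nat list \<Rightarrow> 'm::finite flag topology" where
  "flag_topology c = topology (\<lambda>U. U \<subseteq> flag_manifold c \<and>
     (\<forall>F\<in>flag_manifold c. openin (top_of_set SL) {g \<in> SL. act g F \<in> U}))"

lemma openin_flag_topology:
  fixes U :: "'m::finite flag set"
  shows "openin (flag_topology c) U \<longleftrightarrow> U \<subseteq> flag_manifold c \<and>
     (\<forall>F\<in>flag_manifold c. openin (top_of_set SL) {g \<in> SL. act g F \<in> U})"
proof -
  have "istopology (\<lambda>U :: 'm flag set. U \<subseteq> flag_manifold c \<and>
     (\<forall>F\<in>flag_manifold c. openin (top_of_set SL) {g \<in> SL. act g F \<in> U}))"
    (is "istopology ?P")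
    unfolding istopology_def
  proof (intro conjI allI impI)
    fix S T :: "'m flag set" assume S: "?P S" and T: "?P T"
    show "S \<inter> T \<subseteq> flag_manifold c" using S by blast
    show "\<forall>F\<in>flag_manifold c. openin (top_of_set SL) {g \<in> SL. act g F \<in> S \<inter> T}"
    proof
      fix F :: "'m flag" assume "F \<in> flag_manifold c"
      then have "openin (top_of_set SL) ({g \<in> SL. act g F \<in> S} \<inter> {g \<in> SL. act g F \<in> T})"
        using S T by (intro openin_Int) auto
      moreover have "{g \<in> SL. act g F \<in> S} \<inter> {g \<in> SL. act g F \<in> T} = {g \<in> SL. act g F \<in> S \<inter> T}"
        by blast
      ultimately show "openin (top_of_set SL) {g \<in> SL. act g F \<in> S \<inter> T}" by simp
    qed
  next
    fix K :: "'m flag set set" assume K: "\<forall>S\<in>K. ?P S"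
    show "\<Union>K \<subseteq> flag_manifold c" using K by blast
    show "\<forall>F\<in>flag_manifold c. openin (top_of_set SL) {g \<in> SL. act g F \<in> \<Union>K}"
    proof
      fix F :: "'m flag" assume "F \<in> flag_manifold c"
      then have "openin (top_of_set SL) (\<Union>S\<in>K. {g \<in> SL. act g F \<in> S})"
        using K by (intro openin_Union) auto
      moreover have "(\<Union>S\<in>K. {g \<in> SL. act g F \<in> S}) = {g \<in> SL. act g F \<in> \<Union>K}"
        by blast
      ultimately show "openin (top_of_set SL) {g \<in> SL. act g F \<in> \<Union>K}" by simp
    qed
  qed
  then show ?thesis
    by (simp add: flag_topology_def topology_inverse')
qed


section \<open>Complex submanifolds and dimension\<close>

text \<open>The index set of the \<open>k\<close>-th block (counted from 0) of a dimension sequence.\<close>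

definition block :: "nat list \<Rightarrow> nat \<Rightarrow> nat set" where
  "block c k = {sum_list (take k c)<..sum_list (take (Suc k) c)}"

definition ordered_basis :: "(nat \<Rightarrow> 'm::finite cvec) \<Rightarrow> bool" where
  "ordered_basis b \<longleftrightarrow> vec.span (b ` {1..2 * CARD('m)}) = UNIV"

text \<open>
  The holomorphic charts of \<open>Z\<close>: relative to an ordered basis \<open>b\<close>, let \<open>chart_space c b\<close> be the
  strictly lower block triangular matrices.  Then \<open>X \<mapsto> (1 + X) F\<close>, with \<open>F\<close> the flag of \<open>b\<close>,
  parametrizes the big cell of \<open>Z\<close> centred at \<open>F\<close>, and these cells cover \<open>Z\<close>.
\<close>

definition chart_space :: "nat list \<Rightarrow> (nat \<Rightarrow> 'm::finite cvec) \<Rightarrow> 'm cmat set" where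
  "chart_space c b = {X. \<forall>k<length c. \<forall>i\<in>block c k.
     X *v b i \<in> vec.span (b ` {sum_list (take (Suc k) c)<..2 * CARD('m)})}"

definition chart :: "nat list \<Rightarrow> (nat \<Rightarrow> 'm::finite cvec) \<Rightarrow> 'm cmat \<Rightarrow> 'm flag" where
  "chart c b X = act (mat 1 + X) (flag_of c b)"

definition imult :: "'m::finite cmat \<Rightarrow> 'm cmat" where
  "imult X = map_matrix (\<lambda>z. \<i> * z) X"

definition complex_subspace :: "'m::finite cmat set \<Rightarrow> bool" where
  "complex_subspace L \<longleftrightarrow> subspace L \<and> imult ` L \<subseteq> L"

text \<open>Used below for sets that are open in a complex subspace.\<close>

definition holo_on :: "('m::finite cmat \<Rightarrow> 'm cmat) \<Rightarrow> 'm cmat set \<Rightarrow> bool" where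
  "holo_on f S \<longleftrightarrow> (\<forall>x\<in>S. \<exists>A. (f has_derivative A) (at x within S) \<and>
     (\<forall>y. A (imult y) = imult (A y)))"

text \<open>
  Embedded complex submanifolds of complex dimension \<open>d\<close>: near each point some chart can be composed
  with a biholomorphic map \<open>h\<close> that straightens \<open>M\<close> to a linear subspace \<open>L\<close>.  Here \<open>dim\<close> is the
  real dimension.
\<close>

definition complex_submanifold :: "nat list \<Rightarrow> nat \<Rightarrow> 'm::finite flag set \<Rightarrow> bool" where
  "complex_submanifold c d M \<longleftrightarrow> M \<subseteq> flag_manifold c \<and>
     (\<forall>F\<in>M. \<exists>b W W' h h' L. ordered_basis b \<and>
        openin (top_of_set (chart_space c b)) W \<and> openin (top_of_set (chart_space c b)) W' \<and>
        F \<in> chart c b ` W \<and>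
        homeomorphism W W' h h' \<and> holo_on h W \<and> holo_on h' W' \<and>
        complex_subspace L \<and> L \<subseteq> chart_space c b \<and> dim L = 2 * d \<and>
        h ` {X \<in> W. chart c b X \<in> M} = W' \<inter> L)"

text \<open>
  The dimension of an analytic set, which may be singular, is the largest dimension of a nonempty
  complex submanifold contained in it.
\<close>

definition analytic_dim :: "nat list \<Rightarrow> 'm::finite flag set \<Rightarrow> nat" where
  "analytic_dim c A = Sup {d. \<exists>M. M \<noteq> {} \<and> M \<subseteq> A \<and> complex_submanifold c d M}"


section \<open>Open orbit and base cycle\<close>

definition open_orbit :: "nat list \<Rightarrow> 'm::finite flag set \<Rightarrow> bool" where
  "open_orbit c D \<longleftrightarrow> (\<exists>F\<in>flag_manifold c. D = orbit SL_quat F) \<and> openin (flag_topology c) D"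

definition base_cycle :: "nat list \<Rightarrow> 'm::finite flag set \<Rightarrow> 'm flag set \<Rightarrow> bool" where
  "base_cycle c D C \<longleftrightarrow> (\<exists>F\<in>D. C = orbit Sp_compact F) \<and> (\<exists>d. complex_submanifold c d C)"


section \<open>Iwasawa--Schubert varieties\<close>

definition evec :: "(nat \<Rightarrow> 'm::finite) \<Rightarrow> nat \<Rightarrow> 'm cvec" where
  "evec nu i = axis (Inl (nu i)) 1"

definition ubasis :: "(nat \<Rightarrow> 'm::finite) \<Rightarrow> nat \<Rightarrow> 'm cvec" where
  "ubasis nu k = (if odd k then evec nu ((k + 1) div 2) else jj (evec nu (k div 2)))"

definition iwasawa_borel :: "(nat \<Rightarrow> 'm::finite) \<Rightarrow> 'm cmat set" where
  "iwasawa_borel nu = {g \<in> SL.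
     let F = flag_of (replicate (2 * CARD('m)) 1) (ubasis nu) in act g F = F}"

definition minimal_rep :: "nat list \<Rightarrow> (nat \<Rightarrow> nat) \<Rightarrow> bool" where
  "minimal_rep c w \<longleftrightarrow> w permutes {1..sum_list c} \<and>
     (\<forall>k<length c. strict_mono_on (block c k) w)"

definition schubert_variety ::
    "(nat \<Rightarrow> 'm::finite) \<Rightarrow> nat list \<Rightarrow> (nat \<Rightarrow> nat) \<Rightarrow> 'm flag set" where
  "schubert_variety nu c w =
     flag_topology c closure_of orbit (iwasawa_borel nu) (flag_of c (ubasis nu \<circ> w))"


section \<open>The permutation associated with a Schubert variety\<close>

fun split_blocks :: "nat list \<Rightarrow> 'a list \<Rightarrow> 'a list list" where
  "split_blocks [] xs = []"
| "split_blocks (l # ls) xs = take l xs # split_blocks ls (drop l xs)"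

text \<open>
  The one-line notation of \<open>w\<close>, rearranged, for \<open>ds = [d\<^sub>1, \<dots>, d\<^sub>s]\<close>.  The list \<open>mid\<close> is the middle block,
  empty if the dimension sequence has none; list positions are counted from 0, so the first, third,
  \dots entries are those at even positions.
\<close>

definition w_hat :: "nat list \<Rightarrow> nat \<Rightarrow> (nat \<Rightarrow> nat) \<Rightarrow> nat list" where
  "w_hat ds n w = (let ws = map w [1..<Suc n]; p = sum_list ds;
       mid = drop p (take (n - p) ws)
     in take p ws @ nths mid {i. even i} @ rev (nths mid {i. odd i}) @
        concat (map rev (split_blocks (rev ds) (drop (n - p) ws))))"

text \<open>\<open>k\<^sub>i\<close> is \<open>w_hat ds (2 * m) w ! (i - 1)\<close> and \<open>l\<^sub>i\<close> is \<open>w_hat ds (2 * m) w ! (2 * m - i)\<close>.\<close>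

definition corresponds :: "nat list \<Rightarrow> nat \<Rightarrow> (nat \<Rightarrow> nat) \<Rightarrow> (nat \<Rightarrow> nat) \<Rightarrow> bool" where
  "corresponds ds m w s \<longleftrightarrow> s permutes {1..m} \<and>
     (\<forall>i\<in>{1..m}. let k = w_hat ds (2 * m) w ! (i - 1); l = w_hat ds (2 * m) w ! (2 * m - i)
        in odd k \<and> l = k + 1 \<and> s i = (k + 1) div 2)"

definition sbasis :: "(nat \<Rightarrow> 'm::finite) \<Rightarrow> (nat \<Rightarrow> nat) \<Rightarrow> nat \<Rightarrow> 'm cvec" where
  "sbasis nu s i = (if i \<le> CARD('m) then evec nu (s i)
     else jj (evec nu (s (2 * CARD('m) + 1 - i))))"

end

theory Submission
  imports Defs "HOL-Computational_Algebra.Polynomial"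
begin

text \<open>
  Let \<open>p\<close> be the stabilizer of a flag \<open>F\<close> in \<open>gl(n)\<close>, \<open>b\<close> the Lie algebra of the Iwasawa--Borel
  subgroup and \<open>k = sp(2m, C)\<close>.  As \<open>b + k = gl(n)\<close>, the two orbits through \<open>F\<close> are transversal:
  \<open>dim b/(b \<inter> p) + dim k/(k \<inter> p) \<ge> dim Z\<close>, and equality forces \<open>b \<inter> k \<subseteq> p\<close>.  For \<open>F\<close> in the
  intersection of \<open>S\<^sub>w\<close> and \<open>C\<^sub>0\<close> the first summand is at most the number of inversions of \<open>w\<close>, by
  semicontinuity, and the second one is at most \<open>dim C\<^sub>0\<close>, because the tangent spaces of \<open>C\<^sub>0\<close> are
  complex.  Hence complementary dimensions force equality.  Now \<open>b \<inter> k\<close> contains a torus with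
  distinct weights on the \<open>u\<^sub>i\<close>, so \<open>F\<close> is spanned by coordinate vectors, and the rank conditions
  satisfied on \<open>S\<^sub>w\<close> leave only the flag of \<open>u \<circ> w\<close>.  That flag lies in the open orbit, so it is in
  general position with respect to \<open>j\<close>; this determines the shape of \<open>w\<close>.
\<close>

subsection \<open>Linear maps and flags\<close>

text \<open>All dimensions on the linear side are real, whence the factors 2. The analytic
  dimensions are never computed: a linear piece of the Schubert cell and \<open>C0\<close> itself
  bound two of them from below, the charts bound that of \<open>Z\<close> from above, and the
  hypothesis on dimensions closes the circle. The obstacle is that the group acting on
  \<open>C0\<close> is compact: its Lie algebra together with \<open>b\<close> is in general too
  small to fill \<open>gl(n)\<close>, so the transversality argument has to run with
  \<open>sp(2m, C)\<close>, although only curves in the compact group are available inside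
  \<open>C0\<close>. After the squeeze \<open>F\<close> is a coordinate flag with as many
  noninversions as \<open>w\<close> and at least the incidences of \<open>w\<close> with the Iwasawa
  flag; this forces equality, just as comparable elements of equal length in a Bruhat order
  coincide. The root vectors of \<open>b \<inter> k\<close> that send \<open>j(e_i)\<close> to a
  multiple of \<open>e_i\<close> put \<open>e_i\<close> no later than its partner, and general
  position puts partners into mirrored blocks; only the two together fix which value of each pair
  stands on the left.\<close>

lemma dim_image_lower_semicontinuous:
  fixes T :: "'g \<Rightarrow> 'a::euclidean_space \<Rightarrow> 'b::euclidean_space"
  assumes lin: "\<And>g. linear (T g)" and cont: "\<And>v. ((\<lambda>g. T g v) \<longlongrightarrow> T0 v) A"
    and lin0: "linear T0" and S: "subspace S"
  shows "eventually (\<lambda>g. dim (T0 ` S) \<le> dim (T g ` S)) A"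
proof -
  \<comment> \<open>\<open>R\<close> is a section of \<open>T0\<close> over its image. As soon as
    \<open>T g \<circ> R\<close> differs from the identity of that image by an operator of norm
    below 1, it is injective there, so the image under \<open>T g\<close> is at least as large. The
    sum of norms over the basis bounds the operator norm.\<close>
  obtain R where R: "range R \<subseteq> S" "linear R" "\<And>v. v \<in> T0 ` S \<Longrightarrow> T0 (R v) = v"
    using linear_exists_right_inverse_on[OF lin0 S] by auto
  have "((\<lambda>g. \<Sum>b\<in>Basis. norm (T g (R b) - T0 (R b))) \<longlongrightarrow> (\<Sum>b\<in>(Basis::'b set). norm (T0 (R b) - T0 (R b)))) A"
    by (intro tendsto_intros cont)
  then have "eventually (\<lambda>g. (\<Sum>b\<in>Basis. norm (T g (R b) - T0 (R b))) < 1) A"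
    by (auto dest: order_tendstoD(2)[of _ _ _ 1])
  then show ?thesis
  proof (rule eventually_mono)
    fix g assume small: "(\<Sum>b\<in>Basis. norm (T g (R b) - T0 (R b))) < 1"
    let ?D = "\<lambda>y. T g (R y) - T0 (R y)"
    have linD: "linear ?D"
      using lin[of g] lin0 R(2) by (intro linear_compose_sub) (auto simp: linear_compose[unfolded o_def])
    have bound: "norm (?D y) \<le> (\<Sum>b\<in>Basis. norm (?D b)) * norm y" for y
    proof -
      have "?D y = ?D (\<Sum>b\<in>Basis. (y \<bullet> b) *\<^sub>R b)" by (simp only: euclidean_representation)
      also have "\<dots> = (\<Sum>b\<in>Basis. (y \<bullet> b) *\<^sub>R ?D b)"
        using linear_sum[OF linD, of "\<lambda>b. (y \<bullet> b) *\<^sub>R b" Basis] linear_scale[OF linD] by simp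
      also have "norm \<dots> \<le> (\<Sum>b\<in>Basis. norm ((y \<bullet> b) *\<^sub>R ?D b))" by (rule norm_sum)
      also have "\<dots> \<le> (\<Sum>b\<in>Basis. norm (?D b) * norm y)"
        by (intro sum_mono) (simp add: Basis_le_norm mult.commute[of "norm (_ - _)"] mult_right_mono)
      finally show ?thesis by (simp add: sum_distrib_right)
    qed
    have sub: "subspace (T0 ` S)" using lin0 S by (rule linear_subspace_image)
    have inj: "inj_on (\<lambda>y. T g (R y)) (T0 ` S)"
    proof (rule inj_onI)
      fix x y assume x: "x \<in> T0 ` S" and y: "y \<in> T0 ` S" and eq: "T g (R x) = T g (R y)"
      define z where "z = x - y"
      have z: "z \<in> T0 ` S" unfolding z_def using sub x y by (rule subspace_diff)
      have "T g (R z) = 0" unfolding z_def using eq by (simp add: linear_diff[OF R(2)] linear_diff[OF lin])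
      then have "norm (?D z) = norm z" using R(3)[OF z] by simp
      then have "norm z \<le> (\<Sum>b\<in>Basis. norm (?D b)) * norm z" using bound[of z] by simp
      then have "norm z = 0" using small
        mult_strict_right_mono[OF small, of "norm z"] by fastforce
      then show "x = y" by (simp add: z_def)
    qed
    have linTR: "linear (\<lambda>y. T g (R y))" using linear_compose[OF R(2) lin[of g]] by (simp add: o_def)
    have "dim (T0 ` S) = dim ((\<lambda>y. T g (R y)) ` (T0 ` S))"
      using linTR inj sub by (metis dim_image_eq span_eq_iff)
    also have "\<dots> \<le> dim (T g ` S)"
      using R(1) by (intro dim_subset) auto
    finally show "dim (T0 ` S) \<le> dim (T g ` S)" .
  qed
qed

lemma bounded_bilinear_matrix_mult:
  "bounded_bilinear ((**) :: complex^'n^'m \<Rightarrow> complex^'p^'n \<Rightarrow> complex^'p^'m)"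
  unfolding bilinear_conv_bounded_bilinear[symmetric] bilinear_def
  by (auto intro!: linearI simp: vec_eq_iff matrix_matrix_mult_def sum.distrib algebra_simps scaleR_sum_right)

lemma bounded_bilinear_matrix_vector_mult:
  "bounded_bilinear ((*v) :: complex^'n^'m \<Rightarrow> complex^'n \<Rightarrow> complex^'m)"
  unfolding bilinear_conv_bounded_bilinear[symmetric] bilinear_def
  by (auto intro!: linearI simp: vec_eq_iff matrix_vector_mult_def sum.distrib algebra_simps scaleR_sum_right)

lemmas matmul_simps =
  bounded_bilinear.add_left[OF bounded_bilinear_matrix_mult]
  bounded_bilinear.add_right[OF bounded_bilinear_matrix_mult]
  bounded_bilinear.diff_left[OF bounded_bilinear_matrix_mult]
  bounded_bilinear.diff_right[OF bounded_bilinear_matrix_mult]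
  bounded_bilinear.minus_left[OF bounded_bilinear_matrix_mult]
  bounded_bilinear.minus_right[OF bounded_bilinear_matrix_mult]
  bounded_bilinear.scaleR_left[OF bounded_bilinear_matrix_mult]
  bounded_bilinear.scaleR_right[OF bounded_bilinear_matrix_mult]

lemmas matmul_zero [simp] =
  bounded_bilinear.zero_left[OF bounded_bilinear_matrix_mult]
  bounded_bilinear.zero_right[OF bounded_bilinear_matrix_mult]

lemma linear_matmul_left: "linear (\<lambda>X. (A :: complex^'n^'m) ** X)"
  by (simp add: bounded_bilinear.bounded_linear_right[OF bounded_bilinear_matrix_mult] bounded_linear.linear)

lemma linear_matmul_right: "linear (\<lambda>X. X ** (A :: complex^'n^'m))"
  by (simp add: bounded_bilinear.bounded_linear_left[OF bounded_bilinear_matrix_mult] bounded_linear.linear)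

lemma linear_conj: "linear (\<lambda>X. A ** X ** (B :: complex^'n^'m))"
  using linear_compose[OF linear_matmul_left linear_matmul_right] by (simp add: o_def)

lemma matrix_invE:
  fixes g :: "complex^'n^'n"
  assumes "invertible g" obtains h where "g ** h = mat 1" "h ** g = mat 1" "invertible h"
  using assms unfolding invertible_def by blast

lemma invertible_of_ker:
  fixes g :: "complex^'n^'n"
  assumes "\<And>v. g *v v = 0 \<Longrightarrow> v = 0" shows "invertible g"
  using assms invertible_left_inverse matrix_left_invertible_ker by blast

section \<open>Flags from adapted bases and the action of the matrix group\<close>

lemma sum_list_take_mono: "i \<le> j \<Longrightarrow> sum_list (take i c) \<le> sum_list (take j (c::nat list))"
proof -
  assume "i \<le> j"
  then obtain k where "j = i + k" using le_Suc_ex by blast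
  then show ?thesis by (simp add: take_add)
qed

lemma sum_list_take_Suc: "k < length c \<Longrightarrow> sum_list (take (Suc k) c) = sum_list (take k c) + (c ! k :: nat)"
  by (simp add: take_Suc_conv_app_nth)

lemma length_flag_of [simp]: "length (flag_of c b) = length c"
  by (simp add: flag_of_def del: upt_Suc)

lemma flag_of_nth: "k < length c \<Longrightarrow> flag_of c b ! k = vec.span (b ` {1..sum_list (take (Suc k) c)})"
  by (simp add: flag_of_def del: upt_Suc)

lemma length_act [simp]: "length (act g F) = length F"
  by (simp add: act_def)

lemma act_nth: "k < length F \<Longrightarrow> act g F ! k = (*v) g ` (F ! k)"
  by (simp add: act_def)

lemma act_act: "act g (act h F) = act (g ** h) F"
  by (simp add: act_def o_def image_image matrix_vector_mul_assoc)

lemma act_one [simp]: "act (mat 1) F = F"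
  by (simp add: act_def)

lemma act_flag_of: "act g (flag_of c b) = flag_of c (\<lambda>i. g *v b i)"
proof (rule nth_equalityI)
  fix k assume "k < length (act g (flag_of c b))"
  then have k: "k < length c" by simp
  have "(*v) g ` vec.span (b ` {1..sum_list (take (Suc k) c)}) =
      vec.span ((*v) g ` b ` {1..sum_list (take (Suc k) c)})"
    by (rule vec.linear_span_image[OF matrix_vector_mul_linear_gen, symmetric])
  then show "act g (flag_of c b) ! k = flag_of c (\<lambda>i. g *v b i) ! k"
    using k by (simp add: act_nth flag_of_nth image_image)
qed simp

lemma subspace_matrix_image: "vec.subspace V \<Longrightarrow> vec.subspace ((*v) g ` V)"
  by (rule vec.linear_subspace_image[OF matrix_vector_mul_linear_gen])

lemma act_flag_manifold:
  assumes g: "invertible g" and F: "F \<in> flag_manifold c"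
  shows "act g F \<in> flag_manifold c"
proof -
  obtain h where h: "g ** h = mat 1" "h ** g = mat 1" using g by (rule matrix_invE)
  have inj: "inj ((*v) g)" by (rule inj_matrix_vector_mult[OF g])
  have nth: "({0} # act g F) ! i = (*v) g ` (({0} # F) ! i)" if "i \<le> length c" for i
    using that F by (cases i) (auto simp: flag_manifold_def act_nth)
  have dm: "vec.dim ((*v) g ` V) = vec.dim V" for V :: "'a cvec set"
    by (rule vec.dim_image_eq[OF matrix_vector_mul_linear_gen]) (use inj in \<open>auto intro: inj_on_subset\<close>)
  have "last ({0} # act g F) = (*v) g ` last ({0} # F)"
    using F by (simp add: act_def last_map)
  then have "last ({0} # act g F) = UNIV"
    using F h surjI[of "(*v) g" "(*v) h"] by (simp add: flag_manifold_def matrix_vector_mul_assoc)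
  moreover have "vec.subspace (act g F ! i) \<and> ({0} # act g F) ! i \<subseteq> act g F ! i \<and>
        vec.dim (act g F ! i) = vec.dim (({0} # act g F) ! i) + c ! i" if "i < length c" for i
  proof -
    have "vec.subspace (F ! i)" "({0} # F) ! i \<subseteq> F ! i" "vec.dim (F ! i) = vec.dim (({0} # F) ! i) + c ! i"
      "length F = length c"
      using F that by (auto simp: flag_manifold_def)
    moreover have "act g F ! i = (*v) g ` (F ! i)" using that calculation by (simp add: act_nth)
    moreover have "({0} # act g F) ! i = (*v) g ` (({0} # F) ! i)" using that by (intro nth) simp
    ultimately show ?thesis by (simp only: dm subspace_matrix_image image_mono simp_thms)
  qed
  ultimately show ?thesis
    using F unfolding flag_manifold_def by simp
qed

lemma flag_manifold_subspace: "F \<in> flag_manifold c \<Longrightarrow> i < length c \<Longrightarrow> vec.subspace (F ! i)"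
  by (auto simp: flag_manifold_def)

lemma flag_manifold_length: "F \<in> flag_manifold c \<Longrightarrow> length F = length c"
  by (auto simp: flag_manifold_def)

lemma flag_manifold_dim:
  assumes "F \<in> flag_manifold c" "k \<le> length c"
  shows "vec.dim (({0} # F) ! k) = sum_list (take k c)"
  using assms(2)
proof (induction k)
  case 0
  then show ?case by simp
next
  case (Suc k)
  then show ?case using assms(1) by (simp add: flag_manifold_def sum_list_take_Suc)
qed

text \<open>Existence of an adapted basis, by extending a basis of each member to the next. The
  induction carries a function on positions, injective on an initial segment, and keeps its earlier
  values, since all previous spans must survive the extension.\<close>

lemma flag_manifold_eq_flag_of:
  fixes F :: "'m::finite flag"
  assumes F: "F \<in> flag_manifold c" and n: "sum_list c = 2 * CARD('m)"
  shows "\<exists>b. ordered_basis b \<and> F = flag_of c b"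
proof -
  have "\<exists>b. inj_on b {1..sum_list (take k c)} \<and> vec.independent (b ` {1..sum_list (take k c)}) \<and>
     (\<forall>l\<le>k. vec.span (b ` {1..sum_list (take l c)}) = ({0} # F) ! l)" if "k \<le> length c" for k
    using that
  proof (induction k)
    case 0
    then show ?case by (auto simp: vec.independent_empty)
  next
    case (Suc k)
    then obtain b where b: "inj_on b {1..sum_list (take k c)}" "vec.independent (b ` {1..sum_list (take k c)})"
      "\<forall>l\<le>k. vec.span (b ` {1..sum_list (take l c)}) = ({0} # F) ! l" by auto
    let ?s = "sum_list (take k c)" and ?s' = "sum_list (take (Suc k) c)"
    have k: "k < length c" using Suc by simp
    have sub: "({0} # F) ! k \<subseteq> F ! k" "vec.subspace (F ! k)" using F k by (auto simp: flag_manifold_def)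
    have "b ` {1..?s} \<subseteq> F ! k" using b(3) sub(1) vec.span_superset[of "b ` {1..?s}"] by auto
    then obtain B where B: "b ` {1..?s} \<subseteq> B" "B \<subseteq> F ! k" "vec.independent B" "F ! k \<subseteq> vec.span B"
      by (rule vec.maximal_independent_subset_extend[OF _ b(2)])
    have spanB: "vec.span B = F ! k"
      by (rule vec.span_subspace[OF B(2,4) sub(2)])
    have finB: "finite B" using B(3) by (rule vec.finiteI_independent)
    have "card B = vec.dim (F ! k)" by (metis B(2,3,4) vec.basis_card_eq_dim)
    then have cardB: "card B = ?s'" using flag_manifold_dim[OF F Suc.prems] by simp
    have ss: "?s \<le> ?s'" by (rule sum_list_take_mono) simp
    have "card (B - b ` {1..?s}) = card {?s<..?s'}"
      using B(1) finB cardB b(1) by (simp add: card_Diff_subset card_image)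
    then obtain f where f: "bij_betw f {?s<..?s'} (B - b ` {1..?s})"
      by (metis finB finite_Diff finite_greaterThanAtMost finite_same_card_bij)
    define b' where "b' = (\<lambda>i. if i \<le> ?s then b i else f i)"
    have im1: "b' ` {1..s} = b ` {1..s}" if "s \<le> ?s" for s
      using that by (auto simp: b'_def)
    have "bij_betw b' {1..?s} (b ` {1..?s})"
      using b(1) by (auto simp: b'_def inj_on_def bij_betw_def)
    moreover have "bij_betw b' {?s<..?s'} (B - b ` {1..?s})"
      using f by (rule bij_betw_cong[THEN iffD1, rotated]) (auto simp: b'_def)
    ultimately have "bij_betw b' ({1..?s} \<union> {?s<..?s'}) (b ` {1..?s} \<union> (B - b ` {1..?s}))"
      by (rule bij_betw_combine) auto
    moreover have "{1..?s} \<union> {?s<..?s'} = {1..?s'}" using ss by auto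
    moreover have "b ` {1..?s} \<union> (B - b ` {1..?s}) = B" using B(1) by auto
    ultimately have bij: "bij_betw b' {1..?s'} B" by simp
    have "vec.span (b' ` {1..sum_list (take l c)}) = ({0} # F) ! l" if "l \<le> Suc k" for l
    proof (cases "l = Suc k")
      case True
      then show ?thesis using bij spanB by (simp add: bij_betw_def)
    next
      case False
      then have "l \<le> k" using that by simp
      then show ?thesis using b(3) im1[OF sum_list_take_mono] by simp
    qed
    then show ?case using bij B(3) by (auto simp: bij_betw_def)
  qed
  from this[of "length c"] obtain b where b: "\<forall>l\<le>length c. vec.span (b ` {1..sum_list (take l c)}) = ({0} # F) ! l"
    by auto
  have len: "length F = length c" using F by (rule flag_manifold_length)
  have "F = flag_of c b"
  proof (rule nth_equalityI)
    fix i assume "i < length F"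
    then show "F ! i = flag_of c b ! i" using b len by (auto simp: flag_of_nth)
  qed (simp add: len)
  moreover have "last ({0} # F) = ({0} # F) ! length c" by (subst last_conv_nth) (auto simp: len)
  then have "({0} # F) ! length c = UNIV" using F by (simp only: flag_manifold_def mem_Collect_eq)
  then have "ordered_basis b" using b n by (auto simp: ordered_basis_def)
  ultimately show ?thesis by blast
qed

lemma ordered_basis_independent:
  fixes b :: "nat \<Rightarrow> 'm::finite cvec"
  assumes "ordered_basis b"
  shows "inj_on b {1..2 * CARD('m)}" "vec.independent (b ` {1..2 * CARD('m)})"
proof -
  have sp: "vec.span (b ` {1..2 * CARD('m)}) = UNIV" using assms by (simp add: ordered_basis_def)
  have dim: "vec.dim (UNIV :: 'm cvec set) = 2 * CARD('m)" by (simp only: vec_dim_card) simp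
  have "2 * CARD('m) \<le> card (b ` {1..2 * CARD('m)})"
    using vec.dim_le_card[of UNIV "b ` {1..2 * CARD('m)}"] sp dim by simp
  moreover have "card (b ` {1..2 * CARD('m)}) \<le> 2 * CARD('m)" using card_image_le[of "{1..2 * CARD('m)}" b] by simp
  ultimately have eq: "card (b ` {1..2 * CARD('m)}) = 2 * CARD('m)" by simp
  then show "inj_on b {1..2 * CARD('m)}" by (simp add: eq_card_imp_inj_on)
  show "vec.independent (b ` {1..2 * CARD('m)})"
    by (rule vec.card_le_dim_spanning[of _ UNIV]) (use sp dim eq in auto)
qed

lemma ordered_basis_transform:
  fixes a b :: "nat \<Rightarrow> 'm::finite cvec"
  assumes a: "ordered_basis a" and b: "ordered_basis b"
  shows "\<exists>g. invertible g \<and> (\<forall>i\<in>{1..2 * CARD('m)}. g *v a i = b i)"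
proof -
  let ?I = "{1..2 * CARD('m)}"
  obtain f where f: "Vector_Spaces.linear (*s) (*s) f" "\<forall>x\<in>a ` ?I. f x = (b \<circ> inv_into ?I a) x"
    using vec.linear_independent_extend[OF ordered_basis_independent(2)[OF a]] by blast
  have m: "matrix f *v x = f x" for x using matrix_works[OF f(1)] by simp
  have fa: "matrix f *v a i = b i" if "i \<in> ?I" for i
    using that f(2) m ordered_basis_independent(1)[OF a] by simp
  have "UNIV = vec.span ((*v) (matrix f) ` a ` ?I)"
    using b fa by (simp add: ordered_basis_def image_image)
  also have "\<dots> = (*v) (matrix f) ` vec.span (a ` ?I)"
    by (rule vec.linear_span_image[OF matrix_vector_mul_linear_gen])
  finally have "surj ((*v) (matrix f))" using a by (simp add: ordered_basis_def)
  then have "invertible (matrix f)"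
    by (simp add: invertible_right_inverse matrix_right_invertible_surjective)
  then show ?thesis using fa by blast
qed

lemma surj_matrix_vector: "invertible (g :: complex^'n^'n) \<Longrightarrow> surj ((*v) g)"
  by (metis matrix_invE matrix_vector_mul_assoc matrix_vector_mul_lid surjI)

lemma flag_of_cong:
  assumes "sum_list c = n" "\<And>i. i \<in> {1..n} \<Longrightarrow> a i = b i"
  shows "flag_of c a = flag_of c b"
proof (rule nth_equalityI)
  fix k assume "k < length (flag_of c a)"
  then have k: "k < length c" by simp
  have "sum_list (take (Suc k) c) \<le> n" using sum_list_take_mono[of "Suc k" "length c" c] k assms(1) by simp
  then have "a ` {1..sum_list (take (Suc k) c)} = b ` {1..sum_list (take (Suc k) c)}"
    using assms(2) by (intro image_cong) auto
  then show "flag_of c a ! k = flag_of c b ! k" using k by (simp add: flag_of_nth)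
qed simp

lemma flag_manifold_transitive:
  fixes F :: "'m::finite flag"
  assumes "F \<in> flag_manifold c" "sum_list c = 2 * CARD('m)" "ordered_basis a"
  shows "\<exists>g. invertible g \<and> F = act g (flag_of c a)"
proof -
  obtain b where b: "ordered_basis b" "F = flag_of c b" using flag_manifold_eq_flag_of assms by blast
  obtain g where g: "invertible g" "\<forall>i\<in>{1..2 * CARD('m)}. g *v a i = b i"
    using ordered_basis_transform[OF assms(3) b(1)] by blast
  have "F = act g (flag_of c a)"
    unfolding b(2) act_flag_of by (rule flag_of_cong[OF assms(2)]) (use g in auto)
  then show ?thesis using g by blast
qed

lemma flag_of_in_flag_manifold:
  fixes b :: "nat \<Rightarrow> 'm::finite cvec"
  assumes b: "ordered_basis b" and n: "sum_list c = 2 * CARD('m)"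
  shows "flag_of c b \<in> flag_manifold c"
proof -
  let ?s = "\<lambda>k. sum_list (take k c)"
  have nth: "({0} # flag_of c b) ! k = vec.span (b ` {1..?s k})" if "k \<le> length c" for k
    using that by (cases k) (auto simp: flag_of_nth)
  have le: "?s k \<le> 2 * CARD('m)" for k
    using sum_list_take_mono[of k "max k (length c)" c] n by simp
  have dim: "vec.dim (vec.span (b ` {1..?s k})) = ?s k" for k
  proof -
    have sub: "{1..?s k} \<subseteq> {1..2 * CARD('m)}" using le by auto
    have "vec.dim (vec.span (b ` {1..?s k})) = card (b ` {1..?s k})"
      using vec.independent_mono[OF ordered_basis_independent(2)[OF b] image_mono[OF sub]]
      by (simp add: vec.dim_eq_card_independent)
    also have "\<dots> = ?s k"
      using inj_on_subset[OF ordered_basis_independent(1)[OF b] sub] by (simp add: card_image)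
    finally show ?thesis .
  qed
  have "last ({0} # flag_of c b) = ({0} # flag_of c b) ! length c"
    by (subst last_conv_nth) auto
  also have "\<dots> = UNIV" using b n by (simp only: nth) (simp add: ordered_basis_def)
  moreover have "vec.subspace (flag_of c b ! i) \<and> ({0} # flag_of c b) ! i \<subseteq> flag_of c b ! i \<and>
        vec.dim (flag_of c b ! i) = vec.dim (({0} # flag_of c b) ! i) + c ! i" if "i < length c" for i
  proof -
    have "?s i \<le> ?s (Suc i)" by (rule sum_list_take_mono) simp
    then have "vec.span (b ` {1..?s i}) \<subseteq> vec.span (b ` {1..?s (Suc i)})"
      by (intro vec.span_mono image_mono) auto
    moreover have "flag_of c b ! i = vec.span (b ` {1..?s (Suc i)})" using that by (simp add: flag_of_nth)
    moreover have "({0} # flag_of c b) ! i = vec.span (b ` {1..?s i})" using that by (intro nth) simp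
    moreover have "?s (Suc i) = ?s i + c ! i" using that by (rule sum_list_take_Suc)
    moreover note dim[of "Suc i"] dim[of i]
    ultimately show ?thesis by (simp only: vec.subspace_span simp_thms)
  qed
  ultimately show ?thesis unfolding flag_manifold_def by simp
qed

lemma mat_mult_vector: "mat z *v v = z *s v" for v :: "complex^'n"
  by (simp add: vec_eq_iff matrix_vector_mult_def mat_def if_distrib[of "\<lambda>x. x * _"] cong: if_cong)

text \<open>Scalars act trivially on flags, so an invertible matrix may be replaced by a multiple in
  \<open>SL\<close>, the group through which the flag topology and the Borel orbits are
  defined.\<close>

lemma act_scale:
  assumes "z \<noteq> 0" "\<And>V. V \<in> set F \<Longrightarrow> vec.subspace V"
  shows "act (mat z ** g) F = act g F"
proof -
  have "(\<lambda>v. (mat z ** g) *v v) ` V = (\<lambda>v. g *v v) ` V" if "vec.subspace V" for V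
  proof -
    have W: "vec.subspace ((*v) g ` V)" using that by (rule subspace_matrix_image)
    have "(\<lambda>v. (mat z ** g) *v v) ` V = (*s) z ` ((*v) g ` V)"
      by (simp add: image_image matrix_vector_mul_assoc[symmetric] mat_mult_vector)
    also have "\<dots> = (*v) g ` V"
    proof (intro equalityI subsetI)
      fix x assume "x \<in> (*s) z ` ((*v) g ` V)" then show "x \<in> (*v) g ` V"
        using vec.subspace_scale[OF W] by auto
    next
      fix x assume x: "x \<in> (*v) g ` V"
      have "x = z *s (inverse z *s x)" using assms(1) by simp
      then show "x \<in> (*s) z ` ((*v) g ` V)" using vec.subspace_scale[OF W x] by blast
    qed
    finally show ?thesis .
  qed
  then show ?thesis using assms(2) by (auto simp: act_def)
qed

text \<open>An n-th root of \<open>1 / det g\<close>. The principal logarithm makes it continuous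
  near the identity, on which \<open>open_contains_generic\<close> relies.\<close>

definition det_normalizer :: "'m::finite cmat \<Rightarrow> complex" where
  "det_normalizer g = exp (- Ln (det g) / of_nat (2 * CARD('m)))"

lemma det_mat: "det (mat z :: 'm::finite cmat) = z ^ (2 * CARD('m))"
proof -
  have "det (mat z :: 'm cmat) = prod (\<lambda>i. (mat z :: 'm cmat) $ i $ i) UNIV"
    by (rule det_diagonal) (simp add: mat_def)
  then show ?thesis by (simp add: mat_def mult_2[symmetric])
qed

lemma det_normalizer_SL:
  assumes "invertible (g :: 'm::finite cmat)"
  shows "mat (det_normalizer g) ** g \<in> SL"
proof -
  have d: "det g \<noteq> 0" using assms invertible_det_nz by blast
  have "det_normalizer g ^ (2 * CARD('m)) = exp (- Ln (det g))"
    unfolding det_normalizer_def exp_of_nat_mult[symmetric] by simp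
  then show ?thesis using d by (simp add: SL_def det_mul det_mat exp_minus)
qed

lemma det_normalizer_nonzero [simp]: "det_normalizer g \<noteq> 0"
  by (simp add: det_normalizer_def)

lemma act_det_normalizer:
  assumes "F \<in> flag_manifold c"
  shows "act (mat (det_normalizer g) ** g) F = act g F"
  by (intro act_scale)
    (auto simp: in_set_conv_nth flag_manifold_length[OF assms] intro: flag_manifold_subspace[OF assms])

subsection \<open>Stabilizers\<close>

text \<open>Taken in the full matrix algebra and not in the group: this is a linear space, and for a
  flag in the manifold its invertible members are exactly the invertible matrices fixing the flag
  (\<open>act_stab\<close>, \<open>act_fixed_stab\<close>).\<close>

definition stab :: "'m::finite flag \<Rightarrow> 'm cmat set" where
  "stab F = {X. \<forall>i<length F. \<forall>v\<in>F ! i. X *v v \<in> F ! i}"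

lemma vec_subspace_imp_subspace: "vec.subspace V \<Longrightarrow> subspace (V :: (complex^'n) set)"
proof -
  assume V: "vec.subspace V"
  have "c *\<^sub>R x = complex_of_real c *s x" for c and x :: "complex^'n" by (simp add: vec_eq_iff scaleR_conv_of_real[where 'a=complex])
  then show ?thesis using V vec.subspace_0[OF V] vec.subspace_add[OF V] vec.subspace_scale[OF V]
    by (auto intro!: subspaceI)
qed

lemma subspace_stab:
  assumes "F \<in> flag_manifold c" shows "subspace (stab F)"
proof -
  have *: "subspace (F ! i)" if "i < length F" for i
    using assms that by (metis flag_manifold_length flag_manifold_subspace vec_subspace_imp_subspace)
  show ?thesis
    unfolding stab_def
    by (intro subspaceI)
      (auto simp: * subspace_0 subspace_add subspace_scale matrix_vector_mult_add_rdistrib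
       bounded_bilinear.scaleR_left[OF bounded_bilinear_matrix_vector_mult])
qed

lemma stab_act:
  assumes "g ** h = mat 1" "h ** g = mat 1"
  shows "stab (act g F) = (\<lambda>X. g ** X ** h) ` stab F"
proof (intro equalityI subsetI)
  fix X assume X: "X \<in> stab (act g F)"
  have "h ** X ** g \<in> stab F"
    unfolding stab_def
  proof (intro CollectI allI impI ballI)
    fix i v assume i: "i < length F" and v: "v \<in> F ! i"
    then have "X *v (g *v v) \<in> (*v) g ` (F ! i)" using X by (auto simp: stab_def act_nth)
    then obtain w where w: "w \<in> F ! i" "X *v (g *v v) = g *v w" by auto
    have "(h ** X ** g) *v v = (h ** g) *v w" using w(2) by (simp add: matrix_vector_mul_assoc[symmetric])
    then show "(h ** X ** g) *v v \<in> F ! i" using w assms by simp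
  qed
  moreover have "X = g ** (h ** X ** g) ** h"
    using assms by (metis matrix_mul_assoc matrix_mul_lid matrix_mul_rid)
  ultimately show "X \<in> (\<lambda>X. g ** X ** h) ` stab F" by blast
next
  fix X assume "X \<in> (\<lambda>X. g ** X ** h) ` stab F"
  then obtain Y where Y: "Y \<in> stab F" "X = g ** Y ** h" by blast
  have "(g ** Y ** h) *v (g *v w) = g *v (Y *v w)" for w
    using assms(2) by (metis matrix_vector_mul_assoc matrix_vector_mul_lid)
  then show "X \<in> stab (act g F)" using Y by (auto simp: stab_def act_nth)
qed

lemma inj_conj:
  assumes "g ** h = mat 1" "h ** g = mat 1"
  shows "inj (\<lambda>X. g ** X ** (h :: complex^'n^'n))"
proof (rule injI)
  fix X Y assume "g ** X ** h = g ** Y ** h"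
  then have "h ** (g ** X ** h) ** g = h ** (g ** Y ** h) ** g" by simp
  then show "X = Y" using assms by (metis matrix_mul_assoc matrix_mul_lid matrix_mul_rid)
qed

lemma dim_conj:
  assumes "g ** h = mat 1" "h ** g = mat 1"
  shows "dim ((\<lambda>X. g ** X ** (h :: complex^'n^'n)) ` S) = dim S"
  using dim_image_eq[OF linear_conj inj_on_subset[OF inj_conj[OF assms] subset_UNIV]] by blast

lemma dim_stab_act:
  assumes "invertible g" shows "dim (stab (act g F)) = dim (stab F)"
proof -
  obtain h where h: "g ** h = mat 1" "h ** g = mat 1" using assms by (rule matrix_invE)
  show ?thesis unfolding stab_act[OF h] by (rule dim_conj[OF h])
qed

lemma act_stab:
  assumes F: "F \<in> flag_manifold c" and g: "invertible g" "g \<in> stab F"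
  shows "act g F = F"
proof (rule nth_equalityI)
  fix i assume "i < length (act g F)"
  then have i: "i < length F" by simp
  have V: "vec.subspace (F ! i)" using F i by (metis flag_manifold_length flag_manifold_subspace)
  have "vec.dim ((*v) g ` (F ! i)) = vec.dim (F ! i)"
    by (rule vec.dim_image_eq[OF matrix_vector_mul_linear_gen])
      (use inj_matrix_vector_mult[OF g(1)] in \<open>auto intro: inj_on_subset\<close>)
  moreover have "(*v) g ` (F ! i) \<subseteq> F ! i" using g(2) i by (auto simp: stab_def)
  ultimately show "act g F ! i = F ! i"
    using vec.subspace_dim_equal[OF subspace_matrix_image[OF V] V, of g] i by (simp add: act_nth)
qed simp

subsection \<open>Coordinate flags\<close>

text \<open>The coordinate carrying \<open>u_k\<close>: since \<open>j\<close> sends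
  \<open>e_i\<close> to minus another standard vector, the Iwasawa basis is the standard one up to
  order and sign (\<open>ubasis_eq\<close>).\<close>

definition idx :: "(nat \<Rightarrow> 'm) \<Rightarrow> nat \<Rightarrow> 'm + 'm" where
  "idx nu k = (if odd k then Inl (nu ((k + 1) div 2)) else Inr (nu (k div 2)))"

definition coord_space :: "('m + 'm) set \<Rightarrow> 'm::finite cvec set" where
  "coord_space I = {v. \<forall>x. x \<notin> I \<longrightarrow> v $ x = 0}"

text \<open>Spans of matrix units. The Borel algebra, the stabilizers of coordinate flags and the
  chart spaces at such flags all have this form, which turns intersections into conjunctions and
  dimensions into cardinalities.\<close>

definition coord_matrices :: "('n \<Rightarrow> 'n \<Rightarrow> bool) \<Rightarrow> (complex^'n^'n) set" where
  "coord_matrices R = {X. \<forall>x y. \<not> R x y \<longrightarrow> X $ x $ y = 0}"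

definition pos_block :: "nat list \<Rightarrow> nat \<Rightarrow> nat" where
  "pos_block c i = (LEAST k. i \<le> sum_list (take (Suc k) c))"

lemma jj_nth [simp]:
  "jj v $ Inl i = cnj (v $ Inr i)" "jj v $ Inr i = - cnj (v $ Inl i)"
proof -
  have s: "(\<Sum>x\<in>UNIV. g x) = (\<Sum>i\<in>UNIV. g (Inl i)) + (\<Sum>i\<in>UNIV. g (Inr i))" for g :: "'a + 'a \<Rightarrow> complex"
    by (simp add: UNIV_sum sum.union_disjoint sum.reindex[of Inl] sum.reindex[of Inr] image_Int[symmetric] o_def)
      (subst sum.union_disjoint, auto simp: sum.reindex)
  show "jj v $ Inl i = cnj (v $ Inr i)" "jj v $ Inr i = - cnj (v $ Inl i)"
    by (auto simp: jj_def matrix_vector_mult_def Jmat_def s if_distrib[of "\<lambda>x. x * _"] cong: if_cong)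
qed

lemma vec_sum_eqI: 
  fixes v w :: "'a^('m::finite + 'm)"
  assumes "\<And>i. v $ Inl i = w $ Inl i" "\<And>i. v $ Inr i = w $ Inr i" shows "v = w"
  unfolding vec_eq_iff
proof
  fix x show "v $ x = w $ x" using assms by (cases x) auto
qed

lemma axis_nth': "axis i x $ j = (if j = i then x else 0)"
  by (simp add: axis_def)

lemma ubasis_eq: "ubasis nu k = (if odd k then 1 else - 1) *s axis (idx nu k) 1"
  by (auto simp: ubasis_def idx_def evec_def axis_nth' intro!: vec_sum_eqI)

lemma vec_subspace_coord_space: "vec.subspace (coord_space I)"
  by (auto intro!: vec.subspaceI simp: coord_space_def)

lemma span_scaled_axes:
  assumes z: "\<And>i. i \<in> A \<Longrightarrow> z i \<noteq> 0" and b: "\<And>i. i \<in> A \<Longrightarrow> b i = z i *s axis (p i) 1"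
  shows "vec.span (b ` A) = coord_space (p ` A)"
proof (rule vec.span_unique[OF _ vec_subspace_coord_space])
  show "b ` A \<subseteq> coord_space (p ` A)"
    using b by (auto simp: coord_space_def axis_nth')
next
  fix T assume T: "b ` A \<subseteq> T" "vec.subspace T"
  have ax: "axis (p i) 1 \<in> T" if "i \<in> A" for i
  proof -
    have "inverse (z i) *s b i \<in> T" using T that by (auto intro!: vec.subspace_scale)
    moreover have "inverse (z i) *s b i = axis (p i) 1" using z[OF that] b[OF that] by simp
    ultimately show ?thesis by simp
  qed
  show "coord_space (p ` A) \<subseteq> T"
  proof
    fix v assume v: "v \<in> coord_space (p ` A)"
    have "v = (\<Sum>x\<in>UNIV. v $ x *s axis x 1)" by (simp add: basis_expansion)
    also have "\<dots> \<in> T"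
    proof (rule vec.subspace_sum[OF T(2)])
      fix x show "v $ x *s axis x 1 \<in> T"
      proof (cases "x \<in> p ` A")
        case True then show ?thesis using ax T(2) by (auto intro!: vec.subspace_scale)
      next
        case False then have "v $ x = 0" using v by (simp add: coord_space_def)
        then show ?thesis using T(2) by (simp add: vec.subspace_0)
      qed
    qed
    finally show "v \<in> T" .
  qed
qed

lemma subspace_coord_matrices: "subspace (coord_matrices R)"
  by (auto intro!: subspaceI simp: coord_matrices_def)

lemma coord_matrices_Int: "coord_matrices R \<inter> coord_matrices S = coord_matrices (\<lambda>x y. R x y \<and> S x y)"
  by (auto simp: coord_matrices_def)

text \<open>Each free complex coordinate contributes two real basis elements, along \<open>1\<close>
  and \<open>\<i>\<close>. The embedding \<open>e\<close> is abstract so that vectors and matrices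
  are covered at once.\<close>

lemma dim_vanishing_coordinates:
  fixes e :: "'i::finite \<Rightarrow> complex \<Rightarrow> 'a::euclidean_space" and p :: "'a \<Rightarrow> 'i \<Rightarrow> complex"
  assumes B: "Basis = {e j u | j u. u \<in> {1, \<i>}}"
    and inj: "\<And>j u j' u'. u \<in> {1, \<i>} \<Longrightarrow> e j u = e j' u' \<Longrightarrow> j = j' \<and> u = u'"
    and p: "\<And>X j u. X \<bullet> e j u = p X j \<bullet> u"
  shows "dim {X. \<forall>j. j \<notin> I \<longrightarrow> p X j = 0} = 2 * card I"
proof -
  let ?P = "I \<times> {1, \<i>}"
  let ?d = "(\<lambda>(j, u). e j u) ` ?P"
  have mem: "e j u \<in> ?d \<longleftrightarrow> j \<in> I" if u: "u \<in> {1, \<i>}" for j u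
  proof
    assume "e j u \<in> ?d"
    then obtain j' u' where "j' \<in> I" "e j u = e j' u'" by auto
    then show "j \<in> I" using inj[OF u, of j j' u'] by simp
  next
    assume "j \<in> I" then have "(j, u) \<in> ?P" using u by simp
    then show "e j u \<in> ?d" by (rule rev_image_eqI) simp
  qed
  have zero: "(\<forall>u\<in>{1, \<i>}. Q \<longrightarrow> z \<bullet> u = 0) \<longleftrightarrow> (Q \<longrightarrow> z = 0)" for z Q
    by (auto simp: inner_complex_def complex_eq_iff[of z 0])
  have "(\<forall>i\<in>Basis. i \<notin> ?d \<longrightarrow> X \<bullet> i = 0) \<longleftrightarrow> (\<forall>j. j \<notin> I \<longrightarrow> p X j = 0)" for X
  proof -
    have "(\<forall>i\<in>Basis. i \<notin> ?d \<longrightarrow> X \<bullet> i = 0) \<longleftrightarrow> (\<forall>j. \<forall>u\<in>{1, \<i>}. e j u \<notin> ?d \<longrightarrow> X \<bullet> e j u = 0)"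
      unfolding B by blast
    also have "\<dots> \<longleftrightarrow> (\<forall>j. \<forall>u\<in>{1, \<i>}. j \<notin> I \<longrightarrow> X \<bullet> e j u = 0)"
      using mem by simp
    finally show ?thesis by (simp only: p zero)
  qed
  then have "{X. \<forall>j. j \<notin> I \<longrightarrow> p X j = 0} = {X. \<forall>i\<in>Basis. i \<notin> ?d \<longrightarrow> X \<bullet> i = 0}" by simp
  moreover have "?d \<subseteq> Basis" by (auto simp: B)
  ultimately have "dim {X. \<forall>j. j \<notin> I \<longrightarrow> p X j = 0} = card ?d"
    by (simp only: dim_substandard)
  also have "\<dots> = card ?P"
    by (rule card_image) (auto simp: inj_on_def dest!: inj[rotated])
  finally show ?thesis by (simp add: card_cartesian_product)
qed

lemma dim_coord_space: "dim (coord_space I :: 'm::finite cvec set) = 2 * card I"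
  unfolding coord_space_def
  by (rule dim_vanishing_coordinates[where e="\<lambda>x u. axis x u"])
    (auto simp: Basis_vec_def Basis_complex_def axis_eq_axis inner_axis)

lemma dim_coord_matrices:
  "dim (coord_matrices R :: (complex^'n^'n) set) = 2 * card {(x, y). R x y}"
proof -
  have "coord_matrices R = {X :: complex^'n^'n. \<forall>j. j \<notin> {(x, y). R x y} \<longrightarrow> X $ fst j $ snd j = 0}"
    by (auto simp: coord_matrices_def)
  also have "dim \<dots> = 2 * card {(x, y). R x y}"
  proof (rule dim_vanishing_coordinates[where e="\<lambda>j u. axis (fst j) (axis (snd j) u)"])
    show "(Basis :: (complex^'n^'n) set) = {axis (fst j) (axis (snd j) u) | j u. u \<in> {1, \<i>}}"
      by (force simp: Basis_vec_def Basis_complex_def)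
  qed (auto simp: axis_eq_axis axis_eq_0_iff inner_axis prod_eq_iff)
  finally show ?thesis .
qed

lemma matrix_axis: "X *v axis y (1::complex) = (\<chi> x. X $ x $ y)"
  by (simp add: vec_eq_iff matrix_vector_mult_def axis_def if_distrib[of "\<lambda>x. _ * x"] cong: if_cong)

lemma image_coord_space_subset:
  "(\<forall>v\<in>coord_space I. X *v v \<in> coord_space J) \<longleftrightarrow> (\<forall>y\<in>I. \<forall>x. x \<notin> J \<longrightarrow> X $ x $ y = 0)"
proof (intro iffI ballI)
  fix y assume *: "\<forall>v\<in>coord_space I. X *v v \<in> coord_space J" and y: "y \<in> I"
  then have "X *v axis y 1 \<in> coord_space J" by (auto simp: coord_space_def axis_nth')
  then show "\<forall>x. x \<notin> J \<longrightarrow> X $ x $ y = 0" by (simp add: coord_space_def matrix_axis)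
next
  fix v assume *: "\<forall>y\<in>I. \<forall>x. x \<notin> J \<longrightarrow> X $ x $ y = 0" and v: "v \<in> coord_space I"
  have "X $ x $ y * v $ y = 0" if "x \<notin> J" for x y
    using * v that by (cases "y \<in> I") (auto simp: coord_space_def)
  then have "(\<Sum>y\<in>UNIV. X $ x $ y * v $ y) = 0" if "x \<notin> J" for x
    using that by (intro sum.neutral) blast
  then show "X *v v \<in> coord_space J" by (simp add: coord_space_def matrix_vector_mult_def)
qed

lemma pos_block_le_iff:
  assumes "i \<le> sum_list c" "k < length c"
  shows "pos_block c i \<le> k \<longleftrightarrow> i \<le> sum_list (take (Suc k) c)"
proof
  assume le: "pos_block c i \<le> k"
  have "i \<le> sum_list (take (Suc (length c)) c)" using assms(1) by simp
  then have "i \<le> sum_list (take (Suc (pos_block c i)) c)"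
    unfolding pos_block_def by (rule LeastI)
  also have "\<dots> \<le> sum_list (take (Suc k) c)" using le by (intro sum_list_take_mono) simp
  finally show "i \<le> sum_list (take (Suc k) c)" .
next
  assume "i \<le> sum_list (take (Suc k) c)" then show "pos_block c i \<le> k"
    unfolding pos_block_def by (rule Least_le)
qed

lemma pos_block_less:
  assumes "i \<in> {1..sum_list c}" shows "pos_block c i < length c"
proof -
  have "length c \<noteq> 0" using assms by auto
  then have "pos_block c i \<le> length c - 1" using assms by (subst pos_block_le_iff) auto
  then show ?thesis using \<open>length c \<noteq> 0\<close> by linarith
qed

lemma in_block_iff:
  assumes "i \<in> {1..sum_list c}" "k < length c"
  shows "i \<in> block c k \<longleftrightarrow> pos_block c i = k"
proof (cases k)
  case 0
  then show ?thesis using assms pos_block_le_iff[of i c 0] by (auto simp: block_def)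
next
  case (Suc k')
  then show ?thesis using assms pos_block_le_iff[of i c k] pos_block_le_iff[of i c k']
    by (auto simp: block_def)
qed

lemma block_subset: "k < length c \<Longrightarrow> block c k \<subseteq> {1..sum_list c}"
  using sum_list_take_mono[of "Suc k" "length c" c] by (auto simp: block_def)

text \<open>The dimension sequence stays arbitrary because the complete flag, with all blocks of
  length 1, is a second instance; it identifies the Borel algebra as a stabilizer.\<close>

locale iwasawa_setup =
  fixes nu :: "nat \<Rightarrow> 'm::finite" and c :: "nat list" and n :: nat
  assumes nu: "bij_betw nu {1..CARD('m)} UNIV" and sum_c: "sum_list c = n"
    and n: "n = 2 * CARD('m)"
begin

text \<open>Position of a coordinate in the order \<open>e_1, j(e_1), e_2, ...\<close>; the Borel
  algebra is upper triangular for it.\<close>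

definition rank :: "'m + 'm \<Rightarrow> nat" where
  "rank = inv_into {1..n} (idx nu)"

lemma bij_idx: "bij_betw (idx nu) {1..n} UNIV"
proof -
  have inj: "inj_on (idx nu) {1..n}"
  proof (rule inj_onI)
    fix i k assume ik: "i \<in> {1..n}" "k \<in> {1..n}" "idx nu i = idx nu k"
    have inj: "inj_on nu {1..CARD('m)}" using nu by (simp add: bij_betw_def)
    show "i = k"
    proof (cases "odd i")
      case True
      then have k: "odd k" using ik by (auto simp: idx_def split: if_splits)
      then have "nu ((i + 1) div 2) = nu ((k + 1) div 2)" using ik(3) True by (simp add: idx_def)
      moreover have "(i + 1) div 2 \<in> {1..CARD('m)}" "(k + 1) div 2 \<in> {1..CARD('m)}"
        using ik True k n by (auto elim!: oddE)
      ultimately have "(i + 1) div 2 = (k + 1) div 2" by (rule inj_onD[OF inj])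
      then show ?thesis using True k by presburger
    next
      case False
      then have k: "even k" using ik by (auto simp: idx_def split: if_splits)
      then have "nu (i div 2) = nu (k div 2)" using ik(3) False by (simp add: idx_def)
      moreover have "i div 2 \<in> {1..CARD('m)}" "k div 2 \<in> {1..CARD('m)}"
        using ik False k n by (auto elim!: evenE)
      ultimately have "i div 2 = k div 2" by (rule inj_onD[OF inj])
      then show ?thesis using False k by presburger
    qed
  qed
  moreover have "card (idx nu ` {1..n}) = CARD('m + 'm)" using inj n by (simp add: card_image)
  then have "idx nu ` {1..n} = UNIV" by (intro card_subset_eq) auto
  ultimately show ?thesis by (simp add: bij_betw_def)
qed

lemma rank_idx [simp]: "i \<in> {1..n} \<Longrightarrow> rank (idx nu i) = i"
  using bij_idx by (simp add: rank_def bij_betw_def inv_into_f_f)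

lemma idx_rank [simp]: "idx nu (rank x) = x"
  using bij_idx by (simp add: rank_def bij_betw_def f_inv_into_f)

lemma rank_in: "rank x \<in> {1..n}"
  using bij_idx unfolding rank_def by (metis bij_betw_def inv_into_into UNIV_I)

lemma rank_bounds: "1 \<le> rank x" "rank x \<le> n"
  using rank_in[of x] by auto

lemma rank_eq_iff: "rank x = rank y \<longleftrightarrow> x = y"
  by (metis idx_rank)

definition borel_alg :: "'m cmat set" where
  "borel_alg = coord_matrices (\<lambda>x y. rank x \<le> rank y)"

text \<open>The block in which \<open>w\<close> places a coordinate. The members of the flag of
  \<open>u \<circ> w\<close> are the coordinate spaces of its sublevel sets, so such flags are
  handled as functions on coordinates.\<close>

definition blk :: "(nat \<Rightarrow> nat) \<Rightarrow> 'm + 'm \<Rightarrow> nat" where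
  "blk w x = pos_block c (inv w (rank x))"

lemma stab_coord_flag:
  assumes len: "length F = length c" and f: "\<And>x. f x < length c"
    and F: "\<And>k. k < length c \<Longrightarrow> F ! k = coord_space {x. f x \<le> k}"
  shows "stab F = coord_matrices (\<lambda>x y. f x \<le> f y)"
proof -
  have "X \<in> stab F \<longleftrightarrow>
      (\<forall>k<length c. \<forall>y. f y \<le> k \<longrightarrow> (\<forall>x. \<not> f x \<le> k \<longrightarrow> X $ x $ y = 0))" for X
    by (simp add: stab_def len F image_coord_space_subset)
  also have "\<dots> X \<longleftrightarrow> X \<in> coord_matrices (\<lambda>x y. f x \<le> f y)" for X
    using f unfolding coord_matrices_def mem_Collect_eq by (meson order_refl order_trans)
  finally show ?thesis by blast
qed

context
  fixes w assumes w: "w permutes {1..n}"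
begin

lemma w_in: "i \<in> {1..n} \<Longrightarrow> w i \<in> {1..n}" using permutes_in_image[OF w] by blast

lemma inv_w_in: "i \<in> {1..n} \<Longrightarrow> inv w i \<in> {1..n}"
  using permutes_in_image[OF permutes_inv[OF w]] by blast

lemma blk_idx: "i \<in> {1..n} \<Longrightarrow> blk w (idx nu (w i)) = pos_block c i"
  using w_in[of i] by (simp add: blk_def permutes_inverses[OF w] del: atLeastAtMost_iff)

lemma idx_w_surj: "\<exists>i\<in>{1..n}. x = idx nu (w i)"
  using inv_w_in[OF rank_in] permutes_inverses(1)[OF w] by (metis idx_rank)

lemma blk_less: "blk w x < length c"
  using idx_w_surj[of x] blk_idx pos_block_less by (auto simp: sum_c)

lemma span_ubasis:
  assumes "A \<subseteq> {1..n}"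
  shows "vec.span ((ubasis nu \<circ> w) ` A) = coord_space ((\<lambda>i. idx nu (w i)) ` A)"
  by (rule span_scaled_axes[where z="\<lambda>i. if odd (w i) then 1 else - 1"]) (auto simp: ubasis_eq)

lemma flag_nth:
  assumes k: "k < length c"
  shows "flag_of c (ubasis nu \<circ> w) ! k = coord_space {x. blk w x \<le> k}"
proof -
  have sub: "{1..sum_list (take (Suc k) c)} \<subseteq> {1..n}"
    using sum_list_take_mono[of "Suc k" "length c" c] k sum_c by auto
  have "(\<lambda>i. idx nu (w i)) ` {1..sum_list (take (Suc k) c)} = {x. blk w x \<le> k}"
  proof (intro equalityI subsetI)
    fix x assume "x \<in> (\<lambda>i. idx nu (w i)) ` {1..sum_list (take (Suc k) c)}"
    then obtain i where i: "i \<in> {1..sum_list (take (Suc k) c)}" "x = idx nu (w i)" by blast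
    then show "x \<in> {x. blk w x \<le> k}" using sub blk_idx[of i] k pos_block_le_iff[of i c k] sum_c by auto
  next
    fix x assume x: "x \<in> {x. blk w x \<le> k}"
    obtain i where i: "i \<in> {1..n}" "x = idx nu (w i)" using idx_w_surj by blast
    then show "x \<in> (\<lambda>i. idx nu (w i)) ` {1..sum_list (take (Suc k) c)}"
      using x blk_idx[of i] k pos_block_le_iff[of i c k] sum_c by auto
  qed
  then show ?thesis using k span_ubasis[OF sub] by (simp add: flag_of_nth)
qed

lemma ordered_basis_ubasis: "ordered_basis (ubasis nu \<circ> w)"
proof -
  have "(\<lambda>i. idx nu (w i)) ` {1..n} = UNIV" using idx_w_surj by blast
  then show ?thesis
    using span_ubasis[of "{1..n}"] by (simp add: ordered_basis_def coord_space_def n)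
qed

lemma stab_flag: "stab (flag_of c (ubasis nu \<circ> w)) = coord_matrices (\<lambda>x y. blk w x \<le> blk w y)"
  by (rule stab_coord_flag) (simp_all add: blk_less flag_nth)

lemma chart_space_eq: "chart_space c (ubasis nu \<circ> w) = coord_matrices (\<lambda>x y. blk w x > blk w y)"
proof -
  have sp: "vec.span ((ubasis nu \<circ> w) ` {sum_list (take (Suc k) c)<..n}) = coord_space {x. blk w x > k}"
    if k: "k < length c" for k
  proof -
    have sub: "{sum_list (take (Suc k) c)<..n} \<subseteq> {1..n}" by auto
    have "(\<lambda>i. idx nu (w i)) ` {sum_list (take (Suc k) c)<..n} = {x. blk w x > k}"
    proof (intro equalityI subsetI)
      fix x assume "x \<in> (\<lambda>i. idx nu (w i)) ` {sum_list (take (Suc k) c)<..n}"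
      then obtain i where i: "i \<in> {sum_list (take (Suc k) c)<..n}" "x = idx nu (w i)" by blast
      then show "x \<in> {x. blk w x > k}" using blk_idx[of i] k pos_block_le_iff[of i c k] sum_c by auto
    next
      fix x assume x: "x \<in> {x. blk w x > k}"
      obtain i where i: "i \<in> {1..n}" "x = idx nu (w i)" using idx_w_surj by blast
      then show "x \<in> (\<lambda>i. idx nu (w i)) ` {sum_list (take (Suc k) c)<..n}"
        using x blk_idx[of i] k pos_block_le_iff[of i c k] sum_c by auto
    qed
    then show ?thesis using span_ubasis[OF sub] by simp
  qed
  have X: "X *v (ubasis nu \<circ> w) i \<in> coord_space I \<longleftrightarrow> (\<forall>x. x \<notin> I \<longrightarrow> X $ x $ idx nu (w i) = 0)" for X :: "'m cmat" and i I
    by (auto simp: ubasis_eq vec.scale matrix_axis coord_space_def vector_scalar_commute)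
  have "X \<in> chart_space c (ubasis nu \<circ> w) \<longleftrightarrow>
      (\<forall>k<length c. \<forall>i\<in>block c k. \<forall>x. \<not> blk w x > k \<longrightarrow> X $ x $ idx nu (w i) = 0)" for X
    unfolding chart_space_def using sp X by (simp add: n[symmetric])
  also have "\<dots> X \<longleftrightarrow> X \<in> coord_matrices (\<lambda>x y. blk w x > blk w y)" for X
  proof
    assume *: "\<forall>k<length c. \<forall>i\<in>block c k. \<forall>x. \<not> blk w x > k \<longrightarrow> X $ x $ idx nu (w i) = 0"
    have "X $ x $ y = 0" if "\<not> blk w x > blk w y" for x y
    proof -
      obtain i where i: "i \<in> {1..n}" "y = idx nu (w i)" using idx_w_surj by blast
      then have "i \<in> block c (blk w y)" using blk_less[of y] blk_idx[of i] in_block_iff[of i c] by (simp add: sum_c)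
      then show ?thesis using * that blk_less i by blast
    qed
    then show "X \<in> coord_matrices (\<lambda>x y. blk w x > blk w y)" by (simp add: coord_matrices_def)
  next
    assume *: "X \<in> coord_matrices (\<lambda>x y. blk w x > blk w y)"
    show "\<forall>k<length c. \<forall>i\<in>block c k. \<forall>x. \<not> blk w x > k \<longrightarrow> X $ x $ idx nu (w i) = 0"
    proof (intro allI impI ballI)
      fix k i x assume k: "k < length c" "i \<in> block c k" "\<not> k < blk w x"
      then have "i \<in> {1..n}" using block_subset[of k c] sum_c by auto
      then have "blk w (idx nu (w i)) = k" using k in_block_iff[of i c k] blk_idx sum_c by simp
      then show "X $ x $ idx nu (w i) = 0" using * k by (auto simp: coord_matrices_def)
    qed
  qed
  finally show ?thesis by blast
qed

end

end

subsection \<open>Comparing rank conditions\<close>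

text \<open>Summing \<open>#{(x, y). x \<le> y \<and> g x \<le> f y}\<close> over \<open>y\<close> first or over \<open>x\<close> first shows that it lies
  between the corresponding numbers for \<open>(f, f)\<close> and \<open>(g, g)\<close>.\<close>

lemma noninversions_dominance_eq:
  fixes f g :: "nat \<Rightarrow> nat"
  assumes fib: "\<And>i. card {x\<in>{1..n}. f x = i} = card {x\<in>{1..n}. g x = i}"
    and dom: "\<And>i k. k \<le> n \<Longrightarrow> card {x\<in>{1..k}. f x \<le> i} \<le> card {x\<in>{1..k}. g x \<le> i}"
    and len: "card {(x, y). x \<in> {1..n} \<and> y \<in> {1..n} \<and> x \<le> y \<and> g x \<le> g y}
      \<le> card {(x, y). x \<in> {1..n} \<and> y \<in> {1..n} \<and> x \<le> y \<and> f x \<le> f y}"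
    and z: "z \<in> {1..n}"
  shows "f z = g z"
proof (rule ccontr)
  assume fgz: "f z \<noteq> g z"
  define r where "r = (\<lambda>f i k. card {x\<in>{1..k::nat}. f x \<le> (i::nat)})"
  define rs where "rs = (\<lambda>f i k. card {x\<in>{1..k::nat}. f x < (i::nat)})"
  define R where "R = (\<lambda>f i k. card {y\<in>{k..n}. (i::nat) \<le> f y})"
  define E where "E = (\<lambda>f g :: nat \<Rightarrow> nat. card {(x, y). x \<in> {1..n} \<and> y \<in> {1..n} \<and> x \<le> y \<and> g x \<le> f y})"
  have rle: "r f i k \<le> r g i k" if "k \<le> n" for i k using dom that by (simp add: r_def)
  have rsle: "rs f i k \<le> rs g i k" if "k \<le> n" for i k
  proof (cases i)
    case (Suc j) then show ?thesis using rle[OF that, of j] by (simp add: r_def rs_def less_Suc_eq_le)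
  qed (simp add: rs_def)
  have E1: "E f g = (\<Sum>y\<in>{1..n}. r g (f y) y)" for f g
  proof -
    have "{(x, y). x \<in> {1..n} \<and> y \<in> {1..n} \<and> x \<le> y \<and> g x \<le> f y} =
      (\<lambda>(y, x). (x, y)) ` (SIGMA y:{1..n}. {x\<in>{1..y}. g x \<le> f y})" by force
    moreover have "inj_on (\<lambda>(y, x). (x, y)) (SIGMA y:{1..n}. {x\<in>{1..y}. g x \<le> f y})" by (auto simp: inj_on_def)
    ultimately show ?thesis by (simp add: E_def r_def card_image)
  qed
  have E2: "E f g = (\<Sum>x\<in>{1..n}. R f (g x) x)" for f g
  proof -
    have "{(x, y). x \<in> {1..n} \<and> y \<in> {1..n} \<and> x \<le> y \<and> g x \<le> f y} =
      (SIGMA x:{1..n}. {y\<in>{x..n}. g x \<le> f y})" by force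
    then show ?thesis by (simp add: E_def R_def)
  qed
  have T: "card {y\<in>{1..n}. i \<le> f y} = card {y\<in>{1..n}. i \<le> g y}" for i
  proof -
    have sum: "card {y\<in>{1..n}. i \<le> h y} + (\<Sum>j<i. card {y\<in>{1..n}. h y = j}) = n" for h :: "nat \<Rightarrow> nat"
    proof -
      have "{1..n} = {y\<in>{1..n}. i \<le> h y} \<union> (\<Union>j<i. {y\<in>{1..n}. h y = j})" by auto
      then have "n = card ({y\<in>{1..n}. i \<le> h y} \<union> (\<Union>j<i. {y\<in>{1..n}. h y = j}))"
        by (metis card_atLeastAtMost diff_Suc_1)
      also have "\<dots> = card {y\<in>{1..n}. i \<le> h y} + card (\<Union>j<i. {y\<in>{1..n}. h y = j})"
        by (rule card_Un_disjoint) auto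
      also have "card (\<Union>j<i. {y\<in>{1..n}. h y = j}) = (\<Sum>j<i. card {y\<in>{1..n}. h y = j})"
        by (rule card_UN_disjoint) auto
      finally show ?thesis by simp
    qed
    show ?thesis using sum[of f] sum[of g] fib by simp
  qed
  \<comment> \<open>Counting from the other end: the values at least \<open>i\<close> from
    \<open>x\<close> on are all such values minus those before \<open>x\<close>. As the totals agree
    by \<open>T\<close>, dominance on prefixes passes to suffixes.\<close>
  have Rrs: "R h i x + (x - 1) = card {y\<in>{1..n}. i \<le> h y} + rs h i (x - 1)" if x: "x \<in> {1..n}" for h i x
  proof -
    have "{y\<in>{1..n}. i \<le> h y} = {y\<in>{x..n}. i \<le> h y} \<union> {y\<in>{1..x-1}. i \<le> h y}" using x by auto
    then have 1: "card {y\<in>{1..n}. i \<le> h y} = R h i x + card {y\<in>{1..x-1}. i \<le> h y}"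
      using x by (simp only: R_def) (subst card_Un_disjoint, auto)
    have "{1..x-1} = {y\<in>{1..x-1}. h y < i} \<union> {y\<in>{1..x-1}. i \<le> h y}" by auto
    then have "x - 1 = card ({y\<in>{1..x-1}. h y < i} \<union> {y\<in>{1..x-1}. i \<le> h y})"
      by (metis card_atLeastAtMost diff_Suc_1)
    also have "\<dots> = rs h i (x - 1) + card {y\<in>{1..x-1}. i \<le> h y}"
      unfolding rs_def by (rule card_Un_disjoint) auto
    finally show ?thesis using 1 by simp
  qed
  have Rle: "R f (g x) x \<le> R g (g x) x" if x: "x \<in> {1..n}" for x
  proof -
    have "rs f (g x) (x - 1) \<le> rs g (g x) (x - 1)" using x by (intro rsle) auto
    then show ?thesis using Rrs[OF x, of f "g x"] Rrs[OF x, of g "g x"] T[of "g x"] by linarith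
  qed
  \<comment> \<open>The two summations give \<open>E f f \<le> E f g \<le> E g g\<close>, and
    \<open>E g g \<le> E f f\<close> by hypothesis; so all three agree, and then so do the single
    summands.\<close>
  have sum_le: "(\<Sum>x\<in>{1..n}. R g (g x) x) \<le> (\<Sum>x\<in>{1..n}. R f (g x) x)"
  proof -
    have "(\<Sum>x\<in>{1..n}. R g (g x) x) = E g g" by (simp add: E2)
    also have "\<dots> \<le> E f f" using len by (simp add: E_def)
    also have "\<dots> \<le> E f g" unfolding E1 by (rule sum_mono) (auto intro: rle)
    finally show ?thesis by (simp add: E2)
  qed
  then have "R f (g x) x = R g (g x) x" if "x \<in> {1..n}" for x
  proof -
    have "(\<Sum>x\<in>{1..n}. R f (g x) x) = (\<Sum>x\<in>{1..n}. R g (g x) x)"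
      by (intro antisym sum_le sum_mono Rle)
    then show ?thesis using Rle that by (rule sum_mono_inv) auto
  qed
  then have rseq: "rs g (g x) (x - 1) = rs f (g x) (x - 1)" if "x \<in> {1..n}" for x
    using Rrs[OF that, of f "g x"] Rrs[OF that, of g "g x"] T[of "g x"] that by simp
  \<comment> \<open>At the first disagreement dominance gives \<open>g y0 < f y0\<close>. Put
    \<open>i = f y0\<close>; as the fibres have equal size, \<open>g\<close> still takes the value
    \<open>i\<close> after \<open>y0\<close>, first at \<open>x\<close>. Just before
    \<open>x\<close> both functions have equally many values below \<open>i\<close>, but
    \<open>g\<close> has fewer equal to \<open>i\<close>, against dominance.\<close>
  define y0 where "y0 = (LEAST y. y \<in> {1..n} \<and> f y \<noteq> g y)"
  have y0: "y0 \<in> {1..n}" "f y0 \<noteq> g y0"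
    using LeastI[of "\<lambda>y. y \<in> {1..n} \<and> f y \<noteq> g y" z] z fgz by (auto simp: y0_def)
  have before: "f y = g y" if "y \<in> {1..<y0}" for y
  proof (rule ccontr)
    assume "f y \<noteq> g y"
    then have "y0 \<le> y" unfolding y0_def using that y0 by (intro Least_le) auto
    then show False using that by simp
  qed
  let ?i = "f y0"
  have cnt: "card {x\<in>{1..y0}. P (h x)} = card {x\<in>{1..<y0}. P (h x)} + (if P (h y0) then 1 else 0)" for P and h :: "nat \<Rightarrow> nat"
  proof -
    have "{x\<in>{1..y0}. P (h x)} = {x\<in>{1..<y0}. P (h x)} \<union> (if P (h y0) then {y0} else {})" using y0 by (auto simp: le_less)
    then show ?thesis by (simp only:) (subst card_Un_disjoint, auto)
  qed
  have same: "{x\<in>{1..<y0}. P (f x)} = {x\<in>{1..<y0}. P (g x)}" for P using before by auto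
  have "r f ?i y0 \<le> r g ?i y0" using y0 by (intro rle) auto
  then have "g y0 \<le> ?i"
    using cnt[of "\<lambda>v. v \<le> ?i" f] cnt[of "\<lambda>v. v \<le> ?i" g] same[of "\<lambda>v. v \<le> ?i"]
    by (auto simp: r_def split: if_splits)
  then have gy0: "g y0 \<noteq> ?i" using y0 by simp
  have cf: "card {x\<in>{1..y0}. f x = ?i} = card {x\<in>{1..<y0}. f x = ?i} + 1"
    using cnt[of "\<lambda>v. v = ?i" f] by simp
  have "\<exists>x. x \<in> {y0<..n} \<and> g x = ?i"
  proof (rule ccontr)
    assume no: "\<not> ?thesis"
    have "{x\<in>{1..n}. g x = ?i} \<subseteq> {x\<in>{1..<y0}. g x = ?i}"
      using no gy0 y0 by (auto simp: not_less) (metis le_neq_implies_less linorder_not_le)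
    then have "card {x\<in>{1..n}. g x = ?i} \<le> card {x\<in>{1..<y0}. f x = ?i}"
      unfolding same[of "\<lambda>v. v = ?i"] by (intro card_mono) auto
    also have "\<dots> < card {x\<in>{1..y0}. f x = ?i}" using cf by simp
    also have "\<dots> \<le> card {x\<in>{1..n}. f x = ?i}" using y0 by (intro card_mono) auto
    finally show False using fib by simp
  qed
  then obtain x where x: "x \<in> {y0<..n}" "g x = ?i" and xmin: "\<And>y. y < x \<Longrightarrow> \<not> (y \<in> {y0<..n} \<and> g y = ?i)"
    using exists_least_iff[of "\<lambda>x. x \<in> {y0<..n} \<and> g x = ?i"] by blast
  define a where "a = x - 1"
  have a: "y0 \<le> a" "a < x" "a \<le> n" using x by (auto simp: a_def)
  have "{y\<in>{1..a}. g y = ?i} \<subseteq> {y\<in>{1..<y0}. g y = ?i}"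
    using xmin a gy0 by (auto simp: not_less) (metis le_neq_implies_less le_trans linorder_not_le not_less)
  then have "card {y\<in>{1..a}. g y = ?i} \<le> card {y\<in>{1..<y0}. f y = ?i}"
    unfolding same[of "\<lambda>v. v = ?i"] by (intro card_mono) auto
  also have "\<dots> < card {y\<in>{1..y0}. f y = ?i}" using cf by simp
  also have "\<dots> \<le> card {y\<in>{1..a}. f y = ?i}" using a by (intro card_mono) auto
  finally have lt: "card {y\<in>{1..a}. g y = ?i} < card {y\<in>{1..a}. f y = ?i}" .
  have split: "r h ?i a = rs h ?i a + card {y\<in>{1..a}. h y = ?i}" for h
  proof -
    have "{x\<in>{1..a}. h x \<le> ?i} = {x\<in>{1..a}. h x < ?i} \<union> {x\<in>{1..a}. h x = ?i}" by auto
    then show ?thesis unfolding r_def rs_def by (simp only:) (subst card_Un_disjoint, auto)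
  qed
  have "rs g ?i a = rs f ?i a" using rseq[of x] x y0 by (simp add: a_def)
  then show False using rle[OF a(3), of ?i] split[of f] split[of g] lt by simp
qed

text \<open>Since \<open>B + P\<close> and \<open>K + P\<close> together span everything, the
  dimension formula determines the dimension of their intersection. That intersection contains both
  \<open>P\<close> and \<open>B \<inter> K\<close>, and the assumed inequality leaves no room in it
  beyond \<open>P\<close>.\<close>

lemma transversal_dim:
  fixes B K P :: "'a::euclidean_space set"
  assumes sub: "subspace B" "subspace K" "subspace P"
    and span: "\<And>x. \<exists>b\<in>B. \<exists>k\<in>K. x = b + k"
    and le: "dim B + dim K + dim P \<le> DIM('a) + dim (B \<inter> P) + dim (K \<inter> P)"
  shows "B \<inter> K \<subseteq> P" "dim B + dim K + dim P = DIM('a) + dim (B \<inter> P) + dim (K \<inter> P)"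
proof -
  let ?S = "\<lambda>A B. {x + y |x y. x \<in> A \<and> y \<in> B}"
  let ?BP = "?S B P" and ?KP = "?S K P"
  have sBP: "subspace ?BP" "subspace ?KP" using sub by (auto intro: subspace_sums)
  have d1: "dim ?BP + dim (B \<inter> P) = dim B + dim P" by (rule dim_sums_Int[OF sub(1,3)])
  have d2: "dim ?KP + dim (K \<inter> P) = dim K + dim P" by (rule dim_sums_Int[OF sub(2,3)])
  have d3: "dim (?S ?BP ?KP) + dim (?BP \<inter> ?KP) = dim ?BP + dim ?KP" by (rule dim_sums_Int[OF sBP])
  have B: "B \<subseteq> ?BP" using subspace_0[OF sub(3)] by force
  have K: "K \<subseteq> ?KP" using subspace_0[OF sub(3)] by force
  have P: "P \<subseteq> ?BP \<inter> ?KP" using subspace_0[OF sub(1)] subspace_0[OF sub(2)] by force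
  have "?S ?BP ?KP = UNIV" 
  proof (intro equalityI subsetI UNIV_I)
    fix x obtain b k where "b \<in> B" "k \<in> K" "x = b + k" using span by blast
    moreover have "b \<in> ?BP" "k \<in> ?KP" using calculation B K by (auto simp only: subset_iff)
    ultimately show "x \<in> ?S ?BP ?KP" by blast
  qed
  then have d4: "DIM('a) + dim (?BP \<inter> ?KP) = dim ?BP + dim ?KP" using d3 by simp
  have ge: "dim P \<le> dim (?BP \<inter> ?KP)" using P by (rule dim_subset)
  then have eq: "dim P = dim (?BP \<inter> ?KP)" using d1 d2 d4 le by linarith
  show "dim B + dim K + dim P = DIM('a) + dim (B \<inter> P) + dim (K \<inter> P)" using d1 d2 d4 eq by linarith
  have "P = ?BP \<inter> ?KP"
    by (rule subspace_dim_equal[OF sub(3) subspace_inter[OF sBP] P eq_refl[OF eq[symmetric]]])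
  then show "B \<inter> K \<subseteq> P" using B K by blast
qed

subsection \<open>The symplectic algebra\<close>

text \<open>Exchanges the coordinates of \<open>e_i\<close> and \<open>j(e_i)\<close>. Together with
  the sign \<open>sg\<close> it puts both halves of \<open>j\<close> into the one formula
  \<open>jj_nth'\<close>.\<close>

definition star :: "'m::finite + 'm \<Rightarrow> 'm + 'm" where
  "star = case_sum Inr Inl"

definition sg :: "'m + 'm \<Rightarrow> complex" where
  "sg = case_sum (\<lambda>_. 1) (\<lambda>_. - 1)"

lemma star_simps [simp]: "star (Inl i) = Inr i" "star (Inr i) = Inl i" "star (star x) = x"
  by (auto simp: star_def split: sum.splits)

lemma star_eq_iff: "star x = y \<longleftrightarrow> x = star y" by auto

lemma sg_simps [simp]: "sg (Inl i) = 1" "sg (Inr i) = - 1" "sg (star x) = - sg x" "sg x * sg x = 1" "sg x * (sg x * z) = z"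
    "cnj (sg x) = sg x"
  by (auto simp: star_def sg_def split: sum.splits)

lemma jj_nth': "jj v $ x = sg x * cnj (v $ star x)"
  by (cases x) auto

text \<open>Entrywise form of \<open>X J + J X\<^sup>T = 0\<close>.\<close>

definition sp_alg :: "'m::finite cmat set" where
  "sp_alg = {X. \<forall>x y. X $ x $ y = - (sg x * sg y * X $ star y $ star x)}"

lemma subspace_sp_alg: "subspace sp_alg"
  unfolding sp_alg_def
proof (intro subspaceI CollectI allI)
  fix X Y :: "'m::finite cmat" and x y :: "'m + 'm" and r :: real
  show "(0 :: 'm cmat) $ x $ y = - (sg x * sg y * (0 :: 'm cmat) $ star y $ star x)" by simp
  assume X: "X \<in> {X. \<forall>x y. X $ x $ y = - (sg x * sg y * X $ star y $ star x)}"
  then have X': "X $ x $ y = - (sg x * sg y * X $ star y $ star x)" by blast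
  show "(r *\<^sub>R X) $ x $ y = - (sg x * sg y * (r *\<^sub>R X) $ star y $ star x)"
    using X' by simp
  assume Y: "Y \<in> {X. \<forall>x y. X $ x $ y = - (sg x * sg y * X $ star y $ star x)}"
  then have Y': "Y $ x $ y = - (sg x * sg y * Y $ star y $ star x)" by blast
  show "(X + Y) $ x $ y = - (sg x * sg y * (X + Y) $ star y $ star x)"
    using X' Y' by (simp add: algebra_simps)
qed

context iwasawa_setup begin

lemma subspace_borel_alg: "subspace borel_alg"
  unfolding borel_alg_def by (rule subspace_coord_matrices)

lemma star_idx: "i \<in> {1..CARD('m)} \<Longrightarrow> star (idx nu (2 * i - 1)) = idx nu (2 * i)"
  by (cases i) (auto simp: idx_def)

lemma rank_star: "(rank (star x) + 1) div 2 = (rank x + 1) div 2"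
proof -
  define i where "i = (rank x + 1) div 2"
  have i: "i \<in> {1..CARD('m)}" using rank_bounds[of x] n by (auto simp: i_def)
  then have in': "2 * i - 1 \<in> {1..n}" "2 * i \<in> {1..n}" using n by auto
  have "rank x = 2 * i - 1 \<or> rank x = 2 * i" using rank_bounds[of x] unfolding i_def by arith
  then have "x = idx nu (2 * i - 1) \<or> x = idx nu (2 * i)" by (metis idx_rank)
  then have "rank (star x) = 2 * i \<or> rank (star x) = 2 * i - 1"
    using star_idx[OF i] star_simps(3) rank_idx[OF in'(1)] rank_idx[OF in'(2)] by metis
  then have "(rank (star x) + 1) div 2 = i" using i by auto
  then show ?thesis by (simp add: i_def)
qed

lemma star_neq: "star x \<noteq> x" by (cases x) auto

lemma half_eqD:
  fixes p q r :: nat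
  assumes "(p + 1) div 2 = (r + 1) div 2" "(q + 1) div 2 = (r + 1) div 2" "p \<noteq> r" "q \<noteq> r"
  shows "p = q"
proof -
  have h: "x + 1 = 2 * ((x + 1) div 2) \<or> x = 2 * ((x + 1) div 2)" for x :: nat by arith
  show ?thesis using h[of p] h[of q] h[of r] assms by linarith
qed

text \<open>Partners occupy the ranks \<open>2 * i - 1\<close> and \<open>2 * i\<close>, so both
  inequalities hold weakly for the pair numbers, which \<open>star\<close> preserves; hence
  \<open>x\<close> and \<open>y\<close> belong to the same pair.\<close>

lemma eq_star_of_rank:
  assumes "rank y < rank x" "rank (star x) < rank (star y)" shows "x = star y"
proof -
  have 1: "(rank x + 1) div 2 = (rank y + 1) div 2"
    using assms rank_star[of x] rank_star[of y] div_le_mono[of "rank y + 1" "rank x + 1" 2]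
      div_le_mono[of "rank (star x) + 1" "rank (star y) + 1" 2] by linarith
  have 2: "rank x \<noteq> rank y" using assms(1) by simp
  have 3: "rank (star y) \<noteq> rank y" unfolding rank_eq_iff by (rule star_neq)
  show ?thesis using half_eqD[OF 1 rank_star 2 3] unfolding rank_eq_iff .
qed

text \<open>The entries strictly below the diagonal can be prescribed freely in
  \<open>sp_alg\<close>: its relation links the position \<open>(x, y)\<close> with
  \<open>(star y, star x)\<close>, and two linked positions both lie strictly below only if they
  coincide, by \<open>eq_star_of_rank\<close>; there the relation is vacuous.\<close>

lemma borel_sp_span: "\<exists>b\<in>borel_alg. \<exists>k\<in>sp_alg. X = b + k"
proof -
  define Y :: "'m cmat" where "Y = (\<chi> x y. if rank y < rank x then X $ x $ y
     else if rank (star x) < rank (star y) then - (sg x * sg y * X $ star y $ star x) else 0)"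
  have "Y \<in> sp_alg"
    unfolding sp_alg_def
  proof (intro CollectI allI)
    fix x y
    consider "rank y < rank x" "rank (star x) < rank (star y)" | "rank y < rank x" "\<not> rank (star x) < rank (star y)"
      | "\<not> rank y < rank x" by blast
    then show "Y $ x $ y = - (sg x * sg y * Y $ star y $ star x)"
    proof cases
      case 1
      then have "x = star y" by (rule eq_star_of_rank)
      then show ?thesis using 1 by (simp add: Y_def)
    next
      case 2
      then show ?thesis by (simp add: Y_def mult.assoc mult.left_commute)
    next
      case 3
      then show ?thesis by (simp add: Y_def)
    qed
  qed
  moreover have "X - Y \<in> borel_alg" by (simp add: borel_alg_def coord_matrices_def Y_def)
  ultimately show ?thesis by (metis diff_add_cancel)
qed

text \<open>Let \<open>D\<close> be the diagonal matrix with entries \<open>lam\<close>. The product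
  of all \<open>D - lam y\<close> with \<open>y \<noteq> x\<close> reduces a vector to a nonzero
  multiple of its \<open>x\<close>-th coordinate, so the axis of \<open>x\<close> lies in
  \<open>V\<close> as soon as some vector of \<open>V\<close> has a nonzero coordinate
  there.\<close>

lemma diagonal_stable_coord:
  fixes V :: "'m cvec set"
  assumes V: "vec.subspace V" and lam: "inj lam"
    and stable: "\<And>v. v \<in> V \<Longrightarrow> (\<chi> x. lam x * v $ x) \<in> V"
  shows "V = coord_space {x. axis x 1 \<in> V}"
proof
  show "V \<subseteq> coord_space {x. axis x 1 \<in> V}"
  proof (clarsimp simp: coord_space_def, rule ccontr)
    fix v x assume v: "v \<in> V" and x: "axis x 1 \<notin> V" and vx: "v $ x \<noteq> 0"
    have *: "(\<chi> z. (\<Prod>y\<in>S. (lam z - lam y)) * v $ z) \<in> V" if "finite S" for S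
      using that
    proof induction
      case empty
      then show ?case using v by (simp add: vec_nth_inverse)
    next
      case (insert y S)
      let ?w = "\<chi> z. (\<Prod>y\<in>S. (lam z - lam y)) * v $ z"
      have "(\<chi> z. lam z * ?w $ z) - lam y *s ?w \<in> V"
        using stable[OF insert.IH] insert.IH V by (intro vec.subspace_diff vec.subspace_scale) auto
      moreover have "(\<chi> z. lam z * ?w $ z) - lam y *s ?w = (\<chi> z. (\<Prod>y\<in>insert y S. (lam z - lam y)) * v $ z)"
        using insert.hyps by (simp add: vec_eq_iff algebra_simps)
      ultimately show ?case by simp
    qed
    let ?S = "UNIV - {x}"
    let ?p = "(\<Prod>y\<in>?S. (lam x - lam y)) * v $ x"
    have p0: "?p \<noteq> 0" using vx lam by (auto simp: inj_eq)
    have "(\<chi> z. (\<Prod>y\<in>?S. (lam z - lam y)) * v $ z) = ?p *s axis x 1"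
      by (auto simp: vec_eq_iff axis_nth')
    then have "?p *s axis x 1 \<in> V" using *[of ?S] by simp
    then have "inverse ?p *s (?p *s axis x 1) \<in> V" using V by (rule vec.subspace_scale[rotated])
    moreover have "inverse ?p *s (?p *s axis x 1) = (axis x 1 :: 'm cvec)" 
      by (simp only: vector_smult_assoc left_inverse[OF p0] vector_smult_lid)
    ultimately show False using x by simp
  qed
  show "coord_space {x. axis x 1 \<in> V} \<subseteq> V"
  proof -
    have "coord_space {x. axis x 1 \<in> V} = vec.span ((\<lambda>x. axis x 1) ` {x. axis x 1 \<in> V})"
      using span_scaled_axes[of "{x. axis x 1 \<in> V}" "\<lambda>_. 1" "\<lambda>x. axis x 1" "\<lambda>x. x"] by simp
    also have "\<dots> \<subseteq> V" using V by (intro vec.span_minimal) auto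
    finally show ?thesis .
  qed
qed

lemma coordinate_flag:
  assumes F: "F \<in> flag_manifold c" and stable: "borel_alg \<inter> sp_alg \<subseteq> stab F"
  obtains f where "\<And>x. f x < length c" "\<And>k. k < length c \<Longrightarrow> F ! k = coord_space {x. f x \<le> k}"
    "\<And>i. f (Inl i) \<le> f (Inr i)"
proof -
  \<comment> \<open>Opposite values on partners make the diagonal matrix symplectic; positive pair
    numbers with a sign make its entries distinct.\<close>
  define lam :: "'m + 'm \<Rightarrow> complex" where "lam x = sg x * of_nat ((rank x + 1) div 2)" for x
  have len: "length F = length c" using F by (rule flag_manifold_length)
  have "inj lam"
  proof (rule injI)
    fix x y assume eq: "lam x = lam y"
    have pos: "(rank x + 1) div 2 > 0" for x using rank_bounds[of x] by auto
    have "Re (lam x) = (case x of Inl _ \<Rightarrow> 1 | Inr _ \<Rightarrow> -1) * real ((rank x + 1) div 2)" for x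
      by (cases x) (auto simp: lam_def)
    then have "(case x of Inl _ \<Rightarrow> 1 | Inr _ \<Rightarrow> -1) * real ((rank x + 1) div 2) =
      (case y of Inl _ \<Rightarrow> 1 | Inr _ \<Rightarrow> -1) * real ((rank y + 1) div 2)" using eq by metis
    then have side: "isl x \<longleftrightarrow> isl y" and pr: "(rank x + 1) div 2 = (rank y + 1) div 2"
      using pos[of x] pos[of y] by (auto split: sum.splits)
    show "x = y"
    proof (rule ccontr)
      assume "x \<noteq> y"
      then have 1: "rank y \<noteq> rank x" by (simp add: rank_eq_iff)
      have 2: "rank (star x) \<noteq> rank x" unfolding rank_eq_iff by (rule star_neq)
      have "rank y = rank (star x)" by (rule half_eqD[OF pr[symmetric] rank_star 1 2])
      then have "y = star x" by (simp add: rank_eq_iff)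
      then show False using side by (cases x) auto
    qed
  qed
  let ?D = "(\<chi> x y. if x = y then lam x else 0) :: 'm cmat"
  have "?D \<in> borel_alg \<inter> sp_alg"
    using rank_star by (auto simp: borel_alg_def coord_matrices_def sp_alg_def lam_def star_eq_iff)
  then have D: "?D \<in> stab F" using stable by blast
  have Dv: "?D *v v = (\<chi> x. lam x * v $ x)" for v
    by (simp add: vec_eq_iff matrix_vector_mult_def if_distrib[of "\<lambda>x. x * _"] cong: if_cong)
  define I where "I k = {x. axis x 1 \<in> F ! k}" for k
  have FI: "F ! k = coord_space (I k)" if "k < length c" for k
    unfolding I_def
    using diagonal_stable_coord[OF flag_manifold_subspace[OF F that] \<open>inj lam\<close>] D that len
    by (auto simp: stab_def Dv)
  have step: "F ! k \<subseteq> F ! Suc k" if "Suc k < length c" for k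
    using F that by (force simp: flag_manifold_def)
  have mono: "I k \<subseteq> I l" if "k \<le> l" "l < length c" for k l
    using that
  proof (induction l rule: dec_induct)
    case (step l)
    then show ?case using \<open>\<And>k. Suc k < length c \<Longrightarrow> F ! k \<subseteq> F ! Suc k\<close>[of l] by (auto simp: I_def)
  qed simp
  have c0: "length c \<noteq> 0" using sum_c n by (metis length_0_conv sum_list.Nil card_gt_0_iff finite mult_eq_0_iff UNIV_not_empty neq0_conv zero_neq_numeral)
  have last: "x \<in> I (length c - 1)" for x
  proof -
    have "last ({0} # F) = F ! (length c - 1)" using len c0 by (auto simp: last_conv_nth) 
    then have "F ! (length c - 1) = UNIV" using F by (simp add: flag_manifold_def)
    then show ?thesis by (simp add: I_def)
  qed
  \<comment> \<open>The first member containing the axis of \<open>x\<close>; it exists because the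
    last member is the whole space.\<close>
  define f where "f x = (LEAST k. x \<in> I k)" for x
  have f_less: "f x < length c" for x
    using Least_le[of "\<lambda>k. x \<in> I k", OF last] c0 unfolding f_def by linarith
  have f_in: "x \<in> I (f x)" for x unfolding f_def using last by (rule LeastI)
  have f_le: "{x. f x \<le> k} = I k" if "k < length c" for k
  proof (intro equalityI subsetI)
    fix x assume "x \<in> {x. f x \<le> k}" then show "x \<in> I k" using mono[of "f x" k] f_in that by auto
  next
    fix x assume "x \<in> I k" then show "x \<in> {x. f x \<le> k}" unfolding f_def by (auto intro: Least_le)
  qed
  have lr: "f (Inl i) \<le> f (Inr i)" for i
  proof -
    \<comment> \<open>This matrix unit sits at a position that is its own mirror in
      \<open>sp_alg\<close>, and it is upper triangular because \<open>e_i\<close> directly precedes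
      \<open>j(e_i)\<close>. It carries the axis of \<open>Inr i\<close> to that of
      \<open>Inl i\<close>.\<close>
    let ?E = "(\<chi> x y. if x = Inl i \<and> y = Inr i then 1 else 0) :: 'm cmat"
    have rk: "rank (Inl i) \<le> rank (Inr i)"
    proof -
      obtain k where k: "k \<in> {1..CARD('m)}" "i = nu k" using nu by (metis UNIV_I bij_betw_imp_surj_on imageE)
      then have in': "2 * k - 1 \<in> {1..n}" "2 * k \<in> {1..n}" using n by auto
      have "rank (idx nu (2 * k - 1)) = 2 * k - 1" "rank (idx nu (2 * k)) = 2 * k"
        by (rule rank_idx[OF in'(1)], rule rank_idx[OF in'(2)])
      moreover have "idx nu (2 * k - 1) = Inl i" "idx nu (2 * k) = Inr i" using k by (auto simp: idx_def)
      ultimately show ?thesis by simp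
    qed
    have "?E \<in> borel_alg \<inter> sp_alg"
      using rk by (auto simp: borel_alg_def coord_matrices_def sp_alg_def star_eq_iff)
    then have "?E \<in> stab F" using stable by blast
    then have "\<forall>v\<in>F ! f (Inr i). ?E *v v \<in> F ! f (Inr i)" using f_less[of "Inr i"] len by (simp add: stab_def)
    moreover have "?E *v axis (Inr i) 1 = axis (Inl i) 1"
      by (simp add: vec_eq_iff matrix_axis axis_nth')
    moreover have "axis (Inr i) 1 \<in> F ! f (Inr i)" using f_in[of "Inr i"] by (simp add: I_def)
    ultimately have "axis (Inl i) 1 \<in> F ! f (Inr i)" by fastforce
    then show ?thesis unfolding f_def[of "Inl i"] by (intro Least_le) (simp add: I_def)
  qed
  show thesis using that[of f] f_less f_le FI lr by auto
qed

end

subsection \<open>Charts and Schubert cells\<close>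

text \<open>\<open>X\<close> is strictly triangular along \<open>f\<close>, so \<open>1 + X\<close>
  is unipotent and its kernel vanishes by substitution in the order of \<open>f\<close>.\<close>

lemma coord_matrices_nilpotent_ker:
  fixes X :: "complex^'n^'n" and f :: "'n \<Rightarrow> nat"
  assumes X: "X \<in> coord_matrices (\<lambda>x y. f x > f y)" and v: "(mat 1 + X) *v v = 0"
  shows "v = 0"
proof -
  have "v $ x = 0" for x
  proof (induction "f x" arbitrary: x rule: less_induct)
    case less
    have "X $ x $ y * v $ y = 0" for y
      using less X by (cases "f y < f x") (auto simp: coord_matrices_def)
    then have "(X *v v) $ x = 0" unfolding matrix_vector_mult_def by (simp only: vec_lambda_beta sum.neutral_const)
    moreover have "v $ x + (X *v v) $ x = 0" using arg_cong[OF v, of "\<lambda>u. u $ x"]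
      by (simp add: matrix_vector_mult_add_rdistrib)
    ultimately show ?case by simp
  qed
  then show ?thesis by (simp add: vec_eq_iff)
qed

lemma coord_matrices_nilpotent_invertible:
  fixes X :: "complex^'n^'n" and f :: "'n \<Rightarrow> nat"
  assumes "X \<in> coord_matrices (\<lambda>x y. f x > f y)"
  shows "invertible (mat 1 + X)"
  using coord_matrices_nilpotent_ker[OF assms] by (rule invertible_of_ker)

text \<open>Uniqueness of the factorization into a unipotent lower and a block upper factor. In
  terms of \<open>B = A - 1\<close> the equation reads \<open>B = Y - X - X ** B\<close> and is
  solved row by row as \<open>f\<close> grows: block upper entries vanish because \<open>X\<close>
  and \<open>Y\<close> have none there, the lower ones because \<open>A\<close> has none.\<close>

lemma coord_matrices_cell_unique:
  fixes X :: "complex^'n^'n" and f :: "'n \<Rightarrow> nat"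
  assumes X: "X \<in> coord_matrices (\<lambda>x y. f x > f y)" and Y: "Y \<in> coord_matrices (\<lambda>x y. f x > f y)"
    and A: "A \<in> coord_matrices (\<lambda>x y. f x \<le> f y)" and eq: "mat 1 + Y = (mat 1 + X) ** A"
  shows "X = Y"
proof -
  define B where "B = A - mat 1"
  have B: "B = Y - X - X ** B"
    using eq by (simp add: B_def matmul_simps algebra_simps)
  have "B $ x $ y = 0" for x y
  proof (induction "f x" arbitrary: x rule: less_induct)
    case less
    show ?case
    proof (cases "f x \<le> f y")
      case True
      have "X $ x $ z * B $ z $ y = 0" for z
        using less X by (cases "f z < f x") (auto simp: coord_matrices_def)
      then have "(X ** B) $ x $ y = 0" unfolding matrix_matrix_mult_def by (simp only: vec_lambda_beta sum.neutral_const)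
      moreover have "X $ x $ y = 0" "Y $ x $ y = 0" using X Y True by (auto simp: coord_matrices_def)
      ultimately show ?thesis by (subst B) simp
    next
      case False
      then have "x \<noteq> y" by auto
      then show ?thesis using A False by (simp add: B_def coord_matrices_def mat_def)
    qed
  qed
  then have "B = 0" by (simp add: vec_eq_iff)
  then show ?thesis using B by simp
qed

lemma coord_matrices_mult:
  fixes X :: "complex^'n^'n" and f :: "'n \<Rightarrow> nat"
  assumes "X \<in> coord_matrices (\<lambda>x y. f x > f y)" "Y \<in> coord_matrices (\<lambda>x y. f x > f y)"
  shows "X ** Y \<in> coord_matrices (\<lambda>x y. f x > f y)"
proof -
  have "X $ x $ z * Y $ z $ y = 0" if "\<not> f x > f y" for x y z
    using assms that by (cases "f z < f x") (auto simp: coord_matrices_def)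
  then have "(\<Sum>z\<in>UNIV. X $ x $ z * Y $ z $ y) = 0" if "\<not> f x > f y" for x y
    using that by (intro sum.neutral) blast
  then show ?thesis by (simp add: coord_matrices_def matrix_matrix_mult_def)
qed

lemma chart_space_transform:
  fixes g h :: "'m::finite cmat"
  assumes g: "g ** h = mat 1" "h ** g = mat 1"
  shows "chart_space c (\<lambda>i. g *v a i) = (\<lambda>X. g ** X ** h) ` chart_space c a"
proof -
  have sp: "vec.span ((\<lambda>i. g *v a i) ` A) = (*v) g ` vec.span (a ` A)" for A
    using vec.linear_span_image[OF matrix_vector_mul_linear_gen, of g "a ` A"] by (simp add: image_image)
  have iff: "X *v (g *v a i) \<in> (*v) g ` V \<longleftrightarrow> (h ** X ** g) *v a i \<in> V" for X i V
  proof
    assume "X *v (g *v a i) \<in> (*v) g ` V"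
    then obtain v where v: "v \<in> V" "X *v (g *v a i) = g *v v" by auto
    then have "(h ** X ** g) *v a i = (h ** g) *v v" by (simp add: matrix_vector_mul_assoc[symmetric])
    then show "(h ** X ** g) *v a i \<in> V" using v g by simp
  next
    assume "(h ** X ** g) *v a i \<in> V"
    moreover have "X *v (g *v a i) = g *v ((h ** X ** g) *v a i)"
      using g(1) by (metis matrix_vector_mul_assoc matrix_vector_mul_lid)
    ultimately show "X *v (g *v a i) \<in> (*v) g ` V" by blast
  qed
  have X: "X \<in> chart_space c (\<lambda>i. g *v a i) \<longleftrightarrow> h ** X ** g \<in> chart_space c a" for X
    unfolding chart_space_def sp iff by simp
  show ?thesis
  proof (intro equalityI subsetI)
    fix X assume "X \<in> chart_space c (\<lambda>i. g *v a i)"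
    moreover have "X = g ** (h ** X ** g) ** h" using g by (metis matrix_mul_assoc matrix_mul_lid matrix_mul_rid)
    ultimately show "X \<in> (\<lambda>X. g ** X ** h) ` chart_space c a" using X by blast
  next
    fix X assume "X \<in> (\<lambda>X. g ** X ** h) ` chart_space c a"
    then obtain Y where Y: "Y \<in> chart_space c a" "X = g ** Y ** h" by blast
    then have "h ** X ** g = Y" using g by (metis matrix_mul_assoc matrix_mul_lid matrix_mul_rid)
    then show "X \<in> chart_space c (\<lambda>i. g *v a i)" using X Y by simp
  qed
qed

lemma chart_space_cong:
  fixes a b :: "nat \<Rightarrow> 'm::finite cvec"
  assumes c: "sum_list c = 2 * CARD('m)" and ab: "\<And>i. i \<in> {1..2 * CARD('m)} \<Longrightarrow> a i = b i"
  shows "chart_space c a = chart_space c b"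
proof -
  have "a ` {sum_list (take (Suc k) c)<..2 * CARD('m)} = b ` {sum_list (take (Suc k) c)<..2 * CARD('m)}" for k
    using ab by (intro image_cong) auto
  moreover have "a i = b i" if "k < length c" "i \<in> block c k" for i k
    using that block_subset[of k c] c ab by auto
  ultimately show ?thesis unfolding chart_space_def by auto
qed

lemma analytic_dim_le:
  assumes "\<And>M d. M \<noteq> {} \<Longrightarrow> M \<subseteq> A \<Longrightarrow> complex_submanifold c d M \<Longrightarrow> d \<le> N"
  shows "analytic_dim c A \<le> N"
proof (cases "{d. \<exists>M. M \<noteq> {} \<and> M \<subseteq> A \<and> complex_submanifold c d M} = {}")
  case True
  \<comment> \<open>The supremum of the empty set of naturals is 0.\<close>
  then show ?thesis unfolding analytic_dim_def by (simp only: Sup_nat_def) simp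
next
  case False
  then show ?thesis unfolding analytic_dim_def by (rule cSup_least) (use assms in blast)
qed

context iwasawa_setup begin

abbreviation "Fstd \<equiv> flag_of c (ubasis nu)"

definition strictly_lower :: "'m cmat set" where
  "strictly_lower = coord_matrices (\<lambda>x y. blk id x > blk id y)"

lemma stab_Fstd: "stab Fstd = coord_matrices (\<lambda>x y. blk id x \<le> blk id y)"
  using stab_flag[OF permutes_id] by simp

lemma chart_space_ubasis: "chart_space c (ubasis nu) = strictly_lower"
  using chart_space_eq[OF permutes_id] by (simp add: strictly_lower_def)

lemma ordered_basis_std: "ordered_basis (ubasis nu)"
  using ordered_basis_ubasis[OF permutes_id] by simp

lemma Fstd_in: "Fstd \<in> flag_manifold c"
  using flag_of_in_flag_manifold[OF ordered_basis_std] sum_c n by simp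

text \<open>Any chart is a translate of the one at the standard flag, which reduces questions about
  charts to the fixed space \<open>strictly_lower\<close>.\<close>

lemma ordered_basisE:
  assumes "ordered_basis (b :: nat \<Rightarrow> 'm cvec)"
  obtains g h where "g ** h = mat 1" "h ** g = mat 1" "invertible g"
    "flag_of c b = act g Fstd" "chart_space c b = (\<lambda>X. g ** X ** h) ` strictly_lower"
    "\<And>X. chart c b (g ** X ** h) = act (g ** (mat 1 + X)) Fstd"
proof -
  obtain g where g: "invertible g" "\<forall>i\<in>{1..2 * CARD('m)}. g *v ubasis nu i = b i"
    using ordered_basis_transform[OF ordered_basis_std assms] by blast
  obtain h where h: "g ** h = mat 1" "h ** g = mat 1" using g(1) by (rule matrix_invE)
  have 1: "flag_of c b = act g Fstd"
    unfolding act_flag_of using sum_c n g(2) by (intro flag_of_cong) auto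
  have 2: "chart_space c b = (\<lambda>X. g ** X ** h) ` strictly_lower"
    unfolding chart_space_ubasis[symmetric] chart_space_transform[OF h, symmetric]
    using sum_c n g(2) by (intro chart_space_cong) auto
  have "(mat 1 + g ** X ** h) ** g = g ** (mat 1 + X)" for X
    using h by (simp add: matmul_simps matrix_mul_assoc[symmetric])
  then have "chart c b (g ** X ** h) = act (g ** (mat 1 + X)) Fstd" for X
    unfolding chart_def 1 act_act by simp
  then show thesis using that h g(1) 1 2 by blast
qed

lemma strictly_lower_invertible: "X \<in> strictly_lower \<Longrightarrow> invertible (mat 1 + X)"
  unfolding strictly_lower_def by (rule coord_matrices_nilpotent_invertible)

lemma act_fixed_stab:
  assumes "act g F = F" shows "g \<in> stab F"
  unfolding stab_def
proof (intro CollectI allI impI ballI)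
  fix i v assume i: "i < length F" and v: "v \<in> F ! i"
  have "F ! i = (*v) g ` (F ! i)" using act_nth[OF i, of g] assms by simp
  then show "g *v v \<in> F ! i" using v by blast
qed

lemma act_eq_stab:
  assumes "act A F = act B F" "h ** A = mat 1" shows "h ** B \<in> stab F"
proof -
  have "act (h ** B) F = act (h ** A) F" using assms(1) by (simp only: act_act[symmetric])
  then have "act (h ** B) F = F" using assms(2) by simp
  then show ?thesis by (rule act_fixed_stab)
qed

lemma cell_inj:
  assumes X: "X \<in> strictly_lower" and Y: "Y \<in> strictly_lower"
    and eq: "act (mat 1 + X) Fstd = act (mat 1 + Y) Fstd"
  shows "X = Y"
proof -
  obtain h where h: "(mat 1 + X) ** h = mat 1" "h ** (mat 1 + X) = mat 1"
    using strictly_lower_invertible[OF X] by (rule matrix_invE)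
  have A: "h ** (mat 1 + Y) \<in> stab Fstd" by (rule act_eq_stab[OF eq h(2)])
  have "mat 1 + Y = (mat 1 + X) ** (h ** (mat 1 + Y))" using h by (simp add: matrix_mul_assoc)
  then show ?thesis
    by (rule coord_matrices_cell_unique[OF X[unfolded strictly_lower_def] Y[unfolded strictly_lower_def] A[unfolded stab_Fstd]])
qed

lemma chart_inj:
  assumes b: "ordered_basis (b :: nat \<Rightarrow> 'm cvec)"
  shows "inj_on (chart c b) (chart_space c b)"
proof (rule inj_onI)
  fix X Y assume XY: "X \<in> chart_space c b" "Y \<in> chart_space c b" "chart c b X = chart c b Y"
  obtain g h where g: "g ** h = mat 1" "h ** g = mat 1" "chart_space c b = (\<lambda>X. g ** X ** h) ` strictly_lower"
    "\<And>X. chart c b (g ** X ** h) = act (g ** (mat 1 + X)) Fstd"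
    by (rule ordered_basisE[OF b]) (rule that)
  obtain X' Y' where X': "X' \<in> strictly_lower" "X = g ** X' ** h" and Y': "Y' \<in> strictly_lower" "Y = g ** Y' ** h"
    using XY g(3) by auto
  have "act h (act (g ** (mat 1 + X')) Fstd) = act h (act (g ** (mat 1 + Y')) Fstd)"
    using XY(3) unfolding X' Y' g(4) by simp
  then have "act (mat 1 + X') Fstd = act (mat 1 + Y') Fstd"
    using g(2) by (simp add: act_act matrix_mul_assoc)
  then have "X' = Y'" by (rule cell_inj[OF X'(1) Y'(1)])
  then show "X = Y" using X' Y' by simp
qed

lemma subspace_chart_space: "subspace (chart_space c' (b :: nat \<Rightarrow> 'b::finite cvec))"
proof -
  have "subspace (vec.span A)" for A :: "'b cvec set" by (rule vec_subspace_imp_subspace[OF vec.subspace_span])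
  note subspaces = subspace_0[OF this] subspace_add[OF this] subspace_scale[OF this]
  show ?thesis unfolding chart_space_def
    by (intro subspaceI CollectI allI impI ballI)
      (simp_all add: subspaces matrix_vector_mult_add_rdistrib
        bounded_bilinear.scaleR_left[OF bounded_bilinear_matrix_vector_mult])
qed

text \<open>At the standard flag the chart space and the stabilizer meet in 0, hence their
  dimensions add up to at most that of \<open>gl(n)\<close>. Both dimensions are invariant under
  conjugation, so the chart and the flag may be unrelated.\<close>

lemma dim_flag_manifold_le:
  assumes F: "(F :: 'm flag) \<in> flag_manifold c" and b: "ordered_basis (b :: nat \<Rightarrow> 'm cvec)"
  shows "dim (chart_space c b) + dim (stab F) \<le> DIM('m cmat)"
proof -
  obtain g where g: "invertible g" "F = act g Fstd"
    using flag_manifold_transitive[OF F _ ordered_basis_std] sum_c n by blast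
  obtain g' h' where g': "g' ** h' = mat 1" "h' ** g' = mat 1" "chart_space c b = (\<lambda>X. g' ** X ** h') ` strictly_lower"
    by (rule ordered_basisE[OF b]) (rule that)
  have "dim (chart_space c b) + dim (stab F) = dim strictly_lower + dim (stab Fstd)"
    using g g' by (simp add: dim_stab_act dim_conj)
  also have "\<dots> = dim {x + y |x y. x \<in> strictly_lower \<and> y \<in> stab Fstd} + dim (strictly_lower \<inter> stab Fstd)"
    by (rule dim_sums_Int[symmetric]) (simp_all add: strictly_lower_def stab_Fstd subspace_coord_matrices)
  also have "strictly_lower \<inter> stab Fstd = {0}"
  proof -
    have "X $ x $ y = 0" if "X \<in> strictly_lower \<inter> stab Fstd" for X x y
      using that by (cases "blk id x \<le> blk id y") (auto simp: strictly_lower_def stab_Fstd coord_matrices_def)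
    then have "strictly_lower \<inter> stab Fstd \<subseteq> {0}" by (auto simp: vec_eq_iff)
    moreover have "0 \<in> strictly_lower \<inter> stab Fstd"
      by (simp add: strictly_lower_def stab_Fstd coord_matrices_def)
    ultimately show ?thesis by blast
  qed
  finally show ?thesis using dim_subset_UNIV[of "{x + y |x y. x \<in> strictly_lower \<and> y \<in> stab Fstd}"] by simp
qed

lemma complex_submanifold_dim:
  assumes M: "complex_submanifold c d (M :: 'm flag set)" "M \<noteq> {}" and F: "(F :: 'm flag) \<in> flag_manifold c"
  shows "2 * d + dim (stab F) \<le> DIM('m cmat)"
proof -
  obtain F' where F': "F' \<in> M" using M by blast
  have "\<exists>b L. ordered_basis (b :: nat \<Rightarrow> 'm cvec) \<and> L \<subseteq> chart_space c b \<and> dim L = 2 * d"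
    using bspec[OF conjunct2[OF M(1)[unfolded complex_submanifold_def]] F'] by (elim exE conjE) (intro exI conjI; assumption)
  then obtain b L where "ordered_basis (b :: nat \<Rightarrow> 'm cvec)" "L \<subseteq> chart_space c b" "dim L = 2 * d" by blast
  then show ?thesis using dim_flag_manifold_le[OF F, of b] dim_subset[of L "chart_space c b"] by linarith
qed

lemma analytic_dim_flag_manifold_le:
  assumes F: "(F :: 'm flag) \<in> flag_manifold c"
  shows "2 * analytic_dim c (flag_manifold c :: 'm flag set) + dim (stab F) \<le> DIM('m cmat)"
proof -
  have "analytic_dim c (flag_manifold c :: 'm flag set) \<le> (DIM('m cmat) - dim (stab F)) div 2"
  proof (rule analytic_dim_le)
    fix M :: "'m flag set" and d assume "M \<noteq> {}" "complex_submanifold c d M"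
    then have "2 * d + dim (stab F) \<le> DIM('m cmat)" using complex_submanifold_dim F by blast
    then show "d \<le> (DIM('m cmat) - dim (stab F)) div 2" by linarith
  qed
  moreover have "dim (stab F) \<le> DIM('m cmat)" by (rule dim_subset_UNIV)
  ultimately show ?thesis by linarith
qed

lemma analytic_dim_ge:
  assumes M: "complex_submanifold c d M" "M \<noteq> {}" "M \<subseteq> A"
  shows "d \<le> analytic_dim c (A :: 'm flag set)"
  unfolding analytic_dim_def
proof (rule cSup_upper)
  show "d \<in> {d. \<exists>M. M \<noteq> {} \<and> M \<subseteq> A \<and> complex_submanifold c d M}" using M by blast
  show "bdd_above {d. \<exists>M. M \<noteq> {} \<and> M \<subseteq> A \<and> complex_submanifold c d M}"
  proof (rule bdd_aboveI)
    fix e assume "e \<in> {d. \<exists>M. M \<noteq> {} \<and> M \<subseteq> A \<and> complex_submanifold c d M}"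
    then obtain M :: "'m flag set" where M: "complex_submanifold c e M" "M \<noteq> {}" by blast
    show "e \<le> DIM('m cmat)" using complex_submanifold_dim[OF M Fstd_in] by linarith
  qed
qed

lemma borel_alg_eq_stab: "borel_alg = stab (flag_of (replicate (2 * CARD('m)) 1) (ubasis nu))"
proof -
  \<comment> \<open>The same setting with blocks of length 1: there the block of a coordinate is its
    rank minus 1, as blocks are counted from 0.\<close>
  interpret full: iwasawa_setup nu "replicate n 1" n
    using nu n by unfold_locales (auto simp: sum_list_replicate)
  have "pos_block (replicate n 1) i = i - 1" if "i \<in> {1..n}" for i
  proof -
    have "i \<in> block (replicate n 1) (i - 1)" using that by (auto simp: block_def sum_list_replicate)
    moreover have "i - 1 < n" using that by auto
    ultimately show ?thesis using in_block_iff[of i "replicate n 1" "i - 1"] that by (simp add: sum_list_replicate)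
  qed
  then have blk: "full.blk id x = rank x - 1" for x unfolding full.blk_def inv_id id_apply using rank_in .
  have "rank x - 1 \<le> rank y - 1 \<longleftrightarrow> rank x \<le> rank y" for x y using rank_bounds(1)[of x] rank_bounds(1)[of y] by linarith
  then show ?thesis unfolding borel_alg_def n[symmetric] full.stab_Fstd blk by (simp only:)
qed

lemma iwasawa_borel_iff: "g \<in> iwasawa_borel nu \<longleftrightarrow> g \<in> SL \<and> g \<in> borel_alg"
proof -
  let ?F = "flag_of (replicate (2 * CARD('m)) 1) (ubasis nu) :: 'm flag"
  have F: "?F \<in> flag_manifold (replicate (2 * CARD('m)) 1)"
    by (rule flag_of_in_flag_manifold[OF ordered_basis_std]) (simp add: sum_list_replicate)
  have "act g ?F = ?F" if "g \<in> SL" "g \<in> stab ?F"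
    using that F by (intro act_stab) (auto simp: SL_def invertible_det_nz)
  moreover have "g \<in> stab ?F" if "act g ?F = ?F"
    using that act_eq_stab[of "mat 1" ?F g "mat 1"] by simp
  ultimately show ?thesis by (auto simp: iwasawa_borel_def borel_alg_eq_stab Let_def)
qed

context
  fixes w assumes w: "w permutes {1..n}"
begin

text \<open>The matrix units of the Borel algebra that move the flag of \<open>u \<circ> w\<close>;
  their number is the complex dimension of the Schubert cell.\<close>

definition inversions :: nat where
  "inversions = card {(x, y). rank x \<le> rank y \<and> blk w x > blk w y}"

lemma dim_borel_stab:
  "dim borel_alg = dim (borel_alg \<inter> stab (flag_of c (ubasis nu \<circ> w))) + 2 * inversions"
proof -
  have "card {(x, y). rank x \<le> rank y} = card ({(x, y). rank x \<le> rank y \<and> blk w x \<le> blk w y} \<union>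
      {(x, y). rank x \<le> rank y \<and> blk w x > blk w y})"
    by (rule arg_cong[of _ _ card]) auto
  also have "\<dots> = card {(x, y). rank x \<le> rank y \<and> blk w x \<le> blk w y} + inversions"
    unfolding inversions_def by (rule card_Un_disjoint) auto
  finally show ?thesis
    by (simp add: borel_alg_def stab_flag[OF w] coord_matrices_Int dim_coord_matrices)
qed

text \<open>The chart centred at the flag of \<open>u \<circ> w\<close> carries the linear space
  \<open>L\<close> of chart matrices in the Borel algebra into the Borel orbit, since
  \<open>1 + X\<close> lies in the Borel group once its determinant is normalized. As
  \<open>L\<close> is already linear in the chart, the identity serves as straightening map.\<close>

lemma inversions_le_analytic_dim: "inversions \<le> analytic_dim c (schubert_variety nu c w)"
proof -
  let ?b = "ubasis nu \<circ> w"
  let ?C = "chart_space c ?b"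
  define L where "L = ?C \<inter> borel_alg"
  have L: "L = coord_matrices (\<lambda>x y. blk w x > blk w y \<and> rank x \<le> rank y)"
    by (simp add: L_def chart_space_eq[OF w] borel_alg_def coord_matrices_Int)
  have b: "ordered_basis ?b" by (rule ordered_basis_ubasis[OF w])
  have inj: "inj_on (chart c ?b) ?C" by (rule chart_inj[OF b])
  have F: "flag_of c ?b \<in> flag_manifold c" using flag_of_in_flag_manifold[OF b] sum_c n by simp
  have inv: "invertible (mat 1 + X)" if "X \<in> ?C" for X
    using that unfolding chart_space_eq[OF w] by (rule coord_matrices_nilpotent_invertible)
  have chart_in: "chart c ?b X \<in> flag_manifold c" if "X \<in> ?C" for X
    unfolding chart_def using act_flag_manifold[OF inv[OF that] F] .
  let ?M = "chart c ?b ` L"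
  have cs: "complex_subspace L"
    unfolding complex_subspace_def L
    by (rule conjI[OF subspace_coord_matrices]) (auto simp: coord_matrices_def imult_def map_matrix_def)
  have dimL: "dim L = 2 * inversions"
    by (simp add: L dim_coord_matrices inversions_def conj_commute)
  have pre: "{X \<in> ?C. chart c ?b X \<in> ?M} = L"
    using inj by (auto simp: L_def inj_on_def)
  have "complex_submanifold c inversions ?M"
    unfolding complex_submanifold_def
  proof (intro conjI ballI)
    show "?M \<subseteq> flag_manifold c" using chart_in by (auto simp: L_def)
    fix F assume "F \<in> ?M"
    then have F: "F \<in> chart c ?b ` ?C" by (auto simp: L_def)
    have holo: "holo_on id ?C"
      unfolding holo_on_def by (auto intro!: exI[of _ id] simp: id_def)
    show "\<exists>b W W' h h' L. ordered_basis b \<and> openin (top_of_set (chart_space c b)) W \<and>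
          openin (top_of_set (chart_space c b)) W' \<and> F \<in> chart c b ` W \<and> homeomorphism W W' h h' \<and>
          holo_on h W \<and> holo_on h' W' \<and> complex_subspace L \<and> L \<subseteq> chart_space c b \<and>
          dim L = 2 * inversions \<and> h ` {X \<in> W. chart c b X \<in> ?M} = W' \<inter> L"
      by (rule exI[of _ ?b], rule exI[of _ ?C], rule exI[of _ ?C], rule exI[of _ id], rule exI[of _ id], rule exI[of _ L])
        (use b F holo cs dimL pre in \<open>auto simp: L_def homeomorphism_ident[unfolded id_def[symmetric]]\<close>)
  qed
  moreover have "?M \<noteq> {}" using cs by (auto simp: complex_subspace_def subspace_def)
  moreover have "?M \<subseteq> schubert_variety nu c w"
  proof -
    have "?M \<subseteq> orbit (iwasawa_borel nu) (flag_of c ?b)"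
    proof
      fix F assume "F \<in> ?M"
      then obtain X where X: "X \<in> L" "F = act (mat 1 + X) (flag_of c ?b)" by (auto simp: chart_def)
      let ?g = "mat (det_normalizer (mat 1 + X)) ** (mat 1 + X)"
      have "mat 1 + X \<in> borel_alg" using X by (auto simp: L borel_alg_def coord_matrices_def mat_def)
      then have "?g \<in> borel_alg"
        by (auto simp: borel_alg_def coord_matrices_def matrix_matrix_mult_def mat_def if_distrib[of "\<lambda>x. x * _"] cong: if_cong)
      moreover have "?g \<in> SL" using X inv by (intro det_normalizer_SL) (auto simp: L_def)
      ultimately have "?g \<in> iwasawa_borel nu" by (simp add: iwasawa_borel_iff)
      moreover have "F = act ?g (flag_of c ?b)"
        using X(2) act_det_normalizer[OF flag_of_in_flag_manifold[OF b]] sum_c n by simp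
      ultimately show "F \<in> orbit (iwasawa_borel nu) (flag_of c ?b)" by (auto simp: orbit_def)
    qed
    moreover have "?M \<subseteq> topspace (flag_topology c)"
    proof -
      have "openin (flag_topology c) (flag_manifold c :: 'm flag set)"
        unfolding openin_flag_topology
      proof (intro conjI ballI)
        fix F :: "'m flag" assume "F \<in> flag_manifold c"
        then have "{g \<in> SL. act g F \<in> flag_manifold c} = SL"
          by (auto simp: SL_def invertible_det_nz intro!: act_flag_manifold)
        then show "openin (top_of_set SL) {g \<in> SL. act g F \<in> flag_manifold c}" by (simp only: openin_subtopology_self)
      qed simp
      then show ?thesis using chart_in by (force simp: L_def dest: openin_subset)
    qed
    ultimately show ?thesis
      unfolding schubert_variety_def using closure_of_subset_Int[of "flag_topology c" "orbit (iwasawa_borel nu) (flag_of c ?b)"] by blast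
  qed
  ultimately show ?thesis by (rule analytic_dim_ge)
qed

end

end

subsection \<open>Semicontinuity on Schubert varieties\<close>

text \<open>Openness in the flag topology is tested along all maps
  \<open>g \<mapsto> act g F\<close> on \<open>SL\<close>. A condition whose failure is open along
  each of them passes from a set to its closure.\<close>

lemma closure_of_orbit_property:
  fixes c :: "nat list" and F :: "'m::finite flag"
  assumes Q: "\<And>F. F \<in> flag_manifold c \<Longrightarrow> openin (top_of_set SL) {g \<in> SL. \<not> Q (act g F)}"
    and S: "\<And>F. F \<in> S \<Longrightarrow> Q F" and F: "F \<in> flag_topology c closure_of S"
  shows "Q F"
proof (rule ccontr)
  assume nQ: "\<not> Q F"
  let ?U = "{F \<in> flag_manifold c. \<not> Q F}"
  have "openin (flag_topology c) ?U"
    unfolding openin_flag_topology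
  proof (intro conjI ballI)
    fix F' :: "'m flag" assume F': "F' \<in> flag_manifold c"
    then have "{g \<in> SL. act g F' \<in> ?U} = {g \<in> SL. \<not> Q (act g F')}"
      by (auto simp: SL_def invertible_det_nz intro!: act_flag_manifold)
    then show "openin (top_of_set SL) {g \<in> SL. act g F' \<in> ?U}" using Q[OF F'] by simp
  qed auto
  moreover have "F \<in> flag_manifold c"
  proof -
    have "F \<in> topspace (flag_topology c)" using F by (metis closure_of_subset_topspace subsetD)
    then obtain U where "openin (flag_topology c) U" "F \<in> U" unfolding topspace_def by blast
    then show ?thesis unfolding openin_flag_topology by blast
  qed
  then have "F \<in> ?U" using nQ by simp
  moreover have "\<forall>T. F \<in> T \<and> openin (flag_topology c) T \<longrightarrow> (\<exists>y. y \<in> S \<and> y \<in> T)"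
    using F unfolding in_closure_of by (rule conjunct2)
  ultimately have "\<exists>y. y \<in> S \<and> y \<in> ?U" by (elim allE[of _ ?U] impE conjI)
  then show False using S by blast
qed

lemma openin_of_eventually:
  fixes S :: "'a::metric_space set"
  assumes "\<And>x. x \<in> S \<Longrightarrow> P x \<Longrightarrow> eventually P (at x within S)"
  shows "openin (top_of_set S) {x \<in> S. P x}"
  unfolding openin_contains_ball
proof (intro conjI ballI)
  fix x assume "x \<in> {x \<in> S. P x}"
  then have x: "x \<in> S" "P x" by auto
  from assms[OF x] obtain d where "d > 0" "\<forall>y\<in>S. y \<noteq> x \<and> dist y x < d \<longrightarrow> P y"
    unfolding eventually_at by blast
  then show "\<exists>e>0. ball x e \<inter> S \<subseteq> {x \<in> S. P x}" using x
    by (intro exI[of _ d]) (auto simp: dist_commute)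
qed auto

text \<open>Replacing \<open>g V\<close> and \<open>U\<close> by the range of \<open>(v, u) \<mapsto> g v + u\<close> turns upper semicontinuity of
  intersections into lower semicontinuity of the rank.\<close>

lemma open_dim_intersection:
  fixes A :: "'g::metric_space \<Rightarrow> 'a::euclidean_space \<Rightarrow> 'c::euclidean_space" and B :: "'g \<Rightarrow> 'b::euclidean_space \<Rightarrow> 'c"
  assumes lin: "\<And>g. linear (A g)" "\<And>g. linear (B g)"
    and inj: "\<And>g. g \<in> S \<Longrightarrow> inj (A g)" "\<And>g. g \<in> S \<Longrightarrow> inj (B g)"
    and cont: "\<And>g v. ((\<lambda>g. A g v) \<longlongrightarrow> A g v) (at g within S)" "\<And>g v. ((\<lambda>g. B g v) \<longlongrightarrow> B g v) (at g within S)"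
    and V: "subspace V" and U: "subspace U"
  shows "openin (top_of_set S) {g \<in> S. \<not> N \<le> dim (A g ` V \<inter> B g ` U)}"
proof (rule openin_of_eventually)
  fix g0 assume g0: "g0 \<in> S" "\<not> N \<le> dim (A g0 ` V \<inter> B g0 ` U)"
  define T where "T = (\<lambda>g (v, u). A g v + B g u)"
  have linT: "linear (T g)" for g
    unfolding T_def by (intro linearI) (auto simp: linear_add[OF lin(1)] linear_add[OF lin(2)] linear_scale[OF lin(1)]
      linear_scale[OF lin(2)] algebra_simps)
  have dimT: "dim (T g ` (V \<times> U)) + dim (A g ` V \<inter> B g ` U) = dim V + dim U" if "g \<in> S" for g
  proof -
    have "T g ` (V \<times> U) = {x + y |x y. x \<in> A g ` V \<and> y \<in> B g ` U}" by (force simp: T_def)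
    moreover have "subspace (A g ` V)" "subspace (B g ` U)" using lin V U by (auto intro: linear_subspace_image)
    moreover have "dim (A g ` V) = dim V" "dim (B g ` U) = dim U"
      using dim_image_eq[OF lin(1) inj_on_subset[OF inj(1)[OF that] subset_UNIV]]
        dim_image_eq[OF lin(2) inj_on_subset[OF inj(2)[OF that] subset_UNIV]] by blast+
    ultimately show ?thesis using dim_sums_Int[of "A g ` V" "B g ` U"] by simp
  qed
  have "eventually (\<lambda>g. dim (T g0 ` (V \<times> U)) \<le> dim (T g ` (V \<times> U))) (at g0 within S)"
  proof (rule dim_image_lower_semicontinuous[OF linT _ linT subspace_Times[OF V U]])
    fix v show "((\<lambda>g. T g v) \<longlongrightarrow> T g0 v) (at g0 within S)"
      unfolding T_def by (auto simp: split_beta intro!: tendsto_add cont)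
  qed
  moreover have "eventually (\<lambda>g. g \<in> S) (at g0 within S)" by (simp add: eventually_at_topological) blast
  ultimately show "eventually (\<lambda>g. \<not> N \<le> dim (A g ` V \<inter> B g ` U)) (at g0 within S)"
  proof eventually_elim
    case (elim g)
    then show ?case using dimT[OF elim(2)] dimT[OF g0(1)] g0(2) by linarith
  qed
qed

lemma SL_invertible: "g \<in> SL \<Longrightarrow> invertible g"
  by (simp add: SL_def invertible_det_nz)

lemma inj_matmul:
  assumes "invertible (g :: complex^'n^'n)"
  shows "inj (\<lambda>X. g ** X)" "inj (\<lambda>X. X ** g)"
proof -
  obtain h where h: "g ** h = mat 1" "h ** g = mat 1" using assms by (rule matrix_invE)
  show "inj (\<lambda>X. g ** X)" by (rule injI) (metis h(2) matrix_mul_assoc matrix_mul_lid)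
  show "inj (\<lambda>X. X ** g)" by (rule injI) (metis h(1) matrix_mul_assoc matrix_mul_rid)
qed

text \<open>Right multiplication by \<open>g\<close> removes the inverse from
  \<open>g ** X ** h\<close> and leaves two spaces that depend linearly on \<open>g\<close>, the
  form needed by \<open>open_dim_intersection\<close>.\<close>

lemma dim_conj_stab_Int:
  fixes g h :: "'m::finite cmat"
  assumes g: "g ** h = mat 1" "h ** g = mat 1"
  shows "dim (B \<inter> stab (act g F)) = dim ((\<lambda>X. g ** X) ` stab F \<inter> (\<lambda>Y. Y ** g) ` B)"
proof -
  have "(\<lambda>Y. Y ** g) ` (B \<inter> stab (act g F)) = (\<lambda>X. g ** X) ` stab F \<inter> (\<lambda>Y. Y ** g) ` B"
  proof (intro equalityI subsetI)
    fix Z assume "Z \<in> (\<lambda>Y. Y ** g) ` (B \<inter> stab (act g F))"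
    then obtain X where X: "X \<in> stab F" "g ** X ** h \<in> B" "Z = g ** X ** h ** g"
      unfolding stab_act[OF g] by blast
    then have "Z = g ** X" using g by (metis matrix_mul_assoc matrix_mul_rid)
    then show "Z \<in> (\<lambda>X. g ** X) ` stab F \<inter> (\<lambda>Y. Y ** g) ` B" using X by blast
  next
    fix Z assume "Z \<in> (\<lambda>X. g ** X) ` stab F \<inter> (\<lambda>Y. Y ** g) ` B"
    then obtain X Y where X: "X \<in> stab F" "Z = g ** X" "Y \<in> B" "Z = Y ** g" by blast
    then have "Y = g ** X ** h" using g by (metis matrix_mul_assoc matrix_mul_rid)
    then show "Z \<in> (\<lambda>Y. Y ** g) ` (B \<inter> stab (act g F))" using X unfolding stab_act[OF g] by blast
  qed
  moreover have "invertible g" using g by (auto simp: invertible_def)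
  then have "dim ((\<lambda>Y. Y ** g) ` S) = dim S" for S :: "'m cmat set"
    by (intro dim_image_eq[OF linear_matmul_right inj_on_subset[OF inj_matmul(2) subset_UNIV]])
  ultimately show ?thesis by metis
qed

lemma open_dim_stab_Int:
  assumes F: "F \<in> flag_manifold c" and B: "subspace B"
  shows "openin (top_of_set SL) {g \<in> SL. \<not> N \<le> dim (B \<inter> stab (act g F))}"
proof -
  have "openin (top_of_set SL) {g \<in> SL. \<not> N \<le> dim ((\<lambda>X. g ** X) ` stab F \<inter> (\<lambda>Y. Y ** g) ` B)}"
  proof (rule open_dim_intersection)
    show "((\<lambda>g. g ** v) \<longlongrightarrow> g ** v) (at g within SL)" "((\<lambda>g. v ** g) \<longlongrightarrow> v ** g) (at g within SL)" for g v :: "'a cmat"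
      by (auto intro!: bounded_bilinear.tendsto[OF bounded_bilinear_matrix_mult] tendsto_intros)
  qed (auto simp: linear_matmul_left linear_matmul_right SL_invertible inj_matmul subspace_stab[OF F] B)
  moreover have "dim (B \<inter> stab (act g F)) = dim ((\<lambda>X. g ** X) ` stab F \<inter> (\<lambda>Y. Y ** g) ` B)" if g: "g \<in> SL" for g
  proof -
    obtain h where "g ** h = mat 1" "h ** g = mat 1" using SL_invertible[OF g] by (rule matrix_invE)
    then show ?thesis by (rule dim_conj_stab_Int)
  qed
  ultimately show ?thesis by (simp cong: conj_cong)
qed

lemma open_dim_nth_Int:
  fixes F :: "'m::finite flag"
  assumes F: "F \<in> flag_manifold c" and U: "subspace U" and k: "k < length c"
  shows "openin (top_of_set SL) {g \<in> SL. \<not> N \<le> dim (act g F ! k \<inter> U)}"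
proof -
  have "openin (top_of_set SL) {g \<in> SL. \<not> N \<le> dim ((\<lambda>v. g *v v) ` (F ! k) \<inter> (\<lambda>v. v) ` U)}"
  proof (rule open_dim_intersection)
    show "((\<lambda>g. g *v v) \<longlongrightarrow> g *v v) (at g within SL)" for g :: "'m cmat" and v
      by (auto intro!: bounded_bilinear.tendsto[OF bounded_bilinear_matrix_vector_mult] tendsto_intros)
    show "linear ((*v) g)" for g :: "'m cmat" by simp
    show "linear (\<lambda>v :: 'm cvec. v)" by (simp add: linear_id[unfolded id_def])
    show "inj ((*v) g)" if "g \<in> SL" for g :: "'m cmat" using inj_matrix_vector_mult[OF SL_invertible[OF that]] .
    show "subspace (F ! k)" using flag_manifold_subspace[OF F k] by (rule vec_subspace_imp_subspace)
  qed (use U in auto)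
  then show ?thesis using k flag_manifold_length[OF F] by (simp add: act_nth)
qed

lemma coord_space_Int: "coord_space I \<inter> coord_space J = coord_space (I \<inter> J)"
  by (auto simp: coord_space_def)

context iwasawa_setup begin

lemma borel_mult:
  assumes "X \<in> borel_alg" "Y \<in> borel_alg" shows "X ** Y \<in> borel_alg"
proof -
  have "X $ x $ z * Y $ z $ y = 0" if "\<not> rank x \<le> rank y" for x y z
    using assms that by (cases "rank x \<le> rank z") (auto simp: borel_alg_def coord_matrices_def)
  then have "(\<Sum>z\<in>UNIV. X $ x $ z * Y $ z $ y) = 0" if "\<not> rank x \<le> rank y" for x y
    using that by (intro sum.neutral) blast
  then show ?thesis by (simp add: borel_alg_def coord_matrices_def matrix_matrix_mult_def)
qed

lemma borel_alg_preserves: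
  assumes "X \<in> borel_alg" "v \<in> coord_space {x. rank x \<le> j}" 
  shows "X *v v \<in> coord_space {x. rank x \<le> j}"
  using assms image_coord_space_subset[of "{x. rank x \<le> j}" X "{x. rank x \<le> j}"]
  by (auto simp: borel_alg_def coord_matrices_def)

lemma borel_group_stab: "act g (flag_of (replicate (2 * CARD('m)) 1) (ubasis nu)) = flag_of (replicate (2 * CARD('m)) 1) (ubasis nu)"
  if "g \<in> borel_alg" "invertible g"
  using that act_stab[OF flag_of_in_flag_manifold[OF ordered_basis_std, of "replicate (2 * CARD('m)) 1"]]
  by (simp add: borel_alg_eq_stab sum_list_replicate)

lemma borel_inverse:
  assumes g: "g \<in> borel_alg" "g ** h = mat 1" "h ** g = mat 1" shows "h \<in> borel_alg"
proof -
  let ?F = "flag_of (replicate (2 * CARD('m)) 1) (ubasis nu) :: 'm flag"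
  have "act g ?F = ?F" using g by (intro borel_group_stab) (auto simp: invertible_def)
  then have "act h (act g ?F) = act h ?F" by simp
  then have "act h ?F = ?F" using g by (simp add: act_act)
  then show ?thesis unfolding borel_alg_eq_stab by (rule act_fixed_stab)
qed

context
  fixes w assumes w: "w permutes {1..n}"
begin

lemma flag_w_in: "flag_of c (ubasis nu \<circ> w) \<in> flag_manifold c"
  using flag_of_in_flag_manifold[OF ordered_basis_ubasis[OF w]] sum_c n by simp

text \<open>Along its orbit the Borel group conjugates the intersections of \<open>borel_alg\<close>
  with the stabilizers into each other, and in the closure their dimension can only jump up.\<close>

lemma schubert_dim_stab:
  assumes F: "F \<in> schubert_variety nu c w"
  shows "dim borel_alg \<le> dim (borel_alg \<inter> stab F) + 2 * inversions w"
proof -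
  let ?Fw = "flag_of c (ubasis nu \<circ> w)"
  let ?N = "dim (borel_alg \<inter> stab ?Fw)"
  have "?N \<le> dim (borel_alg \<inter> stab F)"
  proof (rule closure_of_orbit_property[OF _ _ F[unfolded schubert_variety_def]])
    show "openin (top_of_set SL) {g \<in> SL. \<not> ?N \<le> dim (borel_alg \<inter> stab (act g F))}"
      if "F \<in> flag_manifold c" for F by (rule open_dim_stab_Int[OF that subspace_borel_alg])
    fix F assume "F \<in> orbit (iwasawa_borel nu) ?Fw"
    then obtain g where g: "g \<in> SL" "g \<in> borel_alg" "F = act g ?Fw"
      by (auto simp: orbit_def iwasawa_borel_iff)
    obtain h where h: "g ** h = mat 1" "h ** g = mat 1" using SL_invertible[OF g(1)] by (rule matrix_invE)
    have "h \<in> borel_alg" using g(2) h by (rule borel_inverse)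
    have "(\<lambda>X. g ** X ** h) ` (borel_alg \<inter> stab ?Fw) \<subseteq> borel_alg \<inter> stab F"
      unfolding g(3) stab_act[OF h] using g(2) \<open>h \<in> borel_alg\<close> by (auto intro: borel_mult)
    then have "dim ((\<lambda>X. g ** X ** h) ` (borel_alg \<inter> stab ?Fw)) \<le> dim (borel_alg \<inter> stab F)"
      by (rule dim_subset)
    then show "?N \<le> dim (borel_alg \<inter> stab F)" by (simp add: dim_conj[OF h])
  qed
  then show ?thesis using dim_borel_stab[OF w] by linarith
qed

text \<open>The classical incidence conditions of a Schubert variety with respect to the Iwasawa
  flag, which the Borel group fixes: the dimensions of intersection are constant on the orbit and do
  not drop in the closure.\<close>

lemma schubert_rank:
  assumes F: "F \<in> schubert_variety nu c w" and k: "k < length c"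
  shows "2 * card {x. blk w x \<le> k \<and> rank x \<le> j} \<le> dim (F ! k \<inter> coord_space {x. rank x \<le> j})"
proof (rule closure_of_orbit_property[OF _ _ F[unfolded schubert_variety_def]])
  let ?Fw = "flag_of c (ubasis nu \<circ> w)"
  let ?U = "coord_space {x. rank x \<le> j}"
  let ?N = "2 * card {x. blk w x \<le> k \<and> rank x \<le> j}"
  show "openin (top_of_set SL) {g \<in> SL. \<not> ?N \<le> dim (act g F ! k \<inter> ?U)}"
    if "F \<in> flag_manifold c" for F
    by (rule open_dim_nth_Int[OF that vec_subspace_imp_subspace[OF vec_subspace_coord_space] k])
  fix F assume "F \<in> orbit (iwasawa_borel nu) ?Fw"
  then obtain g where g: "g \<in> SL" "g \<in> borel_alg" "F = act g ?Fw"
    by (auto simp: orbit_def iwasawa_borel_iff)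
  have "(*v) g ` (?Fw ! k \<inter> ?U) \<subseteq> F ! k \<inter> ?U"
    unfolding g(3) using k borel_alg_preserves[OF g(2)] by (auto simp: act_nth)
  then have "dim ((*v) g ` (?Fw ! k \<inter> ?U)) \<le> dim (F ! k \<inter> ?U)" by (rule dim_subset)
  moreover have "dim ((*v) g ` (?Fw ! k \<inter> ?U)) = dim (?Fw ! k \<inter> ?U)"
    using inj_matrix_vector_mult[OF SL_invertible[OF g(1)]] by (intro dim_image_eq) (auto intro: inj_on_subset)
  moreover have "?Fw ! k \<inter> ?U = coord_space ({x. blk w x \<le> k} \<inter> {x. rank x \<le> j})"
    by (simp only: flag_nth[OF w k] coord_space_Int)
  moreover have "{x. blk w x \<le> k} \<inter> {x. rank x \<le> j} = {x. blk w x \<le> k \<and> rank x \<le> j}" by auto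
  ultimately show "?N \<le> dim (F ! k \<inter> ?U)" by (simp add: dim_coord_space)
qed

end

end

subsection \<open>Tangent vectors of compact orbits\<close>

lemma dim_kernel_image:
  fixes f :: "'a::euclidean_space \<Rightarrow> 'b::euclidean_space"
  assumes f: "linear f" and S: "subspace S"
  shows "dim S = dim {x \<in> S. f x = 0} + dim (f ` S)"
proof -
  obtain R where R: "range R \<subseteq> S" "linear R" "\<And>v. v \<in> f ` S \<Longrightarrow> f (R v) = v"
    using linear_exists_right_inverse_on[OF f S] by auto
  let ?A = "{x \<in> S. f x = 0}" and ?B = "R ` f ` S"
  have A: "subspace ?A"
    using S by (auto intro!: subspaceI simp: subspace_0 subspace_add subspace_scale linear_0[OF f] linear_add[OF f] linear_scale[OF f])
  have fS: "subspace (f ` S)" using f S by (rule linear_subspace_image)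
  have B: "subspace ?B" using R(2) fS by (rule linear_subspace_image)
  have "inj_on R (f ` S)" using R(3) by (rule inj_on_inverseI)
  then have dimB: "dim ?B = dim (f ` S)"
    using fS R(2) by (intro dim_image_eq) (auto simp: span_eq_iff[THEN iffD2])
  have "R 0 = 0" using R(2) by (rule linear_0)
  have "?A \<inter> ?B \<subseteq> {0}"
  proof
    fix x assume x: "x \<in> ?A \<inter> ?B"
    then obtain y where y: "y \<in> f ` S" "x = R y" by blast
    then have "y = 0" using R(3)[OF y(1)] x by simp
    then show "x \<in> {0}" using y \<open>R 0 = 0\<close> by simp
  qed
  then have "?A \<inter> ?B = {0}" using subspace_0[OF A] subspace_0[OF B] by blast
  moreover have "{x + y |x y. x \<in> ?A \<and> y \<in> ?B} = S"
  proof (intro equalityI subsetI)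
    fix z assume "z \<in> {x + y |x y. x \<in> ?A \<and> y \<in> ?B}"
    then show "z \<in> S" using R(1) subspace_add[OF S] by blast
  next
    fix z assume z: "z \<in> S"
    have "f (z - R (f z)) = 0" using R(3)[of "f z"] z by (simp add: linear_diff[OF f])
    moreover have "z - R (f z) \<in> S" using R(1) z S by (auto intro: subspace_diff)
    ultimately have "z - R (f z) \<in> ?A" by simp
    moreover have "R (f z) \<in> ?B" using z by blast
    moreover have "z = (z - R (f z)) + R (f z)" by simp
    ultimately show "z \<in> {x + y |x y. x \<in> ?A \<and> y \<in> ?B}" by blast
  qed
  ultimately show ?thesis using dim_sums_Int[OF A B] dimB by simp
qed

lemma curve_derivative_in_subspace:
  fixes \<gamma> :: "real \<Rightarrow> 'a::euclidean_space"
  assumes der: "(\<gamma> has_vector_derivative v) (at 0)" and L: "subspace L"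
    and ev: "eventually (\<lambda>t. \<gamma> t \<in> L) (at 0)" and 0: "\<gamma> 0 \<in> L"
  shows "v \<in> L"
proof (rule Lim_in_closed_set[OF closed_subspace[OF L]])
  show "((\<lambda>t. (\<gamma> t - \<gamma> 0) /\<^sub>R t) \<longlongrightarrow> v) (at 0)"
  proof -
    have "((\<lambda>t. ((\<gamma> t - \<gamma> 0) - t *\<^sub>R v) /\<^sub>R norm t) \<longlongrightarrow> 0) (at 0)"
      using der unfolding has_vector_derivative_def has_derivative_at_within by simp
    then have "((\<lambda>t. norm (((\<gamma> t - \<gamma> 0) - t *\<^sub>R v) /\<^sub>R norm t)) \<longlongrightarrow> 0) (at 0)"
      by (rule tendsto_norm_zero)
    then have "((\<lambda>t. norm ((\<gamma> t - \<gamma> 0) /\<^sub>R t - v)) \<longlongrightarrow> 0) (at 0)"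
    proof (rule Lim_transform_eventually)
      have "norm (((\<gamma> t - \<gamma> 0) - t *\<^sub>R v) /\<^sub>R norm t) = norm ((\<gamma> t - \<gamma> 0) /\<^sub>R t - v)" if "t \<noteq> 0" for t
      proof -
        have "(\<gamma> t - \<gamma> 0) /\<^sub>R t - v = ((\<gamma> t - \<gamma> 0) - t *\<^sub>R v) /\<^sub>R t" using that by (simp add: scaleR_diff_right)
        then show ?thesis by simp
      qed
      then show "eventually (\<lambda>t. norm (((\<gamma> t - \<gamma> 0) - t *\<^sub>R v) /\<^sub>R norm t) = norm ((\<gamma> t - \<gamma> 0) /\<^sub>R t - v)) (at 0)"
        by (auto simp: eventually_at intro: exI[of _ 1])
    qed
    from LIM_zero_cancel[OF tendsto_norm_zero_cancel[OF this]] show ?thesis .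
  qed
  show "eventually (\<lambda>t. (\<gamma> t - \<gamma> 0) /\<^sub>R t \<in> L) (at 0)"
    using ev by eventually_elim (intro subspace_scale subspace_diff L 0)
qed simp

lemma curve_compose:
  fixes \<gamma> :: "real \<Rightarrow> 'a::euclidean_space" and h :: "'a \<Rightarrow> 'b::euclidean_space"
  assumes der: "(\<gamma> has_vector_derivative v) (at 0)"
    and ev: "eventually (\<lambda>t. \<gamma> t \<in> W) (at 0)" and 0: "\<gamma> 0 \<in> W"
    and h: "(h has_derivative A) (at (\<gamma> 0) within W)"
  shows "((\<lambda>t. h (\<gamma> t)) has_vector_derivative A v) (at 0)"
proof -
  obtain e where "e > 0" and e': "\<And>t. t \<noteq> 0 \<Longrightarrow> dist t 0 < e \<Longrightarrow> \<gamma> t \<in> W"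
    using ev unfolding eventually_at by auto
  \<comment> \<open>\<open>h\<close> is differentiable only within \<open>W\<close>, so the curve is
    cut down to an interval on which it stays in \<open>W\<close>.\<close>
  have e: "e > 0" "\<And>t. t \<in> ball 0 e \<Longrightarrow> \<gamma> t \<in> W"
  proof -
    fix t :: real assume "t \<in> ball 0 e"
    then show "\<gamma> t \<in> W" using 0 e'[of t] by (cases "t = 0") (auto simp: dist_commute)
  qed fact
  let ?T = "ball 0 e :: real set"
  have "(\<gamma> has_derivative (\<lambda>t. t *\<^sub>R v)) (at 0 within ?T)"
    using der unfolding has_vector_derivative_def by (rule has_derivative_at_withinI)
  moreover have "(h has_derivative A) (at (\<gamma> 0) within \<gamma> ` ?T)"
    using h e by (auto intro: has_derivative_subset)
  ultimately have "((\<lambda>t. h (\<gamma> t)) has_derivative (\<lambda>t. A (t *\<^sub>R v))) (at 0 within ?T)"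
    by (rule has_derivative_in_compose)
  moreover have "A (t *\<^sub>R v) = t *\<^sub>R A v" for t
    using h by (simp add: has_derivative_linear linear_scale)
  ultimately show ?thesis
    unfolding has_vector_derivative_def using e(1) by (simp add: at_within_open[of 0 ?T])
qed

text \<open>The Lie algebra of \<open>Sp_compact\<close>.\<close>

definition skew_alg :: "'m::finite cmat set" where
  "skew_alg = {A \<in> sp_alg. \<forall>x y. A $ x $ y = - cnj (A $ y $ x)}"

text \<open>\<open>sp(2m, C)\<close> is the complexification of \<open>sp(m)\<close>:
  \<open>A\<close> and \<open>imult B\<close> are half the difference and half the sum of
  \<open>X\<close> and its adjoint, and the adjoint again satisfies the symplectic relation.\<close>

lemma sp_alg_decompose:
  assumes "X \<in> sp_alg"
  shows "\<exists>A\<in>skew_alg. \<exists>B\<in>skew_alg. X = A + imult B"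
proof -
  let ?A = "\<chi> x y. (X $ x $ y - cnj (X $ y $ x)) / 2"
  let ?B = "\<chi> x y. - \<i> * (X $ x $ y + cnj (X $ y $ x)) / 2"
  have X: "X $ x $ y = - (sg x * sg y * X $ star y $ star x)" for x y using assms unfolding sp_alg_def by blast
  have X2: "cnj (X $ y $ x) = - (sg x * sg y * cnj (X $ star x $ star y))" for x y
    by (subst X) (simp add: mult.commute)
  have alg: "(p - r) / 2 = - (s * ((q - u) / 2))" "- \<i> * (p + r) / 2 = - (s * (- \<i> * (q + u) / 2))"
    if "p = - (s * q)" "r = - (s * u)" for p q r s u :: complex
    using that by (simp_all add: field_simps)
  have "?A \<in> sp_alg" "?B \<in> sp_alg"
    unfolding sp_alg_def mem_Collect_eq vec_lambda_beta using alg[OF X X2] by blast+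
  then have "?A \<in> skew_alg" "?B \<in> skew_alg" by (auto simp: skew_alg_def field_simps)
  moreover have "X = ?A + imult ?B"
    by (simp add: vec_eq_iff imult_def map_matrix_def field_simps)
  ultimately show ?thesis by blast
qed

lemma sum_star: "(\<Sum>x\<in>UNIV. f (star x)) = (\<Sum>x\<in>UNIV. f x)" for f :: "'m::finite + 'm \<Rightarrow> 'a::comm_monoid_add"
  by (rule sum.reindex_bij_witness[of _ star star]) auto

lemma jj_add: "jj (u + v) = jj u + jj v" and jj_scaleR: "jj (r *\<^sub>R v) = r *\<^sub>R jj v" and jj_diff: "jj (u - v) = jj u - jj v"
  by (auto simp: vec_eq_iff jj_nth' algebra_simps)

lemma jj_jj: "jj (jj v) = - v"
  by (simp add: vec_eq_iff jj_nth')

lemma jj_commutes_skew: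
  assumes A: "A \<in> skew_alg"
  shows "jj (A *v v) = A *v jj v"
  unfolding vec_eq_iff
proof
  fix x
  have a: "A $ x $ y = - (sg x * sg y * A $ star y $ star x)" "A $ star y $ star x = - cnj (A $ star x $ star y)" for x y
    using A unfolding skew_alg_def sp_alg_def by blast+
  have "(A *v jj v) $ x = (\<Sum>y\<in>UNIV. A $ x $ y * (sg y * cnj (v $ star y)))"
    by (simp add: matrix_vector_mult_def jj_nth')
  also have "\<dots> = (\<Sum>y\<in>UNIV. sg x * cnj (A $ star x $ star y) * cnj (v $ star y))"
  proof (rule sum.cong[OF refl])
    fix y
    have "A $ x $ y = sg x * sg y * cnj (A $ star x $ star y)" using a(1)[of x y] a(2)[of y x] by simp
    then show "A $ x $ y * (sg y * cnj (v $ star y)) = sg x * cnj (A $ star x $ star y) * cnj (v $ star y)"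
      by (simp add: mult_ac)
  qed
  also have "\<dots> = (\<Sum>y\<in>UNIV. sg x * cnj (A $ star x $ y) * cnj (v $ y))"
    by (rule sum_star)
  also have "\<dots> = jj (A *v v) $ x"
    by (simp add: jj_nth' matrix_vector_mult_def sum_distrib_left mult_ac)
  finally show "jj (A *v v) $ x = (A *v jj v) $ x" by simp
qed

text \<open>The matrix of the symplectic form intertwines \<open>1 + t A\<close> with the transpose
  of \<open>1 - t A\<close>. This gives the Cayley transform determinant 1.\<close>

lemma det_cayley:
  assumes A: "A \<in> skew_alg"
  shows "det (mat 1 + t *\<^sub>R A) = det (mat 1 - t *\<^sub>R A)"
proof -
  let ?J = "(\<chi> x y. if y = star x then sg x else 0) :: 'a cmat"
  have a: "A $ x $ y = - (sg x * sg y * A $ star y $ star x)" for x y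
    using A unfolding skew_alg_def sp_alg_def by blast
  have "?J ** ?J = - mat 1"
    by (auto simp: vec_eq_iff matrix_matrix_mult_def mat_def if_distrib[of "\<lambda>x. x * _"] cong: if_cong)
  then have "invertible ?J"
    unfolding invertible_def by (intro exI[of _ "- ?J"]) (simp only: matmul_simps minus_minus simp_thms)
  then have J: "det ?J \<noteq> 0" unfolding invertible_det_nz .
  have JQ: "(?J ** Q) $ x $ y = sg x * Q $ star x $ y" for Q x y
    by (simp add: matrix_matrix_mult_def if_distrib[of "\<lambda>x. x * _"] cong: if_cong)
  have PJ: "(P ** ?J) $ x $ y = P $ x $ star y * sg (star y)" for P :: "'a cmat" and x y
  proof -
    have "(P ** ?J) $ x $ y = (\<Sum>k\<in>UNIV. if k = star y then P $ x $ star y * sg (star y) else 0)"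
      unfolding matrix_matrix_mult_def vec_lambda_beta by (intro sum.cong) auto
    then show ?thesis by simp
  qed
  have "(mat 1 + t *\<^sub>R A) ** ?J = ?J ** transpose (mat 1 - t *\<^sub>R A)"
    unfolding vec_eq_iff
  proof (intro allI)
    fix x y
    have "A $ x $ star y * sg (star y) = - (sg x * A $ y $ star x)"
      by (subst a) (simp add: mult_ac)
    then have "(t *\<^sub>R A) $ x $ star y * sg (star y) = - (sg x * (t *\<^sub>R A) $ y $ star x)"
      by (simp add: mult_ac)
    moreover have "mat 1 $ x $ star y * sg (star y) = sg x * (mat 1 :: 'a cmat) $ y $ star x"
      by (auto simp: mat_def)
    ultimately show "((mat 1 + t *\<^sub>R A) ** ?J) $ x $ y = (?J ** transpose (mat 1 - t *\<^sub>R A)) $ x $ y"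
      unfolding PJ JQ by (auto simp: transpose_def algebra_simps)
  qed
  then have "det ((mat 1 + t *\<^sub>R A) ** ?J) = det (?J ** transpose (mat 1 - t *\<^sub>R A))" by simp
  then have "det (mat 1 + t *\<^sub>R A) * det ?J = det ?J * det (mat 1 - t *\<^sub>R A)"
    by (simp only: det_mul det_transpose)
  then show ?thesis using J by simp
qed

lemma inner_cnj: "z \<bullet> w = Re (z * cnj w)"
  by (simp add: inner_complex_def)

lemma Re_skew_inner:
  assumes A: "A \<in> skew_alg"
  shows "(A *v v) \<bullet> v = 0"
proof -
  have a: "A $ x $ y = - cnj (A $ y $ x)" for x y using A unfolding skew_alg_def by blast
  define S where "S = (\<Sum>x\<in>UNIV. \<Sum>y\<in>UNIV. A $ x $ y * v $ y * cnj (v $ x))"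
  have "cnj S = (\<Sum>x\<in>UNIV. \<Sum>y\<in>UNIV. cnj (A $ x $ y) * cnj (v $ y) * v $ x)" by (simp add: S_def)
  also have "\<dots> = (\<Sum>y\<in>UNIV. \<Sum>x\<in>UNIV. cnj (A $ x $ y) * cnj (v $ y) * v $ x)" by (rule sum.swap)
  also have "\<dots> = (\<Sum>y\<in>UNIV. \<Sum>x\<in>UNIV. - (A $ y $ x * v $ x * cnj (v $ y)))"
  proof (intro sum.cong refl)
    fix x y show "cnj (A $ x $ y) * cnj (v $ y) * v $ x = - (A $ y $ x * v $ x * cnj (v $ y))"
      by (subst a[of y x]) simp
  qed
  also have "\<dots> = - S" by (simp add: S_def sum_negf)
  finally have "Re S = 0" by (metis cnj.simps(1) uminus_complex.simps(1) equal_neg_zero)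
  moreover have "(A *v v) \<bullet> v = Re S"
    unfolding inner_vec_def matrix_vector_mult_def S_def
    by (simp only: vec_lambda_beta inner_cnj sum_distrib_right Re_sum)
  ultimately show ?thesis by simp
qed

text \<open>\<open>A v\<close> is orthogonal to \<open>v\<close> in the real inner product, so
  subtracting a multiple of it cannot shorten \<open>v\<close>. The resulting bound on the inverse
  is uniform in \<open>t\<close>, as the remainder estimate in \<open>cayley_derivative\<close>
  requires.\<close>

lemma skew_resolvent:
  assumes A: "A \<in> skew_alg"
  shows "invertible (mat 1 - t *\<^sub>R A)" "norm v \<le> norm ((mat 1 - t *\<^sub>R A) *v v)"
proof -
  have e: "(mat 1 - t *\<^sub>R A) *v v = v - t *\<^sub>R (A *v v)" for v
    by (simp add: matrix_vector_mult_diff_rdistrib bounded_bilinear.scaleR_left[OF bounded_bilinear_matrix_vector_mult])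
  show n: "norm v \<le> norm ((mat 1 - t *\<^sub>R A) *v v)" for v
  proof (rule norm_le[THEN iffD2])
    have "(v - t *\<^sub>R (A *v v)) \<bullet> (v - t *\<^sub>R (A *v v)) = v \<bullet> v + t * t * ((A *v v) \<bullet> (A *v v))"
      using Re_skew_inner[OF A, of v] by (simp add: inner_diff_left inner_diff_right inner_commute)
    then show "v \<bullet> v \<le> ((mat 1 - t *\<^sub>R A) *v v) \<bullet> ((mat 1 - t *\<^sub>R A) *v v)" by (simp add: e)
  qed
  show "invertible (mat 1 - t *\<^sub>R A)" proof (rule invertible_of_ker)
    fix v assume "(mat 1 - t *\<^sub>R A) *v v = 0"
    then show "v = 0" using n[of v] by simp
  qed
qed

text \<open>The Cayley transform of \<open>t A\<close>, a curve in \<open>Sp(m)\<close> through the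
  identity with velocity \<open>2 A\<close>. It takes the place of the exponential curve: membership
  in the group and the derivative come from algebraic identities for the resolvent.\<close>

definition cayley :: "'m::finite cmat \<Rightarrow> real \<Rightarrow> 'm cmat" where
  "cayley A t = (mat 1 + t *\<^sub>R A) ** (SOME R. R ** (mat 1 - t *\<^sub>R A) = mat 1 \<and> (mat 1 - t *\<^sub>R A) ** R = mat 1)"

lemma cayleyE:
  assumes A: "A \<in> skew_alg"
  obtains R where "R ** (mat 1 - t *\<^sub>R A) = mat 1" "(mat 1 - t *\<^sub>R A) ** R = mat 1"
    "cayley A t = (mat 1 + t *\<^sub>R A) ** R"
proof -
  have "\<exists>R. R ** (mat 1 - t *\<^sub>R A) = mat 1 \<and> (mat 1 - t *\<^sub>R A) ** R = mat 1"
    using skew_resolvent(1)[OF A, of t] unfolding invertible_def by blast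
  from someI_ex[OF this] show thesis using that unfolding cayley_def by blast
qed

lemma adjoint_mult: "map_matrix cnj (transpose (A ** B)) = map_matrix cnj (transpose B) ** map_matrix cnj (transpose A)"
  for A B :: "complex^'n^'n"
  by (simp add: vec_eq_iff map_matrix_def transpose_def matrix_matrix_mult_def mult.commute)

lemma cayley_in_Sp:
  assumes A: "A \<in> skew_alg"
  shows "cayley A t \<in> Sp_compact"
proof -
  obtain R where R: "R ** (mat 1 - t *\<^sub>R A) = mat 1" "(mat 1 - t *\<^sub>R A) ** R = mat 1"
    "cayley A t = (mat 1 + t *\<^sub>R A) ** R" by (rule cayleyE[OF A])
  let ?P = "mat 1 + t *\<^sub>R A" and ?M = "mat 1 - t *\<^sub>R A"
  let ?adj = "\<lambda>X :: 'a cmat. map_matrix cnj (transpose X)"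
  have a: "A $ x $ y = - cnj (A $ y $ x)" for x y using A unfolding skew_alg_def by blast
  have "det ?M * det R = 1" using R(2) by (metis det_I det_mul)
  then have det: "det (cayley A t) = 1" unfolding R(3) det_mul det_cayley[OF A] .
  have comm: "?M ** ?P = ?P ** ?M" by (simp add: matmul_simps algebra_simps)
  have a': "cnj (A $ y $ x) = - A $ x $ y" for x y by (subst (2) a) simp
  have aP: "?adj ?P = ?M" and aM: "?adj ?M = ?P" and a1: "?adj (mat 1) = mat 1"
    using a' by (auto simp: vec_eq_iff map_matrix_def transpose_def mat_def)
  have aR: "?adj R ** ?P = mat 1" using R(2) a1 aM by (metis adjoint_mult)
  have "?adj (cayley A t) ** cayley A t = ?adj R ** (?M ** ?P) ** R"
    unfolding R(3) adjoint_mult aP by (simp only: matrix_mul_assoc)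
  also have "\<dots> = (?adj R ** ?P) ** (?M ** R)" unfolding comm by (simp only: matrix_mul_assoc)
  also have "\<dots> = mat 1" using aR R(2) by simp
  finally have unitary: "?adj (cayley A t) ** cayley A t = mat 1" .
  have jP: "jj (?P *v v) = ?P *v jj v" and jM: "jj (?M *v v) = ?M *v jj v" for v
    using jj_commutes_skew[OF A] by (simp_all add: matrix_vector_mult_add_rdistrib matrix_vector_mult_diff_rdistrib
      bounded_bilinear.scaleR_left[OF bounded_bilinear_matrix_vector_mult] jj_add jj_diff jj_scaleR)
  have jR: "jj (R *v v) = R *v jj v" for v
  proof -
    have "?M *v jj (R *v v) = jj v" using jM[of "R *v v"] R(2) by (simp add: matrix_vector_mul_assoc)
    then have "R *v (?M *v jj (R *v v)) = R *v jj v" by simp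
    then show ?thesis using R(1) by (simp add: matrix_vector_mul_assoc)
  qed
  have "jj (cayley A t *v v) = cayley A t *v jj v" for v
    using jP jR by (simp add: R(3) matrix_vector_mul_assoc[symmetric])
  then show ?thesis using det unitary by (simp add: Sp_compact_def SU_def SL_quat_def SL_def)
qed

lemma cayley_0: "A \<in> skew_alg \<Longrightarrow> cayley A 0 = mat 1"
  by (rule cayleyE[of A 0]) auto

lemma cayley_derivative:
  assumes A: "A \<in> skew_alg"
  shows "(cayley A has_vector_derivative 2 *\<^sub>R A) (at 0)"
proof -
  define R where "R t = (SOME R. R ** (mat 1 - t *\<^sub>R A) = mat 1 \<and> (mat 1 - t *\<^sub>R A) ** R = mat 1)" for t
  have R: "R t ** (mat 1 - t *\<^sub>R A) = mat 1" "(mat 1 - t *\<^sub>R A) ** R t = mat 1" for t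
  proof -
    have "\<exists>R. R ** (mat 1 - t *\<^sub>R A) = mat 1 \<and> (mat 1 - t *\<^sub>R A) ** R = mat 1"
      using skew_resolvent(1)[OF A, of t] unfolding invertible_def by blast
    from someI_ex[OF this] show "R t ** (mat 1 - t *\<^sub>R A) = mat 1" "(mat 1 - t *\<^sub>R A) ** R t = mat 1"
      unfolding R_def by blast+
  qed
  have cay: "cayley A t = (mat 1 + t *\<^sub>R A) ** R t" for t by (simp add: cayley_def R_def)
  have Rb: "norm (R t *v v) \<le> norm v" for t v
    using skew_resolvent(2)[OF A, of "R t *v v" t] R(2)[of t] by (simp add: matrix_vector_mul_assoc)
  have comp: "norm (R t $ x $ y) \<le> 1" for t x y
  proof -
    have "norm (R t $ x $ y) = norm ((R t *v axis y 1) $ x)" by (simp add: matrix_axis)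
    also have "\<dots> \<le> norm (R t *v axis y 1)" by (rule Finite_Cartesian_Product.norm_nth_le)
    also have "\<dots> \<le> 1" using Rb[of t "axis y 1"] by simp
    finally show ?thesis .
  qed
  \<comment> \<open>The number of matrix entries, each of modulus at most 1 by
    \<open>comp\<close>.\<close>
  define K where "K = (\<Sum>x\<in>(UNIV::('a+'a) set). \<Sum>y\<in>(UNIV::('a+'a) set). (1::real))"
  have Rn: "norm (R t) \<le> K" for t
  proof -
    have "norm (R t) \<le> (\<Sum>x\<in>UNIV. norm (R t $ x))" by (simp add: norm_vec_def L2_set_le_sum)
    also have "\<dots> \<le> (\<Sum>x\<in>UNIV. \<Sum>y\<in>UNIV. norm (R t $ x $ y))" by (intro sum_mono) (simp add: norm_vec_def L2_set_le_sum)
    also have "\<dots> \<le> K" unfolding K_def by (intro sum_mono comp)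
    finally show ?thesis .
  qed
  obtain C where C: "\<And>X Y. norm ((X :: 'a cmat) ** (Y :: 'a cmat)) \<le> norm X * norm Y * C" "C > 0"
    using bounded_bilinear.pos_bounded[OF bounded_bilinear_matrix_mult] by blast
  \<comment> \<open>The resolvent identity \<open>R = 1 + t A R\<close> is used twice: first the
    curve becomes \<open>1 + 2 t A R\<close>, then \<open>A R = A + t A A R\<close> splits off the
    linear term.\<close>
  have expand: "cayley A t - cayley A 0 - t *\<^sub>R (2 *\<^sub>R A) = (2 * t * t) *\<^sub>R (A ** (A ** R t))" for t
  proof -
    have r: "R t = mat 1 + t *\<^sub>R (A ** R t)" using R(2)[of t] by (simp add: matmul_simps algebra_simps)
    have "cayley A t = R t + t *\<^sub>R (A ** R t)" by (simp add: cay matmul_simps)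
    also have "\<dots> = mat 1 + (2 * t) *\<^sub>R (A ** R t)" by (subst (1) r) (simp add: algebra_simps scaleR_2[symmetric])
    finally have c1: "cayley A t = mat 1 + (2 * t) *\<^sub>R (A ** R t)" .
    have "A ** R t = A + t *\<^sub>R (A ** (A ** R t))" 
      using arg_cong[OF r, of "\<lambda>X. A ** X"] by (simp add: matmul_simps)
    then show ?thesis unfolding cayley_0[OF A] c1 by (metis (no_types, lifting) add_diff_cancel_left' mult.commute scaleR_add_right scaleR_scaleR mult.assoc)
  qed
  show ?thesis
    unfolding has_vector_derivative_def has_derivative_at_within
  proof (intro conjI)
    show "bounded_linear (\<lambda>t :: real. t *\<^sub>R 2 *\<^sub>R A)" by (rule bounded_linear_scaleR_left)
    have "((\<lambda>t. (2 * \<bar>t\<bar>) * (norm A * (norm A * K * C) * C)) \<longlongrightarrow> (2 * \<bar>0\<bar>) * (norm A * (norm A * K * C) * C)) (at 0)"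
      by (intro tendsto_intros)
    then have lim: "((\<lambda>t. (2 * \<bar>t\<bar>) * (norm A * (norm A * K * C) * C)) \<longlongrightarrow> 0) (at 0)" by simp
    show "((\<lambda>t. (cayley A t - cayley A 0 - (t - 0) *\<^sub>R 2 *\<^sub>R A) /\<^sub>R norm (t - 0)) \<longlongrightarrow> 0) (at 0)"
    proof (rule Lim_null_comparison[OF _ lim])
      have "norm ((cayley A t - cayley A 0 - (t - 0) *\<^sub>R 2 *\<^sub>R A) /\<^sub>R norm (t - 0)) \<le> (2 * \<bar>t\<bar>) * (norm A * (norm A * K * C) * C)" for t
      proof -
        have "norm (A ** (A ** R t)) \<le> norm A * norm (A ** R t) * C" by (rule C)
        also have "\<dots> \<le> norm A * (norm A * norm (R t) * C) * C"
          using C by (intro mult_right_mono mult_left_mono) auto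
        also have "\<dots> \<le> norm A * (norm A * K * C) * C"
          using C(2) Rn by (intro mult_right_mono mult_left_mono) auto
        finally have "norm (A ** (A ** R t)) \<le> norm A * (norm A * K * C) * C" .
        then have "(2 * \<bar>t\<bar>) * norm (A ** (A ** R t)) \<le> (2 * \<bar>t\<bar>) * (norm A * (norm A * K * C) * C)"
          by (intro mult_left_mono) auto
        moreover have "norm ((cayley A t - cayley A 0 - (t - 0) *\<^sub>R 2 *\<^sub>R A) /\<^sub>R norm (t - 0)) = (2 * \<bar>t\<bar>) * norm (A ** (A ** R t))"
        proof -
          have "norm ((2 * t * t) *\<^sub>R (A ** (A ** R t)) /\<^sub>R norm t) = inverse \<bar>t\<bar> * (2 * \<bar>t\<bar> * \<bar>t\<bar> * norm (A ** (A ** R t)))"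
            by (simp only: norm_scaleR abs_inverse abs_mult real_norm_def abs_abs abs_numeral)
          also have "\<dots> = (2 * \<bar>t\<bar>) * norm (A ** (A ** R t))" by (cases "t = 0") (simp_all add: field_simps)
          finally show ?thesis unfolding diff_0_right expand .
        qed
        ultimately show ?thesis by simp
      qed
      then show "eventually (\<lambda>t. norm ((cayley A t - cayley A 0 - (t - 0) *\<^sub>R 2 *\<^sub>R A) /\<^sub>R norm (t - 0)) \<le> (2 * \<bar>t\<bar>) * (norm A * (norm A * K * C) * C)) (at 0)"
        by simp
    qed
  qed
qed

lemma Sp_compact_mult:
  assumes "g \<in> Sp_compact" "h \<in> Sp_compact" shows "g ** h \<in> (Sp_compact :: 'm::finite cmat set)"
proof -
  let ?adj = "\<lambda>X :: 'm cmat. map_matrix cnj (transpose X)"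
  have "?adj (g ** h) ** (g ** h) = ?adj h ** (?adj g ** g) ** h"
    unfolding adjoint_mult by (simp only: matrix_mul_assoc)
  then have "?adj (g ** h) ** (g ** h) = mat 1"
    using assms by (simp add: Sp_compact_def SU_def)
  then show ?thesis using assms
    by (simp add: Sp_compact_def SU_def SL_quat_def SL_def det_mul matrix_vector_mul_assoc[symmetric])
qed

lemma continuous_matrix_mult:
  fixes f g :: "'a::topological_space \<Rightarrow> complex^'n^'n"
  shows "continuous_on S f \<Longrightarrow> continuous_on S g \<Longrightarrow> continuous_on S (\<lambda>x. f x ** g x)"
  by (rule bounded_bilinear.continuous_on[OF bounded_bilinear_matrix_mult])

text \<open>An LU decomposition when \<open>\<pi>\<close> is the projection to the strictly lower block triangular part.\<close>

lemma lu_decomposition: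
  fixes \<pi> :: "complex^'n^'n \<Rightarrow> complex^'n^'n"
  assumes lin: "linear \<pi>"
  obtains \<psi> V where "open V" "mat 1 \<in> V" "\<psi> (mat 1) = 0" "(\<psi> has_derivative id) (at (mat 1))"
    "\<And>M. M \<in> V \<Longrightarrow> M = (mat 1 + \<pi> (\<psi> M)) ** (mat 1 + (\<psi> M - \<pi> (\<psi> M)))"
proof -
  have bl: "bounded_linear \<pi>" using lin by (simp add: linear_conv_bounded_linear)
  define f where "f Y = (mat 1 + \<pi> Y) ** (mat 1 + (Y - \<pi> Y))" for Y
  define D where "D Y H = (mat 1 + \<pi> Y) ** (H - \<pi> H) + \<pi> H ** (mat 1 + (Y - \<pi> Y))" for Y H
  have derf: "(f has_derivative D Y) (at Y)" for Y
  proof -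
    have p: "(\<pi> has_derivative \<pi>) (at Y)" by (rule bounded_linear_imp_has_derivative[OF bl])
    have "((\<lambda>Y. (mat 1 + \<pi> Y) ** (mat 1 + (Y - \<pi> Y))) has_derivative
        (\<lambda>H. (mat 1 + \<pi> Y) ** (0 + (H - \<pi> H)) + (0 + \<pi> H) ** (mat 1 + (Y - \<pi> Y)))) (at Y)"
      by (intro bounded_bilinear.FDERIV[OF bounded_bilinear_matrix_mult] derivative_intros p)
    then show ?thesis unfolding f_def D_def by simp
  qed
  have blD: "bounded_linear (D Y)" for Y using derf by (rule has_derivative_bounded_linear)
  define f' where "f' Y = Blinfun (D Y)" for Y
  have f': "blinfun_apply (f' Y) = D Y" for Y unfolding f'_def by (rule bounded_linear_Blinfun_apply[OF blD])
  have cont: "continuous_on UNIV f'"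
  proof (rule continuous_on_blinfun_componentwise)
    fix i :: "complex^'n^'n"
    have "continuous_on UNIV \<pi>" using bl by (rule linear_continuous_on)
    then show "continuous_on UNIV (\<lambda>Y. blinfun_apply (f' Y) i)"
      unfolding f' D_def by (intro continuous_intros continuous_matrix_mult) auto
  qed
  have p0: "\<pi> 0 = 0" using lin by (rule linear_0)
  \<comment> \<open>At 0 the derivative sends \<open>H\<close> to the sum of
    \<open>H - \<pi> H\<close> and \<open>\<pi> H\<close>, so the inverse function theorem applies
    with the identity as derivative.\<close>
  have D0: "D 0 = id" by (auto simp: D_def p0 fun_eq_iff)
  have f0: "f 0 = mat 1" by (simp add: f_def p0)
  have inv0: "id_blinfun o\<^sub>L f' 0 = id_blinfun" by (rule blinfun_eqI) (simp add: f' D0)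
  obtain U' V g g' where U: "open U'" "0 \<in> U'" "open V" "f 0 \<in> V" "homeomorphism U' V f g"
    and g: "\<And>y. y \<in> V \<Longrightarrow> (g has_derivative (g' y)) (at y)"
      "\<And>y. y \<in> V \<Longrightarrow> g' y = inv (blinfun_apply (f' (g y)))"
  proof (rule inverse_function_theorem[OF open_UNIV _ cont UNIV_I inv0])
    show "(f has_derivative blinfun_apply (f' x)) (at x)" for x unfolding f' by (rule derf)
  qed (rule that)
  have g1: "g (mat 1) = 0" using U by (metis f0 homeomorphism_apply1)
  show thesis
  proof (rule that)
    show "open V" "mat 1 \<in> V" using U f0 by auto
    show "g (mat 1) = 0" by (rule g1)
    have "g' (mat 1) = id" using g(2)[of "mat 1"] U f0 g1 by (simp add: f' D0)
    then show "(g has_derivative id) (at (mat 1))" using g(1)[of "mat 1"] U f0 by simp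
    show "M = (mat 1 + \<pi> (g M)) ** (mat 1 + (g M - \<pi> (g M)))" if "M \<in> V" for M
      using that U(5) unfolding f_def[symmetric] by (simp add: homeomorphism_apply2)
  qed
qed

lemma imult_mult: "A ** imult X = imult (A ** X)" "imult X ** A = imult (X ** A)"
  by (simp_all add: imult_def map_matrix_def vec_eq_iff matrix_matrix_mult_def sum_distrib_left mult_ac)

text \<open>A derivative within a subset of a proper subspace is not unique off that subspace, so
  \<open>A\<close> and \<open>A'\<close> are composed only along the lines \<open>X + t v\<close>
  with \<open>v\<close> in \<open>V\<close>, where \<open>h'\<close> after \<open>h\<close> gives
  back the line.\<close>

lemma straightening_derivative_inj:
  fixes h :: "'a::euclidean_space \<Rightarrow> 'a"
  assumes V: "subspace V" and W: "openin (top_of_set V) W" and hom: "homeomorphism W W' h h'"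
    and X: "X \<in> W" and h: "(h has_derivative A) (at X within W)"
    and h': "(h' has_derivative A') (at (h X) within W')" and v: "v \<in> V"
  shows "A' (A v) = v"
proof -
  let ?\<gamma> = "\<lambda>t. X + t *\<^sub>R v"
  have der: "(?\<gamma> has_vector_derivative v) (at 0)"
    by (auto intro!: derivative_eq_intros simp: has_vector_derivative_def)
  have XV: "X \<in> V" using W X openin_imp_subset by blast
  have "?\<gamma> t \<in> V" for t using V XV v by (intro subspace_add subspace_scale)
  moreover obtain U where U: "open U" "W = V \<inter> U" using W by (auto simp: openin_open)
  moreover have "eventually (\<lambda>t. ?\<gamma> t \<in> U) (at 0)"
  proof (rule topological_tendstoD)
    show "(?\<gamma> \<longlongrightarrow> X) (at 0)" by (rule tendsto_eq_intros refl | simp)+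
  qed (use U X in auto)
  ultimately have ev: "eventually (\<lambda>t. ?\<gamma> t \<in> W) (at 0)" by simp
  have d1: "((\<lambda>t. h (?\<gamma> t)) has_vector_derivative A v) (at 0)"
    by (rule curve_compose[OF der ev]) (use X h in auto)
  have ev': "eventually (\<lambda>t. h (?\<gamma> t) \<in> W') (at 0)"
    using ev by eventually_elim (use hom in \<open>auto simp: homeomorphism_def\<close>)
  have "((\<lambda>t. h' (h (?\<gamma> t))) has_vector_derivative A' (A v)) (at 0)"
    by (rule curve_compose[OF d1 ev']) (use X h' hom in \<open>auto simp: homeomorphism_def\<close>)
  moreover have "((\<lambda>t. h' (h (?\<gamma> t))) has_vector_derivative v) (at 0)"
  proof -
    have "eventually (\<lambda>t. ?\<gamma> t = h' (h (?\<gamma> t))) (at 0)"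
      using ev by eventually_elim (simp add: homeomorphism_apply1[OF hom])
    moreover have "?\<gamma> 0 = h' (h (?\<gamma> 0))" using X by (simp add: homeomorphism_apply1[OF hom])
    ultimately show ?thesis unfolding has_vector_derivative_def
      by (rule has_derivative_transform_eventually[OF der[unfolded has_vector_derivative_def] _ _ UNIV_I])
  qed
  ultimately show ?thesis by (rule vector_derivative_unique_at)
qed

context iwasawa_setup begin

definition lower_part :: "'m cmat \<Rightarrow> 'm cmat" where
  "lower_part X = (\<chi> x y. if blk id x > blk id y then X $ x $ y else 0)"

lemma linear_lower_part: "linear lower_part"
  by (auto intro!: linearI simp: lower_part_def vec_eq_iff)

lemma lower_part_in: "lower_part X \<in> strictly_lower"
  by (simp add: lower_part_def strictly_lower_def coord_matrices_def)

lemma upper_part_in: "X - lower_part X \<in> stab Fstd"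
  by (simp add: lower_part_def stab_Fstd coord_matrices_def)

lemma lower_part_imult: "lower_part (imult X) = imult (lower_part X)"
  by (simp add: lower_part_def imult_def map_matrix_def vec_eq_iff)

lemma lower_part_eq_0_iff: "lower_part X = 0 \<longleftrightarrow> X \<in> stab Fstd"
  by (auto simp: lower_part_def stab_Fstd coord_matrices_def vec_eq_iff not_le)

lemma mat1_stab: "mat 1 \<in> stab F"
  by (simp add: stab_def)

text \<open>The Cayley curves only give tangent vectors in \<open>skew_alg\<close>; the tangent space being complex, it
  contains those of \<open>sp_alg = skew_alg + i skew_alg\<close> too.\<close>

lemma compact_orbit_tangent:
  fixes F :: "'m flag"
  assumes F0: "F0 \<in> flag_manifold c" and C: "C = orbit Sp_compact F0"
    and M: "complex_submanifold c d C" and F: "F \<in> C"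
  shows "dim (sp_alg :: 'm cmat set) \<le> dim (sp_alg \<inter> stab F) + 2 * d"
proof -
  obtain k0 where k0: "k0 \<in> Sp_compact" "F = act k0 F0" using F C by (auto simp: orbit_def)
  have orb: "act k F \<in> C" if "k \<in> Sp_compact" for k
    using Sp_compact_mult[OF that k0(1)] by (auto simp: C k0(2) act_act orbit_def)
  obtain b W W' h h' L where b: "ordered_basis (b :: nat \<Rightarrow> 'm cvec)"
    and W: "openin (top_of_set (chart_space c b)) W"
    and FW: "F \<in> chart c b ` W" and hom: "homeomorphism W W' h h'" and holo: "holo_on h W" "holo_on h' W'"
    and L: "complex_subspace L" "L \<subseteq> chart_space c b" "dim L = 2 * d"
    and hW: "h ` {X \<in> W. chart c b X \<in> C} = W' \<inter> L"
    using bspec[OF conjunct2[OF M[unfolded complex_submanifold_def]] F] by (elim exE conjE) (rule that)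
  obtain g gi where g: "g ** gi = mat 1" "gi ** g = mat 1"
    and cs: "chart_space c b = (\<lambda>X. g ** X ** gi) ` strictly_lower"
    and chart: "\<And>X. chart c b (g ** X ** gi) = act (g ** (mat 1 + X)) Fstd"
    by (rule ordered_basisE[OF b]) (rule that)
  obtain X0 where X0: "X0 \<in> W" "F = chart c b X0" using FW by blast
  have Wsub: "W \<subseteq> chart_space c b" using W by (rule openin_imp_subset)
  then obtain Y0 where Y0: "Y0 \<in> strictly_lower" "X0 = g ** Y0 ** gi" using X0 cs by auto
  obtain q where q: "(mat 1 + Y0) ** q = mat 1" "q ** (mat 1 + Y0) = mat 1"
    using strictly_lower_invertible[OF Y0(1)] by (rule matrix_invE)
  \<comment> \<open>\<open>G\<close> carries the standard flag to \<open>F\<close>; conjugated by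
    it, a curve through the identity can be factored near the identity, where the LU decomposition
    is available.\<close>
  define G where "G = g ** (mat 1 + Y0)"
  define Gi where "Gi = q ** gi"
  have G: "G ** Gi = mat 1" "Gi ** G = mat 1"
  proof -
    have "G ** Gi = g ** ((mat 1 + Y0) ** q) ** gi" by (simp only: G_def Gi_def matrix_mul_assoc)
    then show "G ** Gi = mat 1" by (simp only: q g matrix_mul_rid)
    have "Gi ** G = q ** (gi ** g) ** (mat 1 + Y0)" by (simp only: G_def Gi_def matrix_mul_assoc)
    then show "Gi ** G = mat 1" by (simp only: q g matrix_mul_rid)
  qed
  have FG: "F = act G Fstd" unfolding X0(2) Y0(2) chart G_def ..
  have stabF: "stab F = (\<lambda>X. G ** X ** Gi) ` stab Fstd" unfolding FG by (rule stab_act[OF G])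
  obtain A where A: "(h has_derivative A) (at X0 within W)" "\<And>y. A (imult y) = imult (A y)"
    using holo(1) X0(1) unfolding holo_on_def by blast
  have "h X0 \<in> W'" using hom X0 by (auto simp: homeomorphism_def)
  then obtain A' where A': "(h' has_derivative A') (at (h X0) within W')"
    using holo(2) unfolding holo_on_def by blast
  have Ainj: "A' (A v) = v" if "v \<in> chart_space c b" for v
    by (rule straightening_derivative_inj[OF subspace_chart_space W hom X0(1) A(1) A' that])
  have linA: "linear A" using A(1) by (rule has_derivative_linear)
  \<comment> \<open>First-order motion of \<open>F\<close> under \<open>1 + t B\<close>, read in the
    chart. If the conjugate by \<open>G\<close> factors as \<open>(1 + N) Q\<close> with
    \<open>Q\<close> fixing the standard flag, the new chart coordinate is
    \<open>Y0 + (1 + Y0) N\<close> up to conjugation by \<open>g\<close>, and to first order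
    \<open>N\<close> is \<open>lower_part\<close> of the conjugated matrix \<open>t B\<close>. The
    map commutes with \<open>imult\<close>, and its kernel is \<open>stab F\<close>.\<close>
  define \<tau> where "\<tau> B = g ** ((mat 1 + Y0) ** lower_part (Gi ** B ** G)) ** gi" for B
  have lin\<tau>: "linear \<tau>"
  proof -
    have "\<tau> = (\<lambda>X. G ** X ** gi) \<circ> lower_part \<circ> (\<lambda>B. Gi ** B ** G)"
      by (simp add: \<tau>_def G_def fun_eq_iff matrix_mul_assoc)
    then show ?thesis by (simp only: linear_compose linear_conj linear_lower_part)
  qed
  have \<tau>_imult: "\<tau> (imult B) = imult (\<tau> B)" for B
    by (simp add: \<tau>_def imult_mult lower_part_imult)
  have lower_mult: "(mat 1 + Y0) ** N \<in> strictly_lower" if "N \<in> strictly_lower" for N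
  proof -
    have "Y0 ** N \<in> strictly_lower" using Y0(1) that unfolding strictly_lower_def by (rule coord_matrices_mult)
    then have "N + Y0 ** N \<in> strictly_lower" using that
      unfolding strictly_lower_def by (intro subspace_add subspace_coord_matrices)
    then show ?thesis by (simp add: matmul_simps)
  qed
  have \<tau>_in: "\<tau> B \<in> chart_space c b" for B
    unfolding cs \<tau>_def using lower_mult[OF lower_part_in] by blast
  have \<tau>_0: "\<tau> B = 0 \<longleftrightarrow> B \<in> stab F" for B
  proof
    assume "\<tau> B = 0"
    then have "q ** (gi ** \<tau> B ** g) = 0" by simp
    moreover have "q ** (gi ** \<tau> B ** g) = q ** ((gi ** g) ** (mat 1 + Y0)) ** lower_part (Gi ** B ** G) ** (gi ** g)"
      by (simp only: \<tau>_def matrix_mul_assoc)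
    moreover have "\<dots> = lower_part (Gi ** B ** G)"
      by (simp only: g q matrix_mul_lid matrix_mul_rid)
    ultimately have "Gi ** B ** G \<in> stab Fstd" by (simp add: lower_part_eq_0_iff)
    moreover have "G ** (Gi ** B ** G) ** Gi = (G ** Gi) ** B ** (G ** Gi)" by (simp only: matrix_mul_assoc)
    then have "B = G ** (Gi ** B ** G) ** Gi" by (simp only: G matrix_mul_lid matrix_mul_rid)
    ultimately show "B \<in> stab F" unfolding stabF by blast
  next
    assume "B \<in> stab F"
    then obtain Z where Z: "Z \<in> stab Fstd" "B = G ** Z ** Gi" unfolding stabF by blast
    moreover have "Gi ** (G ** Z ** Gi) ** G = (Gi ** G) ** Z ** (Gi ** G)" by (simp only: matrix_mul_assoc)
    ultimately have "Gi ** B ** G = Z" by (simp only: G matrix_mul_lid matrix_mul_rid)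
    then have "lower_part (Gi ** B ** G) = 0" using Z by (simp add: lower_part_eq_0_iff)
    then show "\<tau> B = 0" by (simp add: \<tau>_def)
  qed
  have skew_tangent: "A (\<tau> B) \<in> L" if B: "B \<in> skew_alg" for B
  proof -
    obtain \<psi> V where V: "open V" "mat 1 \<in> V" "\<psi> (mat 1) = 0" "(\<psi> has_derivative id) (at (mat 1))"
      "\<And>M. M \<in> V \<Longrightarrow> M = (mat 1 + lower_part (\<psi> M)) ** (mat 1 + (\<psi> M - lower_part (\<psi> M)))"
      by (rule lu_decomposition[OF linear_lower_part]) (rule that)
    define M where "M t = Gi ** cayley B t ** G" for t
    have M0: "M 0 = mat 1" using G by (simp add: M_def cayley_0[OF B])
    have derM: "(M has_vector_derivative Gi ** (2 *\<^sub>R B) ** G) (at 0)"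
    proof -
      have bl: "bounded_linear (\<lambda>X. Gi ** X ** G)" using linear_conj by (simp add: linear_conv_bounded_linear)
      show ?thesis using bounded_linear.has_vector_derivative[OF bl cayley_derivative[OF B]]
        by (simp add: M_def[abs_def])
    qed
    have evM: "eventually (\<lambda>t. M t \<in> V) (at 0)"
    proof -
      have "(M \<longlongrightarrow> M 0) (at 0)" using has_vector_derivative_continuous[OF derM] by (simp add: continuous_within)
      then show ?thesis using V(1,2) M0 by (simp add: topological_tendstoD)
    qed
    define \<sigma> where "\<sigma> Y = g ** ((mat 1 + Y0) ** lower_part Y) ** gi" for Y
    \<comment> \<open>For \<open>t\<close> near 0 these are the chart coordinates of the moved flag
      \<open>act (cayley B t) F\<close>, as the proof of \<open>\<gamma>_chart\<close>
      verifies.\<close>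
    define \<gamma> where "\<gamma> t = X0 + \<sigma> (\<psi> (M t))" for t
    have lin\<sigma>: "linear \<sigma>"
    proof -
      have "\<sigma> = (\<lambda>X. G ** X ** gi) \<circ> lower_part"
        by (simp add: \<sigma>_def G_def fun_eq_iff matrix_mul_assoc)
      then show ?thesis by (simp only: linear_compose linear_conj linear_lower_part)
    qed
    have bl\<sigma>: "bounded_linear \<sigma>" using lin\<sigma> by (simp add: linear_conv_bounded_linear)
    have "(\<psi> has_derivative id) (at (M 0) within UNIV)" unfolding M0 by (rule V(4))
    then have "((\<lambda>t. \<psi> (M t)) has_vector_derivative id (Gi ** (2 *\<^sub>R B) ** G)) (at 0)"
      by (rule curve_compose[OF derM always_eventually[OF allI[OF UNIV_I]] UNIV_I])
    then have "((\<lambda>t. \<sigma> (\<psi> (M t))) has_vector_derivative \<sigma> (Gi ** (2 *\<^sub>R B) ** G)) (at 0)"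
      using bounded_linear.has_vector_derivative[OF bl\<sigma>] by fastforce
    then have der\<gamma>: "(\<gamma> has_vector_derivative \<tau> (2 *\<^sub>R B)) (at 0)"
      unfolding \<gamma>_def[abs_def] \<tau>_def \<sigma>_def by (auto intro!: derivative_eq_intros)
    have \<gamma>0: "\<gamma> 0 = X0" by (simp add: \<gamma>_def M0 V(3) linear_0[OF lin\<sigma>])
    have \<gamma>_in: "\<gamma> t \<in> chart_space c b" for t
    proof -
      have "\<sigma> Y \<in> chart_space c b" for Y unfolding cs \<sigma>_def using lower_mult[OF lower_part_in] by blast
      then show ?thesis unfolding \<gamma>_def using X0(1) Wsub by (intro subspace_add[OF subspace_chart_space]) auto
    qed
    have \<gamma>_chart: "chart c b (\<gamma> t) \<in> C" if Mt: "M t \<in> V" for t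
    proof -
      define N where "N = lower_part (\<psi> (M t))"
      define Q where "Q = mat 1 + (\<psi> (M t) - lower_part (\<psi> (M t)))"
      have NQ: "M t = (mat 1 + N) ** Q" unfolding N_def Q_def by (rule V(5)[OF Mt])
      have "invertible (cayley B t)" using cayley_in_Sp[OF B] by (intro SL_invertible) (auto simp: Sp_compact_def SU_def)
      then obtain ki where ki: "ki ** cayley B t = mat 1" by (auto simp: invertible_def)
      have "(Gi ** ki ** G) ** M t = Gi ** (ki ** ((G ** Gi) ** cayley B t)) ** G"
        by (simp only: M_def matrix_mul_assoc)
      then have "(Gi ** ki ** G) ** M t = mat 1" by (simp only: G ki matrix_mul_lid matrix_mul_rid)
      then have "((Gi ** ki ** G) ** (mat 1 + N)) ** Q = mat 1" unfolding NQ by (simp add: matrix_mul_assoc)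
      then have "invertible Q" using invertible_left_inverse by blast
      moreover have "Q \<in> stab Fstd" unfolding Q_def
        using mat1_stab upper_part_in by (rule subspace_add[OF subspace_stab[OF Fstd_in]])
      ultimately have QF: "act Q Fstd = Fstd" by (intro act_stab[OF Fstd_in])
      have "G ** M t = (G ** Gi) ** cayley B t ** G" by (simp only: M_def matrix_mul_assoc)
      then have "G ** M t = cayley B t ** G" by (simp only: G matrix_mul_lid)
      then have "act (cayley B t) F = act (G ** (mat 1 + N)) (act Q Fstd)"
        unfolding FG act_act NQ by (simp add: matrix_mul_assoc)
      also have "\<dots> = act (g ** (mat 1 + (Y0 + (mat 1 + Y0) ** N))) Fstd"
        unfolding QF G_def by (simp add: matmul_simps matrix_mul_assoc add.assoc)
      also have "\<dots> = chart c b (g ** (Y0 + (mat 1 + Y0) ** N) ** gi)" by (rule chart[symmetric])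
      also have "g ** (Y0 + (mat 1 + Y0) ** N) ** gi = \<gamma> t"
        by (simp add: \<gamma>_def \<sigma>_def N_def Y0(2) matmul_simps)
      finally show ?thesis using orb[OF cayley_in_Sp[OF B]] by metis
    qed
    have ev: "eventually (\<lambda>t. \<gamma> t \<in> W) (at 0)"
    proof -
      obtain U where U: "open U" "W = chart_space c b \<inter> U" using W by (auto simp: openin_open)
      have "(\<gamma> \<longlongrightarrow> X0) (at 0)" using has_vector_derivative_continuous[OF der\<gamma>] \<gamma>0 by (simp add: continuous_within)
      then have "eventually (\<lambda>t. \<gamma> t \<in> U) (at 0)" using U X0(1) by (intro topological_tendstoD) auto
      then show ?thesis using \<gamma>_in U by simp
    qed
    have inL: "h (\<gamma> t) \<in> L" if "\<gamma> t \<in> W" "M t \<in> V" for t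
      using hW \<gamma>_chart that by blast
    have "((\<lambda>t. h (\<gamma> t)) has_vector_derivative A (\<tau> (2 *\<^sub>R B))) (at 0)"
      by (rule curve_compose[OF der\<gamma> ev]) (use \<gamma>0 X0 A in auto)
    note d = this
    have e: "eventually (\<lambda>t. h (\<gamma> t) \<in> L) (at 0)" using ev evM by eventually_elim (rule inL)
    have z: "h (\<gamma> 0) \<in> L" using inL[of 0] \<gamma>0 X0 M0 V by simp
    have sL: "subspace L" using L(1) by (simp add: complex_subspace_def)
    have "A (\<tau> (2 *\<^sub>R B)) \<in> L" by (rule curve_derivative_in_subspace[OF d sL e z])
    \<comment> \<open>Undoes the velocity \<open>2 B\<close> of the Cayley curve.\<close>
    then have "(1/2) *\<^sub>R A (\<tau> (2 *\<^sub>R B)) \<in> L" using sL by (intro subspace_scale)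
    then show ?thesis by (simp add: linear_scale[OF lin\<tau>] linear_scale[OF linA])
  qed
  have sub: "(\<lambda>B. A (\<tau> B)) ` sp_alg \<subseteq> L"
  proof
    fix v assume "v \<in> (\<lambda>B. A (\<tau> B)) ` sp_alg"
    then obtain B where B: "B \<in> sp_alg" "v = A (\<tau> B)" by blast
    obtain B1 B2 where B12: "B1 \<in> skew_alg" "B2 \<in> skew_alg" "B = B1 + imult B2" using sp_alg_decompose[OF B(1)] by blast
    have "v = A (\<tau> B1) + imult (A (\<tau> B2))"
      unfolding B(2) B12(3) by (simp add: linear_add[OF lin\<tau>] linear_add[OF linA] \<tau>_imult A(2))
    then show "v \<in> L" using skew_tangent B12 L(1) unfolding complex_subspace_def by (auto intro!: subspace_add)
  qed
  have lin: "linear (\<lambda>B. A (\<tau> B))" using linear_compose[OF lin\<tau> linA] by (simp add: o_def)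
  \<comment> \<open>On the chart space, which contains all values of \<open>\<tau>\<close>, the
    derivative \<open>A\<close> has the left inverse \<open>A'\<close>.\<close>
  have "A (\<tau> B) = 0 \<longleftrightarrow> \<tau> B = 0" for B
    using Ainj[OF \<tau>_in[of B]] linear_0[OF linA] linear_0[OF has_derivative_linear[OF A']] by metis
  then have "{B \<in> sp_alg. A (\<tau> B) = 0} = sp_alg \<inter> stab F" using \<tau>_0 by blast
  then have "dim (sp_alg :: 'm cmat set) = dim (sp_alg \<inter> stab F) + dim ((\<lambda>B. A (\<tau> B)) ` sp_alg)"
    using dim_kernel_image[OF lin subspace_sp_alg] by simp
  also have "dim ((\<lambda>B. A (\<tau> B)) ` sp_alg) \<le> 2 * d" using dim_subset[OF sub] L(3) by simp
  finally show ?thesis by simp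
qed

end

subsection \<open>Generic flags\<close>

text \<open>Along an affine line of matrices invertibility can then fail only at finitely many
  parameters, once it holds at one of them.\<close>

lemma det_pencil_poly:
  fixes A B :: "complex^'n^'n"
  shows "\<exists>P. \<forall>t. det (A + mat t ** B) = poly P t"
proof -
  let ?P = "\<Sum>p | p permutes (UNIV :: 'n set). of_int (sign p) * (\<Prod>i\<in>UNIV. [:A $ i $ p i, B $ i $ p i:])"
  have "(mat t ** B) $ i $ j = t * B $ i $ j" for t i j
    by (simp add: matrix_matrix_mult_def mat_def if_distrib[of "\<lambda>x. x * _"] cong: if_cong)
  then have "det (A + mat t ** B) = poly ?P t" for t
    by (simp add: det_def poly_sum poly_prod mult.commute)
  then show ?thesis by blast
qed

text \<open>With \<open>r\<close> members, counted from 1, this says that \<open>V_i\<close> and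
  \<open>j(V_(r-i))\<close> meet in 0 whenever \<open>0 < i < r\<close>. For a symmetric dimension
  sequence their dimensions add up to \<open>n\<close>, so this is general position; matrices
  commuting with \<open>j\<close> preserve it.\<close>

definition generic :: "'m::finite flag \<Rightarrow> bool" where
  "generic F \<longleftrightarrow> (\<forall>i. 0 < i \<and> i < length F \<longrightarrow> F ! (i - 1) \<inter> jj ` (F ! (length F - i - 1)) = {0})"

lemma jj_zero [simp]: "jj 0 = 0" by (simp add: vec_eq_iff jj_nth')

lemma SL_quat_mult: "g \<in> SL_quat \<Longrightarrow> h \<in> SL_quat \<Longrightarrow> g ** h \<in> (SL_quat :: 'm::finite cmat set)"
  by (simp add: SL_quat_def SL_def det_mul matrix_vector_mul_assoc[symmetric])

lemma SL_quat_inverse: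
  assumes "g \<in> SL_quat" "g ** h = mat 1" "h ** g = mat 1" shows "h \<in> (SL_quat :: 'm::finite cmat set)"
proof -
  have "det g * det h = 1" using assms(2) by (metis det_I det_mul)
  then have "det h = 1" using assms(1) by (simp add: SL_quat_def SL_def)
  moreover have "jj (h *v v) = h *v jj v" for v
  proof -
    have "g *v jj (h *v v) = jj (g *v (h *v v))" using assms(1) by (simp add: SL_quat_def)
    then have "g *v jj (h *v v) = jj v" using assms(2) by (simp add: matrix_vector_mul_assoc)
    then have "h *v (g *v jj (h *v v)) = h *v jj v" by simp
    then show ?thesis using assms(3) by (simp add: matrix_vector_mul_assoc)
  qed
  ultimately show ?thesis by (simp add: SL_quat_def SL_def)
qed

lemma generic_act_quat:
  assumes F: "generic F" and g: "g \<in> SL_quat"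
  shows "generic (act g F)"
  unfolding generic_def
proof (intro allI impI)
  fix i assume i: "0 < i \<and> i < length (act g F)"
  let ?A = "F ! (i - 1)" and ?B = "F ! (length F - i - 1)"
  have inv: "invertible g" using g by (intro SL_invertible) (simp add: SL_quat_def)
  have "jj ` (*v) g ` ?B = (*v) g ` jj ` ?B" using g by (simp add: SL_quat_def image_image)
  then have "(*v) g ` ?A \<inter> jj ` (*v) g ` ?B = (*v) g ` (?A \<inter> jj ` ?B)"
    using image_Int[OF inj_matrix_vector_mult[OF inv]] by metis
  also have "?A \<inter> jj ` ?B = {0}" using F i by (simp add: generic_def)
  finally have zero: "(*v) g ` ?A \<inter> jj ` (*v) g ` ?B = {0}" by simp
  show "act g F ! (i - 1) \<inter> jj ` (act g F ! (length (act g F) - i - 1)) = {0}"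
  proof -
    have "i - 1 < length F" "length F - i - 1 < length F" using i by auto
    then show ?thesis using zero by (simp only: act_nth length_act)
  qed
qed

lemma sum_list_take_rev:
  fixes c :: "nat list"
  assumes "rev c = c" "i \<le> length c"
  shows "sum_list (take i c) + sum_list (take (length c - i) c) = sum_list c"
proof -
  have "sum_list (take (length c - i) c) = sum_list (rev (drop i (rev c)))"
    using assms(2) by (metis rev_drop rev_rev_ident length_rev)
  also have "\<dots> = sum_list (drop i c)" using assms(1) by (simp add: sum_list_rev)
  finally show ?thesis by (metis append_take_drop_id sum_list.append)
qed

lemma jj_add_of_real: "jj (v + of_real t *s w) = jj v + of_real t *s jj w"
  by (simp add: vec_eq_iff jj_nth' algebra_simps)

lemma jj_semilinear: "jj (a *s v) = cnj a *s jj v"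
  by (simp add: vec_eq_iff jj_nth' algebra_simps)

text \<open>\<open>j\<close> is conjugate-linear, so scalars are conjugated inside the span; the
  reverse inclusion comes from \<open>j (j v) = - v\<close>.\<close>

lemma jj_image_span: "jj ` vec.span (S) = vec.span (jj ` S)"
proof -
  have *: "jj ` vec.span S \<subseteq> vec.span (jj ` S)" for S :: "'a cvec set"
  proof
    fix x assume "x \<in> jj ` vec.span S"
    then obtain v where v: "v \<in> vec.span S" "x = jj v" by blast
    have "jj v \<in> vec.span (jj ` S)"
      using v(1)
      by (induction rule: vec.span_induct_alt) (auto simp: jj_add jj_semilinear vec.span_zero intro!: vec.span_add vec.span_scale intro: vec.span_base)
    then show "x \<in> vec.span (jj ` S)" using v by simp
  qed
  have jjS: "jj ` jj ` S = uminus ` S" for S :: "'a cvec set" by (simp add: image_image jj_jj)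
  show ?thesis
  proof
    show "jj ` vec.span S \<subseteq> vec.span (jj ` S)" by (rule *)
    show "vec.span (jj ` S) \<subseteq> jj ` vec.span S"
    proof
      fix x assume "x \<in> vec.span (jj ` S)"
      then have "jj x \<in> vec.span (uminus ` S)" using *[of "jj ` S"] unfolding jjS by blast
      moreover have "vec.span (uminus ` S) \<subseteq> vec.span S"
        by (rule vec.span_minimal) (auto intro: vec.span_neg vec.span_base)
      ultimately have "- jj x \<in> vec.span S" by (auto intro: vec.span_neg)
      moreover have "x = jj (- jj x)" using jj_jj[of x] jj_diff[of 0 "jj x"] by simp
      ultimately show "x \<in> jj ` vec.span S" by blast
    qed
  qed
qed

text \<open>If \<open>mixed p b\<close> is a basis, then the members of dimension \<open>p\<close> and \<open>n - p\<close> of the flag of \<open>b\<close>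
  are in general position.\<close>

definition mixed :: "nat \<Rightarrow> (nat \<Rightarrow> 'm::finite cvec) \<Rightarrow> nat \<Rightarrow> 'm cvec" where
  "mixed p b k = (if k \<le> p then b k else jj (b (k - p)))"

context iwasawa_setup begin

text \<open>Turns \<open>ordered_basis\<close> into the nonvanishing of a determinant, hence of a
  polynomial along a line of frames.\<close>

definition frame_matrix :: "(nat \<Rightarrow> 'm cvec) \<Rightarrow> 'm cmat" where
  "frame_matrix b = (\<chi> x y. b (rank y) $ x)"

lemma frame_matrix_axis: "i \<in> {1..n} \<Longrightarrow> frame_matrix b *v axis (idx nu i) 1 = b i"
  by (simp add: matrix_axis frame_matrix_def vec_eq_iff)

lemma frame_matrix_invertible: "invertible (frame_matrix b) \<longleftrightarrow> ordered_basis b"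
proof -
  have ax: "ordered_basis (\<lambda>i. axis (idx nu i) (1::complex))"
    using span_scaled_axes[of "{1..n}" "\<lambda>_. 1" "\<lambda>i. axis (idx nu i) 1" "idx nu"] bij_idx
    by (simp add: ordered_basis_def n[symmetric] bij_betw_def coord_space_def)
  have im: "b ` {1..2 * CARD('m)} = (*v) (frame_matrix b) ` (\<lambda>i. axis (idx nu i) 1) ` {1..2 * CARD('m)}"
    unfolding image_image using frame_matrix_axis n by (intro image_cong) auto
  have "vec.span (b ` {1..2 * CARD('m)}) = range ((*v) (frame_matrix b))"
    unfolding im vec.linear_span_image[OF matrix_vector_mul_linear_gen]
    using ax by (simp add: ordered_basis_def)
  then show ?thesis
    by (simp add: ordered_basis_def invertible_right_inverse matrix_right_invertible_surjective)
qed

lemma ordered_basis_span_Int: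
  assumes b: "ordered_basis (b :: nat \<Rightarrow> 'm cvec)" and AB: "A \<inter> B = {}" "A \<subseteq> {1..n}" "B \<subseteq> {1..n}"
  shows "vec.span (b ` A) \<inter> vec.span (b ` B) = {0}"
proof -
  obtain g where g: "invertible g" "\<forall>i\<in>{1..2 * CARD('m)}. g *v ubasis nu i = b i"
    using ordered_basis_transform[OF ordered_basis_std b] by blast
  have "vec.span (b ` A) = (*v) g ` coord_space (idx nu ` A)" if "A \<subseteq> {1..n}" for A
  proof -
    have "b ` A = (*v) g ` ubasis nu ` A" unfolding image_image using g(2) that n by (intro image_cong) auto
    then show ?thesis using span_ubasis[OF permutes_id that] vec.linear_span_image[OF matrix_vector_mul_linear_gen, of g]
      by simp
  qed
  then have "vec.span (b ` A) \<inter> vec.span (b ` B) = (*v) g ` (coord_space (idx nu ` A) \<inter> coord_space (idx nu ` B))"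
    using AB image_Int[OF inj_matrix_vector_mult[OF g(1)]] by metis
  also have "coord_space (idx nu ` A) \<inter> coord_space (idx nu ` B) = coord_space (idx nu ` (A \<inter> B))"
    unfolding coord_space_Int using bij_idx AB by (metis bij_betw_def inj_on_image_Int)
  also have "\<dots> = {0}" by (auto simp: AB(1) coord_space_def vec_eq_iff)
  finally show ?thesis by simp
qed

context
  assumes sym: "rev c = c"
begin

lemma mixed_generic:
  assumes "\<And>i. 0 < i \<Longrightarrow> i < length c \<Longrightarrow> ordered_basis (mixed (sum_list (take i c)) b)"
  shows "generic (flag_of c (b :: nat \<Rightarrow> 'm cvec))"
  unfolding generic_def
proof (intro allI impI)
  fix i assume i: "0 < i \<and> i < length (flag_of c b)"
  then have i': "0 < i" "i < length c" by auto
  define p where "p = sum_list (take i c)"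
  have p: "p + sum_list (take (length c - i) c) = n" using sum_list_take_rev[OF sym, of i] i' sum_c by (simp add: p_def)
  have 1: "flag_of c b ! (i - 1) = vec.span (mixed p b ` {1..p})"
    using i' by (simp add: flag_of_nth p_def mixed_def)
  have "jj ` b ` {1..n - p} = mixed p b ` {p<..n}"
  proof -
    have "{p<..n} = (\<lambda>k. k + p) ` {1..n - p}"
    proof (intro equalityI subsetI)
      fix x assume "x \<in> {p<..n}"
      then have "x = (x - p) + p" "x - p \<in> {1..n - p}" by auto
      then show "x \<in> (\<lambda>k. k + p) ` {1..n - p}" by blast
    qed auto
    moreover have "mixed p b (k + p) = jj (b k)" if "k \<in> {1..n - p}" for k using that by (simp add: mixed_def)
    ultimately show ?thesis by (simp only: image_image cong: image_cong)
  qed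
  moreover have "Suc (length c - i - 1) = length c - i" using i' by simp
  then have "flag_of c b ! (length c - i - 1) = vec.span (b ` {1..n - p})"
  proof -
    have "sum_list (take (length c - i) c) = n - p" using p by linarith
    then show ?thesis using i' \<open>Suc _ = _\<close> by (simp only: flag_of_nth diff_less zero_less_Suc)
  qed
  ultimately have 2: "jj ` (flag_of c b ! (length c - i - 1)) = vec.span (mixed p b ` {p<..n})"
    by (simp add: jj_image_span)
  have "vec.span (mixed p b ` {1..p}) \<inter> vec.span (mixed p b ` {p<..n}) = {0}"
    using assms[OF i'] p by (intro ordered_basis_span_Int) (auto simp: p_def)
  then show "flag_of c b ! (i - 1) \<inter> jj ` (flag_of c b ! (length (flag_of c b) - i - 1)) = {0}"
    using 1 2 by simp
qed

lemma sbasis_image: "sbasis nu id ` {1..n} = (ubasis nu ` {1..n} :: 'm cvec set)"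
proof -
  let ?s = "sbasis nu id :: nat \<Rightarrow> 'm cvec"
  \<comment> \<open>The position in \<open>e_1, j(e_1), e_2, ...\<close> of the \<open>k\<close>-th
    vector of \<open>e_1, ..., e_m, j(e_m), ..., j(e_1)\<close>.\<close>
  define \<rho> where "\<rho> k = (if k \<le> CARD('m) then 2 * k - 1 else 2 * (n + 1 - k))" for k
  have sb: "?s k = ubasis nu (\<rho> k)" if "k \<in> {1..n}" for k
  proof (cases "k \<le> CARD('m)")
    case True
    then have "odd (2 * k - 1)" "(2 * k - 1 + 1) div 2 = k" using that by auto
    then show ?thesis using True by (simp only: sbasis_def ubasis_def \<rho>_def if_True not_False_eq_True id_apply)
  next
    case False
    then show ?thesis using n by (simp add: sbasis_def ubasis_def \<rho>_def)
  qed
  show "?s ` {1..n} = ubasis nu ` {1..n}"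
  proof (intro equalityI subsetI)
    fix v assume "v \<in> ?s ` {1..n}"
    then obtain k where k: "k \<in> {1..n}" "v = ?s k" by blast
    moreover have "\<rho> k \<in> {1..n}" using k n by (auto simp: \<rho>_def)
    ultimately show "v \<in> ubasis nu ` {1..n}" using sb by auto
  next
    fix v assume "v \<in> ubasis nu ` {1..n}"
    then obtain k where k: "k \<in> {1..n}" "v = ubasis nu k" by blast
    define l where "l = (if odd k then (k + 1) div 2 else n + 1 - k div 2)"
    have "l \<in> {1..n}" "\<rho> l = k" using k n by (auto simp: l_def \<rho>_def elim!: oddE evenE)
    then have "v = ?s l" using sb k by simp
    then show "v \<in> ?s ` {1..n}" using \<open>l \<in> {1..n}\<close> by blast
  qed
qed

lemma ordered_basis_sbasis: "ordered_basis (sbasis nu id :: nat \<Rightarrow> 'm cvec)"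
  using ordered_basis_std unfolding ordered_basis_def n[symmetric] sbasis_image .

text \<open>Up to sign \<open>j\<close> reverses this basis, so it carries the first
  \<open>n - p\<close> vectors onto the last \<open>n - p\<close>. This supplies one explicit
  generic flag.\<close>

lemma mixed_sbasis:
  assumes i: "0 < i" "i < length c"
  shows "ordered_basis (mixed (sum_list (take i c)) (sbasis nu id))"
proof -
  define p where "p = sum_list (take i c)"
  have pn: "p \<le> n" using sum_list_take_mono[of i "length c" c] i sum_c by (simp add: p_def)
  let ?s = "sbasis nu id :: nat \<Rightarrow> 'm cvec"
  have jjs: "jj (?s k) = ?s (n + 1 - k) \<or> jj (?s k) = - ?s (n + 1 - k)" if "k \<in> {1..n}" for k
  proof (cases "k \<le> CARD('m)")
    case True
    then have "\<not> n + 1 - k \<le> CARD('m)" "n + 1 - (n + 1 - k) = k" using n that by auto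
    then show ?thesis using True n by (simp add: sbasis_def)
  next
    case False
    then have "n + 1 - k \<le> CARD('m)" using n by auto
    then show ?thesis using False n by (simp add: sbasis_def jj_jj)
  qed
  have in_span: "?s k \<in> vec.span (mixed p ?s ` {1..n})" if k: "k \<in> {1..n}" for k
  proof (cases "k \<le> p")
    case True
    then have "?s k = mixed p ?s k" by (simp add: mixed_def)
    then show ?thesis using k by (auto intro: vec.span_base)
  next
    case False
    let ?l = "n + 1 - k"
    have l: "?l \<in> {1..n}" "n + 1 - ?l = k" "?l + p \<in> {1..n}" "\<not> ?l + p \<le> p" using k False pn by auto
    have "mixed p ?s (?l + p) = jj (?s ?l)" unfolding mixed_def using l(4) by (simp only: if_False add_diff_cancel_right')
    then have "jj (?s ?l) \<in> vec.span (mixed p ?s ` {1..n})" using l(3) by (metis imageI vec.span_base)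
    moreover have "?s k = jj (?s ?l) \<or> ?s k = - jj (?s ?l)" using jjs[OF l(1)] unfolding l(2) by auto
    ultimately show ?thesis by (auto intro: vec.span_neg)
  qed
  have "UNIV = vec.span (ubasis nu ` {1..n})" using ordered_basis_std n by (simp add: ordered_basis_def)
  also have "\<dots> \<subseteq> vec.span (mixed p ?s ` {1..n})"
    unfolding sbasis_image[symmetric] using in_span by (intro vec.span_minimal) auto
  finally show ?thesis unfolding p_def ordered_basis_def n[symmetric] by blast
qed

text \<open>The parameter is real because \<open>j\<close> conjugates scalars: along real parameters
  the mixed frame is affine. The resulting polynomials are complex but are evaluated on the real
  line.\<close>

lemma frame_mixed_pencil:
  "frame_matrix (mixed p (\<lambda>k. (mat 1 + mat (of_real t) ** E) *v b k)) =
    frame_matrix (mixed p b) + mat (of_real t) ** frame_matrix (mixed p (\<lambda>k. E *v b k))"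
proof -
  have "(mat 1 + mat (of_real t) ** E) *v v = v + of_real t *s (E *v v)" for v
    by (simp add: matrix_vector_mult_add_rdistrib matrix_vector_mul_assoc[symmetric] mat_mult_vector)
  then have "mixed p (\<lambda>k. (mat 1 + mat (of_real t) ** E) *v b k) k = mixed p b k + of_real t *s mixed p (\<lambda>k. E *v b k) k" for k
    by (simp add: mixed_def jj_add_of_real)
  moreover have "(mat z ** X) $ x $ y = z * X $ x $ y" for z and X :: "'m cmat" and x y
    by (simp add: matrix_matrix_mult_def mat_def if_distrib[of "\<lambda>x. x * _"] cong: if_cong)
  ultimately show ?thesis by (simp add: frame_matrix_def vec_eq_iff)
qed

text \<open>The given basis moves along a line to the generic basis \<open>sbasis\<close>.
  Genericity follows from the nonvanishing of finitely many polynomials in the parameter, each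
  nonzero at 1, so it holds for all small nonzero parameters, and for these the flag has not yet
  left \<open>D\<close>.\<close>

lemma open_contains_generic:
  assumes F: "F \<in> flag_manifold c" "F \<in> D" and D: "openin (flag_topology c) (D :: 'm flag set)"
  shows "\<exists>F'\<in>D. generic F'"
proof -
  obtain b where b: "ordered_basis b" "F = flag_of c b"
    using flag_manifold_eq_flag_of[OF F(1)] sum_c n by auto
  obtain g1 where g1: "\<forall>i\<in>{1..2 * CARD('m)}. g1 *v b i = sbasis nu id i"
    using ordered_basis_transform[OF b(1) ordered_basis_sbasis] by blast
  define E where "E = g1 - mat 1"
  define G where "G t = mat 1 + mat (of_real t) ** E" for t :: real
  have G0: "G 0 = mat 1" by (simp add: G_def vec_eq_iff matrix_matrix_mult_def mat_def)
  have G1: "G 1 = g1" by (simp add: G_def E_def)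
  obtain P0 where P0: "\<And>t. det (G t) = poly P0 (of_real t)" using det_pencil_poly[of "mat 1" E] by (auto simp: G_def)
  have "\<exists>P. \<forall>t. det (frame_matrix (mixed (sum_list (take i c)) (\<lambda>k. G t *v b k))) = poly P (of_real t)" for i
    unfolding G_def frame_mixed_pencil using det_pencil_poly by blast
  then obtain P where P: "\<And>i t. det (frame_matrix (mixed (sum_list (take i c)) (\<lambda>k. G t *v b k))) = poly (P i) (of_real t)"
    by metis
  let ?I = "{0<..<length c}"
  \<comment> \<open>\<open>P0\<close> is nonzero at \<open>t = 0\<close> and every
    \<open>P i\<close> at \<open>t = 1\<close>; that makes the product a nonzero polynomial. The
    factor \<open>P0\<close> keeps \<open>G t\<close> invertible.\<close>
  define R where "R = P0 * (\<Prod>i\<in>?I. P i)"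
  have "poly P0 0 \<noteq> 0" using P0[of 0] G0 by simp
  moreover have "poly (P i) 1 \<noteq> 0" if i: "i \<in> ?I" for i
  proof -
    let ?p = "sum_list (take i c)"
    have le: "?p \<le> n" using sum_list_take_mono[of i "length c" c] i sum_c by simp
    have "mixed ?p (\<lambda>k. G 1 *v b k) k = mixed ?p (sbasis nu id) k" if "k \<in> {1..n}" for k
    proof (cases "k \<le> ?p")
      case False
      then have "k - ?p \<in> {1..2 * CARD('m)}" using that n by auto
      then show ?thesis using g1 G1 False by (simp add: mixed_def)
    qed (use g1 G1 that n in \<open>simp add: mixed_def\<close>)
    then have "frame_matrix (mixed ?p (\<lambda>k. G 1 *v b k)) = frame_matrix (mixed ?p (sbasis nu id))"
      using rank_in by (simp add: frame_matrix_def vec_eq_iff del: atLeastAtMost_iff)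
    then have "invertible (frame_matrix (mixed ?p (\<lambda>k. G 1 *v b k)))"
      using mixed_sbasis[of i] i by (simp add: frame_matrix_invertible)
    then show ?thesis using P[of i 1] by (simp add: invertible_det_nz)
  qed
  then have "P i \<noteq> 0" if "i \<in> ?I" for i using that by force
  ultimately have "R \<noteq> 0" by (auto simp: R_def)
  then have fin: "finite {t :: real. poly R (of_real t) = 0}"
    using finite_vimageI[OF poly_roots_finite, of R "of_real :: real \<Rightarrow> complex"] by (simp add: vimage_def inj_of_real)
  have ev_root: "eventually (\<lambda>t :: real. poly R (of_real t) \<noteq> 0) (at 0)"
  proof -
    let ?S = "{t :: real. poly R (of_real t) = 0} - {0}"
    have "open (- ?S)" using fin by (intro open_Compl finite_imp_closed) auto
    moreover have "0 \<in> - ?S" by simp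
    ultimately have "eventually (\<lambda>t. t \<in> - ?S) (at 0)" unfolding eventually_at_topological by blast
    moreover have "eventually (\<lambda>t :: real. t \<noteq> 0) (at 0)" by (simp add: eventually_neq_at_within)
    ultimately show ?thesis by eventually_elim auto
  qed
  have lim_poly: "((\<lambda>t :: real. poly P0 (of_real t)) \<longlongrightarrow> 1) (at 0)"
  proof -
    have "((\<lambda>t :: real. poly P0 (of_real t)) \<longlongrightarrow> poly P0 (of_real 0)) (at 0)" by (intro tendsto_intros)
    then show ?thesis using P0[of 0] G0 by simp
  qed
  \<comment> \<open>\<open>Ln\<close> is continuous at 1, the value of the determinant at
    \<open>t = 0\<close>.\<close>
  have "((\<lambda>t. exp (- Ln (poly P0 (of_real t)) / of_nat (2 * CARD('m)))) \<longlongrightarrow> exp (- Ln 1 / of_nat (2 * CARD('m)))) (at 0)"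
    using lim_poly by (intro tendsto_intros) auto
  then have lim_norm: "((\<lambda>t. det_normalizer (G t)) \<longlongrightarrow> 1) (at 0)"
    by (simp add: det_normalizer_def P0)
  have lim_mat: "((\<lambda>t. mat (f t) :: 'm cmat) \<longlongrightarrow> mat l) (at 0)" if "(f \<longlongrightarrow> l) (at (0::real))" for f l
    by (auto intro!: vec_tendstoI that simp: mat_def)
  have "((\<lambda>t. mat (of_real t) :: 'm cmat) \<longlongrightarrow> mat (of_real 0)) (at 0)"
    by (rule lim_mat) (intro tendsto_intros)
  then have "(G \<longlongrightarrow> mat 1 + mat (of_real 0) ** E) (at 0)"
    unfolding G_def[abs_def] by (intro tendsto_intros bounded_bilinear.tendsto[OF bounded_bilinear_matrix_mult])
  then have "(G \<longlongrightarrow> mat 1) (at 0)" using G0 by (simp add: G_def)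
  from bounded_bilinear.tendsto[OF bounded_bilinear_matrix_mult lim_mat[OF lim_norm] this]
  have lim: "((\<lambda>t. mat (det_normalizer (G t)) ** G t) \<longlongrightarrow> mat 1) (at 0)" by simp
  obtain U where U: "open U" "{g \<in> SL. act g F \<in> D} = SL \<inter> U"
    using D F(1) unfolding openin_flag_topology openin_open by blast
  have "mat 1 \<in> SL \<inter> U" unfolding U(2)[symmetric] using F(2) by (simp add: SL_def)
  then have "eventually (\<lambda>t. mat (det_normalizer (G t)) ** G t \<in> U) (at 0)"
    using lim U(1) by (intro topological_tendstoD) auto
  with ev_root have "eventually (\<lambda>t. poly R (of_real t) \<noteq> 0 \<and> mat (det_normalizer (G t)) ** G t \<in> U) (at 0)"
    by (rule eventually_conj)
  then obtain t where t: "poly R (of_real t) \<noteq> 0" "mat (det_normalizer (G t)) ** G t \<in> U"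
    using eventually_happens'[OF at_neq_bot] by blast
  have inv: "invertible (G t)" using t(1) P0[of t] by (simp add: R_def invertible_det_nz)
  have "mat (det_normalizer (G t)) ** G t \<in> SL" by (rule det_normalizer_SL[OF inv])
  then have "act (mat (det_normalizer (G t)) ** G t) F \<in> D" using t(2) U(2) by blast
  then have inD: "act (G t) F \<in> D" unfolding act_det_normalizer[OF F(1)] .
  have "generic (flag_of c (\<lambda>k. G t *v b k))"
  proof (rule mixed_generic)
    fix i assume i: "0 < i" "i < length c"
    then have "poly (P i) (of_real t) \<noteq> 0" using t(1) by (simp add: R_def poly_prod)
    then show "ordered_basis (mixed (sum_list (take i c)) (\<lambda>k. G t *v b k))"
      unfolding frame_matrix_invertible[symmetric] invertible_det_nz P .
  qed
  then have "generic (act (G t) F)" unfolding b(2) act_flag_of .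
  then show ?thesis using inD by blast
qed

text \<open>\<open>D\<close> is a single orbit of a group that commutes with \<open>j\<close>, so
  one generic member makes all of them generic.\<close>

lemma open_orbit_generic:
  assumes D: "open_orbit c D" and F: "F \<in> (D :: 'm flag set)"
  shows "generic F"
proof -
  obtain F1 where F1: "F1 \<in> flag_manifold c" "D = orbit SL_quat F1" and op: "openin (flag_topology c) D"
    using D by (auto simp: open_orbit_def)
  have "mat 1 \<in> (SL_quat :: 'm cmat set)" by (simp add: SL_quat_def SL_def)
  then have "F1 \<in> D" unfolding F1(2) orbit_def by (metis act_one imageI)
  then obtain F2 where F2: "F2 \<in> D" "generic F2" using open_contains_generic[OF F1(1) _ op] by blast
  obtain g2 where g2: "g2 \<in> SL_quat" "F2 = act g2 F1" using F2 F1 by (auto simp: orbit_def)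
  obtain g where g: "g \<in> SL_quat" "F = act g F1" using F F1 by (auto simp: orbit_def)
  obtain h where h: "g2 ** h = mat 1" "h ** g2 = mat 1"
    using SL_invertible[of g2] g2 matrix_invE[of g2] by (auto simp: SL_quat_def)
  have "act (g ** h) F2 = act (g ** (h ** g2)) F1" unfolding g2(2) act_act by (simp only: matrix_mul_assoc)
  then have "F = act (g ** h) F2" using h g by simp
  then show ?thesis using generic_act_quat[OF F2(2) SL_quat_mult[OF g(1) SL_quat_inverse[OF g2(1) h]]] by simp
qed


end

end

subsection \<open>The intersection point\<close>

lemma split_blocks_nth:
  "k < length c \<Longrightarrow> split_blocks c xs ! k = take (c ! k) (drop (sum_list (take k c)) xs)"
proof (induction c arbitrary: xs k)
  case (Cons l c)
  then show ?case by (cases k) (auto simp: add.commute)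
qed simp

lemma length_split_blocks [simp]: "length (split_blocks c xs) = length c"
  by (induction c xs rule: split_blocks.induct) auto

lemma split_blocks_append:
  "split_blocks (a @ b) xs = split_blocks a xs @ split_blocks b (drop (sum_list a) xs)"
  by (induction a xs rule: split_blocks.induct) (auto simp: add.commute)

lemma concat_split_blocks: "concat (split_blocks c xs) = take (sum_list c) xs"
  by (induction c xs rule: split_blocks.induct) (auto simp: take_add)

lemma nths_parity_Cons:
  "nths (x # xs) {i. even i} = x # nths xs {i. odd i}" "nths (x # xs) {i. odd i} = nths xs {i. even i}"
  by (auto simp: nths_Cons)

text \<open>An increasing list closed under exchanging \<open>2 * i - 1\<close> and
  \<open>2 * i\<close> is a sequence of such pairs, each in adjacent places, so positions of one
  parity carry the odd values and those of the other their successors. This describes the middle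
  block.\<close>

lemma nths_parity_pairs:
  assumes "sorted_wrt (<) xs" "\<And>v. v \<in> set xs \<Longrightarrow> (if odd v then Suc v else v - 1) \<in> set xs" "0 \<notin> set xs"
  shows "nths xs {i. odd i} = map Suc (nths xs {i. even i}) \<and> (\<forall>v\<in>set (nths xs {i. even i}). odd (v::nat))"
  using assms
proof (induction xs rule: induct_list012)
  case (2 x)
  then show ?case using 2(2)[of x] by (auto split: if_splits)
next
  case (3 x y zs)
  have odd: "odd x"
  proof (rule ccontr)
    assume "\<not> odd x"
    then have "x - 1 \<in> set (x # y # zs)" using 3(4)[of x] by simp
    moreover have "x \<noteq> 0" using 3(5) by auto
    ultimately show False using 3(3) by auto
  qed
  then have "Suc x \<in> set (y # zs)" using 3(4)[of x] by auto
  then have y: "y = Suc x" using 3(3) by auto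
  have gt: "v > Suc x" if "v \<in> set zs" for v using 3(3) that y by auto
  have "nths zs {i. odd i} = map Suc (nths zs {i. even i}) \<and> (\<forall>v\<in>set (nths zs {i. even i}). odd v)"
  proof (rule 3(1))
    fix v assume v: "v \<in> set zs"
    have "(if odd v then Suc v else v - 1) \<in> set (x # y # zs)" using 3(4)[of v] v by simp
    moreover have "(if odd v then Suc v else v - 1) > Suc x" using gt[OF v] odd y
      by (cases "odd v") (simp, simp, presburger)
    ultimately show "(if odd v then Suc v else v - 1) \<in> set zs" using y by auto
  next
    show "sorted_wrt (<) zs" "0 \<notin> set zs" using 3(3,5) by simp_all
  qed
  then show ?case using y odd by (simp add: nths_parity_Cons)
qed simp

lemma nths_parity_set_length:
  "set (nths xs {i. even i}) \<union> set (nths xs {i. odd i}) = set xs"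
  "length (nths xs {i. even i}) + length (nths xs {i. odd i}) = length xs"
  by (induction xs) (auto simp: nths_parity_Cons)

lemma take_concat_blocks:
  assumes "length xss = length c" "\<And>k. k < length c \<Longrightarrow> length (xss ! k) = c ! k" 
  shows "take (sum_list (take k c)) (concat xss) = concat (take k xss)"
  using assms
proof (induction xss arbitrary: c k)
  case (Cons x xss)
  then obtain l c' where c: "c = l # c'" by (cases c) auto
  have "length x = l" using Cons(3)[of 0] c by simp
  moreover have "length (xss ! j) = c' ! j" if "j < length c'" for j using Cons(3)[of "Suc j"] c that by simp
  ultimately show ?case using Cons(1)[of c'] Cons(2) c by (cases k) auto
qed auto

text \<open>The passage from \<open>w\<close> to \<open>w_hat\<close> rearranges values inside each
  block only. Initial segments ending at block boundaries therefore keep their sets of values, and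
  these sets are all that a flag sees.\<close>

lemma w_hat_blocks:
  fixes w :: "nat \<Rightarrow> nat"
  assumes c: "c = ds @ mid @ rev ds" and mid: "length mid \<le> 1" and n: "sum_list c = n"
  defines "ws \<equiv> map w [1..<Suc n]"
  defines "M \<equiv> drop (sum_list ds) (take (n - sum_list ds) ws)"
  shows "split_blocks mid (drop (sum_list ds) ws) = (if mid = [] then [] else [M])" "mid = [] \<Longrightarrow> M = []"
    "split_blocks c ws = split_blocks ds ws @ (if mid = [] then [] else [M]) @ split_blocks (rev ds) (drop (n - sum_list ds) ws)"
    "w_hat ds n w = concat (split_blocks ds ws) @ nths M {i. even i} @ rev (nths M {i. odd i}) @
        concat (map rev (split_blocks (rev ds) (drop (n - sum_list ds) ws)))"
    "set (take (sum_list (take k c)) (w_hat ds n w)) = set (take (sum_list (take k c)) ws)"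
    "length (w_hat ds n w) = n"
proof -
  let ?p = "sum_list ds"
  have np: "n = ?p + sum_list mid + ?p" using n c by simp
  show mid0: "mid = [] \<Longrightarrow> M = []" using np by (simp add: M_def ws_def)
  show mid1: "split_blocks mid (drop ?p ws) = (if mid = [] then [] else [M])"
    using mid np by (cases mid) (auto simp: M_def take_drop add.commute)
  have "n - ?p = ?p + sum_list mid" using np by simp
  then show sb: "split_blocks c ws = split_blocks ds ws @ (if mid = [] then [] else [M]) @ split_blocks (rev ds) (drop (n - ?p) ws)"
    unfolding c split_blocks_append mid1[symmetric] by (simp add: add.commute)
  have "?p \<le> n" using np by simp
  then show wh: "w_hat ds n w = concat (split_blocks ds ws) @ nths M {i. even i} @ rev (nths M {i. odd i}) @
        concat (map rev (split_blocks (rev ds) (drop (n - ?p) ws)))"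
    by (simp only: w_hat_def Let_def M_def ws_def concat_split_blocks)
  define SB where "SB = split_blocks c ws"
  define SB' where "SB' = split_blocks ds ws @ (if mid = [] then [] else [nths M {i. even i} @ rev (nths M {i. odd i})]) @
      map rev (split_blocks (rev ds) (drop (n - ?p) ws))"
  have con: "w_hat ds n w = concat SB'" using wh mid0 by (simp add: SB'_def)
  have "list_all2 (\<lambda>xs ys. set xs = set ys \<and> length xs = length ys) SB SB'"
    unfolding SB_def SB'_def sb using nths_parity_set_length[of M]
    by (intro list_all2_appendI) (auto simp: list_all2_conv_all_nth)
  then have len: "length SB' = length SB" and all: "\<And>j. j < length SB \<Longrightarrow> set (SB ! j) = set (SB' ! j) \<and> length (SB ! j) = length (SB' ! j)"
    by (auto simp: list_all2_conv_all_nth)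
  have lSB: "length SB = length c" by (simp add: SB_def)
  have lSBj: "length (SB ! j) = c ! j" if "j < length c" for j
  proof -
    have "sum_list (take j c) + c ! j \<le> n"
      using sum_list_take_mono[of "Suc j" "length c" c] sum_list_take_Suc[OF that] n that by simp
    then show ?thesis using that by (simp add: SB_def split_blocks_nth ws_def)
  qed
  have conSB: "concat SB = ws" by (simp add: SB_def concat_split_blocks n ws_def)
  have "set (concat (take k SB')) = set (concat (take k SB))"
  proof -
    have "set ` set (take k SB') = set ` set (take k SB)"
    proof -
      have "map set (take k SB') = map set (take k SB)" by (rule nth_equalityI) (use len all in auto)
      then show ?thesis by (metis set_map)
    qed
    then show ?thesis by (simp add: set_concat) 
  qed
  moreover have "take (sum_list (take k c)) (concat SB') = concat (take k SB')"
    by (rule take_concat_blocks) (use len lSB lSBj all in auto)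
  moreover have "take (sum_list (take k c)) (concat SB) = concat (take k SB)"
    by (rule take_concat_blocks) (use lSB lSBj in auto)
  ultimately show "set (take (sum_list (take k c)) (w_hat ds n w)) = set (take (sum_list (take k c)) ws)"
    by (simp add: con conSB)
  have "map length SB' = map length SB" by (rule nth_equalityI) (use len all in auto)
  then have "length (concat SB') = length (concat SB)" by (simp add: length_concat)
  then show "length (w_hat ds n w) = n" by (simp add: con conSB ws_def)
qed

section \<open>From equality of dimensions to equality of flags\<close>

context iwasawa_setup begin

lemma card_idx: "card {k\<in>{1..n}. P (idx nu k)} = card {x. P x}"
proof -
  have "bij_betw (idx nu) {k\<in>{1..n}. P (idx nu k)} {x. P x}"
    by (rule bij_betw_byWitness[where f'=rank]) (auto simp: rank_in simp del: atLeastAtMost_iff One_nat_def)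
  then show ?thesis by (rule bij_betw_same_card)
qed

lemma card_idx_rank: "j \<le> n \<Longrightarrow> card {k\<in>{1..j}. P (idx nu k)} = card {x. P x \<and> rank x \<le> j}"
proof -
  assume j: "j \<le> n"
  have "{k\<in>{1..j}. P (idx nu k)} = {k\<in>{1..n}. P (idx nu k) \<and> rank (idx nu k) \<le> j}" using j by auto
  then show ?thesis using card_idx[of "\<lambda>x. P x \<and> rank x \<le> j"] by simp
qed

lemma card_idx_pairs:
  "card {(k, l). k \<in> {1..n} \<and> l \<in> {1..n} \<and> k \<le> l \<and> f (idx nu k) \<le> (f (idx nu l) :: nat)}
    = card {(x, y). rank x \<le> rank y \<and> f x \<le> f y}"
proof (rule bij_betw_same_card)
  show "bij_betw (map_prod (idx nu) (idx nu)) {(k, l). k \<in> {1..n} \<and> l \<in> {1..n} \<and> k \<le> l \<and> f (idx nu k) \<le> f (idx nu l)}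
    {(x, y). rank x \<le> rank y \<and> f x \<le> f y}"
    by (rule bij_betw_byWitness[where f'="map_prod rank rank"]) (auto simp: rank_in simp del: atLeastAtMost_iff One_nat_def)
qed

lemma schubert_cycle_point:
  fixes F :: "'m flag"
  assumes w: "w permutes {1..n}"
    and F: "F \<in> schubert_variety nu c w" "F \<in> flag_manifold c"
    and K: "dim (sp_alg :: 'm cmat set) \<le> dim (sp_alg \<inter> stab F) + 2 * d"
    and dims: "2 * inversions w + 2 * d + dim (stab F) \<le> DIM('m cmat)"
  shows "F = flag_of c (ubasis nu \<circ> w) \<and> (\<forall>i. blk w (Inl i) \<le> blk w (Inr i))"
proof -
  have B: "dim borel_alg \<le> dim (borel_alg \<inter> stab F) + 2 * inversions w" by (rule schubert_dim_stab[OF w F(1)])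
  have le: "dim borel_alg + dim (sp_alg :: 'm cmat set) + dim (stab F) \<le>
      DIM('m cmat) + dim (borel_alg \<inter> stab F) + dim (sp_alg \<inter> stab F)"
    using B K dims by linarith
  note tr = transversal_dim[OF subspace_borel_alg subspace_sp_alg subspace_stab[OF F(2)] borel_sp_span le]
  have len: "length F = length c" by (rule flag_manifold_length[OF F(2)])
  obtain f where f: "\<And>x. f x < length c" "\<And>k. k < length c \<Longrightarrow> F ! k = coord_space {x. f x \<le> k}"
    "\<And>i. f (Inl i) \<le> f (Inr i)"
    by (rule coordinate_flag[OF F(2) tr(1)]) (rule that)
  have stabF: "stab F = coord_matrices (\<lambda>x y. f x \<le> f y)" by (rule stab_coord_flag[OF len f(1,2)])
  \<comment> \<open>Equality in the transversality estimate forces equality in the semicontinuity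
    bound \<open>B\<close>; in coordinates, \<open>f\<close> and \<open>blk w\<close> then have
    equally many noninversions.\<close>
  have "dim borel_alg = dim (borel_alg \<inter> stab F) + 2 * inversions w" using tr(2) B K dims by linarith
  then have "dim (borel_alg \<inter> stab F) = dim (borel_alg \<inter> stab (flag_of c (ubasis nu \<circ> w)))"
    using dim_borel_stab[OF w] by linarith
  then have pairs: "card {(x, y). rank x \<le> rank y \<and> f x \<le> f y} = card {(x, y). rank x \<le> rank y \<and> blk w x \<le> blk w y}"
    unfolding stabF stab_flag[OF w] borel_alg_def coord_matrices_Int dim_coord_matrices by simp
  have dom: "card {x. blk w x \<le> k \<and> rank x \<le> j} \<le> card {x. f x \<le> k \<and> rank x \<le> j}" for k j
  proof (cases "k < length c")
    case True
    have "F ! k \<inter> coord_space {x. rank x \<le> j} = coord_space {x. f x \<le> k \<and> rank x \<le> j}"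
      unfolding f(2)[OF True] coord_space_Int by (rule arg_cong[of _ _ coord_space]) auto
    then show ?thesis using schubert_rank[OF w F(1) True, of j] by (simp add: dim_coord_space)
  next
    case False
    have "f x \<le> k" for x using f(1)[of x] False by linarith
    then show ?thesis by (intro card_mono) auto
  qed
  have dimF: "card {x. g x \<le> k} = sum_list (take (Suc k) c)"
    if "F' \<in> flag_manifold c" "F' ! k = coord_space {x. g x \<le> k}" "k < length c" for F' :: "'m flag" and g k
    using flag_manifold_dim[OF that(1), of "Suc k"] that(2,3) dim_substandard_cart[of "{x. g x \<le> k}", where 'a=complex]
    by (simp add: coord_space_def)
  have cum: "card {x. f x \<le> k} = card {x. blk w x \<le> k}" for k
  proof (cases "k < length c")
    case True
    then show ?thesis
      using dimF[OF F(2) f(2)[OF True] True] dimF[OF flag_w_in[OF w] flag_nth[OF w True] True] by simp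
  next
    case False
    then have "f x \<le> k \<and> blk w x \<le> k" for x using f(1)[of x] blk_less[OF w, of x] by linarith
    then show ?thesis by simp
  qed
  have fib: "card {x. f x = k} = card {x. blk w x = k}" for k
  proof (cases k)
    case 0
    then show ?thesis using cum[of 0] by simp
  next
    case (Suc j)
    have "card {x. g x \<le> Suc j} = card {x. g x \<le> j} + card {x. g x = Suc j}" for g :: "'m + 'm \<Rightarrow> nat"
    proof -
      have "{x. g x \<le> Suc j} = {x. g x \<le> j} \<union> {x. g x = Suc j}" by auto
      then show ?thesis by (simp only:) (rule card_Un_disjoint, auto)
    qed
    then show ?thesis using cum[of "Suc j"] cum[of j] Suc by simp
  qed
  \<comment> \<open>The comparison runs over the coordinates in Iwasawa order: the incidence
    conditions on the Schubert variety give dominance, the common dimension sequence gives fibres of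
    equal size.\<close>
  have eq: "blk w (idx nu k) = f (idx nu k)" if "k \<in> {1..n}" for k
  proof (rule noninversions_dominance_eq[where n=n and z=k and f="\<lambda>k. blk w (idx nu k)" and g="\<lambda>k. f (idx nu k)"])
    show "card {x \<in> {1..n}. blk w (idx nu x) = i} = card {x \<in> {1..n}. f (idx nu x) = i}" for i
      unfolding card_idx[of "\<lambda>x. blk w x = i"] card_idx[of "\<lambda>x. f x = i"] by (rule fib[symmetric])
    show "card {x \<in> {1..k}. blk w (idx nu x) \<le> i} \<le> card {x \<in> {1..k}. f (idx nu x) \<le> i}" if "k \<le> n" for i k
      unfolding card_idx_rank[OF that, of "\<lambda>x. blk w x \<le> i"] card_idx_rank[OF that, of "\<lambda>x. f x \<le> i"] by (rule dom)
    show "card {(x, y). x \<in> {1..n} \<and> y \<in> {1..n} \<and> x \<le> y \<and> f (idx nu x) \<le> f (idx nu y)}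
      \<le> card {(x, y). x \<in> {1..n} \<and> y \<in> {1..n} \<and> x \<le> y \<and> blk w (idx nu x) \<le> blk w (idx nu y)}"
      unfolding card_idx_pairs pairs by simp
  qed (rule that)
  have fw: "f = blk w"
  proof
    fix x show "f x = blk w x" using eq[OF rank_in[of x]] by simp
  qed
  have "F = flag_of c (ubasis nu \<circ> w)"
    by (rule nth_equalityI) (use len f(2) flag_nth[OF w] fw in auto)
  then show ?thesis using f(3) fw by blast
qed

end

section \<open>The shape of the permutation\<close>

lemma star_image_iff: "x \<in> star ` B \<longleftrightarrow> star x \<in> B"
  by (auto intro: rev_image_eqI[of "star x"])

lemma jj_coord_space: "jj ` coord_space I = coord_space (star ` I)"
proof (intro equalityI subsetI)
  fix v assume "v \<in> jj ` coord_space I"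
  then obtain u where u: "u \<in> coord_space I" "v = jj u" by blast
  have "u $ star x = 0" if "x \<notin> star ` I" for x
    using u(1) that by (simp add: coord_space_def star_image_iff)
  then show "v \<in> coord_space (star ` I)" by (simp add: coord_space_def u(2) jj_nth')
next
  fix v assume v: "v \<in> coord_space (star ` I)"
  have "star x \<notin> star ` I" if "x \<notin> I" for x using that by (simp add: star_image_iff)
  then have "- jj v \<in> coord_space I" using v by (simp add: coord_space_def jj_nth')
  moreover have "v = jj (- jj v)" using jj_jj[of v] jj_diff[of 0 "jj v"] by simp
  ultimately show "v \<in> jj ` coord_space I" by blast
qed

lemma set_take_image: "q \<le> length xs \<Longrightarrow> set (take q xs) = (\<lambda>i. xs ! (i - 1)) ` {1..q}"
proof -
  assume q: "q \<le> length xs"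
  have "set (take q xs) = (\<lambda>i. xs ! i) ` {0..<q}" using q by (simp add: nth_image)
  also have "{0..<q} = (\<lambda>i. i - 1) ` {1..q}"
  proof (intro equalityI subsetI)
    fix x assume "x \<in> {0..<q}"
    then have "x = Suc x - 1" "Suc x \<in> {1..q}" by auto
    then show "x \<in> (\<lambda>i. i - 1) ` {1..q}" by blast
  qed auto
  finally show ?thesis by (simp add: image_image)
qed

context iwasawa_setup begin

lemma card_blk_le:
  assumes w: "w permutes {1..n}" and k: "k < length c"
  shows "card {x. blk w x \<le> k} = sum_list (take (Suc k) c)"
  using flag_manifold_dim[OF flag_w_in[OF w], of "Suc k"] k flag_nth[OF w k]
    dim_substandard_cart[of "{x. blk w x \<le> k}", where 'a=complex]
  by (simp add: coord_space_def)

text \<open>Let \<open>r\<close> be the number of blocks. By genericity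
  \<open>{x. blk w x \<le> i - 1}\<close> is disjoint from the \<open>star\<close>-image of
  \<open>{x. blk w x \<le> r - i - 1}\<close>, and by the symmetry of the sequence their sizes add
  up to \<open>n\<close>, so they are complementary. Taking for \<open>i\<close> the block of
  \<open>x\<close> and the next one bounds the block of the partner from both sides.\<close>

lemma blk_star:
  assumes sym: "rev c = c" and w: "w permutes {1..n}" and gen: "generic (flag_of c (ubasis nu \<circ> w))"
  shows "blk w (star x) = length c - 1 - blk w x"
proof -
  let ?r = "length c"
  have key: "(blk w x \<le> i - 1 \<longrightarrow> blk w (star x) \<ge> ?r - i) \<and> (blk w x \<ge> i \<longrightarrow> blk w (star x) \<le> ?r - i - 1)"
    if i: "0 < i" "i < ?r" for i x
  proof -
    let ?A = "{x. blk w x \<le> i - 1}" and ?B = "{x. blk w x \<le> ?r - i - 1}"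
    have i': "i - 1 < ?r" "?r - i - 1 < ?r" using i by auto
    have "coord_space ?A \<inter> jj ` coord_space ?B = {0}"
      using gen[unfolded generic_def length_flag_of, rule_format, OF conjI[OF i]]
      unfolding flag_nth[OF w i'(1)] flag_nth[OF w i'(2)] .
    then have zero: "coord_space (?A \<inter> star ` ?B) = {0}" by (simp add: jj_coord_space coord_space_Int)
    have disj: "?A \<inter> star ` ?B = {}"
    proof (rule ccontr)
      assume "?A \<inter> star ` ?B \<noteq> {}"
      then obtain y where y: "y \<in> ?A \<inter> star ` ?B" by blast
      then have "axis y (1::complex) \<in> coord_space (?A \<inter> star ` ?B)" by (auto simp: coord_space_def axis_nth')
      then have "axis y (1::complex) = 0" unfolding zero by blast
      then show False by (simp add: axis_eq_0_iff)
    qed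
    have inj: "inj (star :: 'm + 'm \<Rightarrow> _)" by (rule injI) (metis star_simps(3))
    have cB: "card (star ` ?B) = card ?B" by (rule card_image[OF inj_on_subset[OF inj subset_UNIV]])
    have "card ?A = sum_list (take i c)" using card_blk_le[OF w i'(1)] i by simp
    moreover have "card ?B = sum_list (take (?r - i) c)"
    proof -
      have "Suc (?r - i - 1) = ?r - i" using i by simp
      then show ?thesis using card_blk_le[OF w i'(2)] by (simp only:)
    qed
    ultimately have "card (?A \<union> star ` ?B) = n"
      using sum_list_take_rev[OF sym, of i] i sum_c cB disj by (simp add: card_Un_disjoint)
    also have "n = card (UNIV :: ('m + 'm) set)" using n by simp
    finally have un: "?A \<union> star ` ?B = UNIV" by (intro card_subset_eq) auto
    have "x \<in> star ` ?B \<longleftrightarrow> star x \<in> ?B" by (rule star_image_iff)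
    moreover have "x \<in> ?A \<or> x \<in> star ` ?B" "\<not> (x \<in> ?A \<and> x \<in> star ` ?B)" using un disj by blast+
    ultimately show ?thesis using i by auto
  qed
  let ?t = "blk w x"
  have lt: "?t < ?r" "blk w (star x) < ?r" using blk_less[OF w] by auto
  have ge: "?r - 1 - ?t \<le> blk w (star x)"
  proof (cases "?t + 1 < ?r")
    case True
    then show ?thesis using key[of "?t + 1" x] by simp
  qed simp
  have le: "blk w (star x) \<le> ?r - 1 - ?t"
  proof (cases "?t = 0")
    case False
    then show ?thesis using key[of ?t x] lt by simp
  qed (use lt in simp)
  show ?thesis using ge le by simp
qed

lemma star_idx_odd:
  assumes "v \<in> {1..n}" "odd v"
  shows "star (idx nu v) = idx nu (Suc v)" "Suc v \<in> {1..n}" "\<exists>i. idx nu v = Inl i"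
proof -
  have "Suc v \<le> 2 * CARD('m)" using assms n by (simp; presburger)
  then show "Suc v \<in> {1..n}" using n by simp
qed (use assms in \<open>auto simp: idx_def elim!: oddE\<close>)

lemma star_idx_even:
  assumes "v \<in> {1..n}" "even v"
  shows "star (idx nu v) = idx nu (v - 1)" "v - 1 \<in> {1..n}" "odd (v - 1)" "Suc (v - 1) = v"
  using assms by (auto simp: idx_def elim!: evenE)

definition block_values :: "(nat \<Rightarrow> nat) \<Rightarrow> nat \<Rightarrow> nat list" where
  "block_values w k = split_blocks c (map w [1..<Suc n]) ! k"

lemma block_values_eq:
  assumes k: "k < length c"
  shows "block_values w k = map w [sum_list (take k c) + 1..<sum_list (take (Suc k) c) + 1]"
proof -
  let ?s = "sum_list (take k c)"
  have Suc: "sum_list (take (Suc k) c) = ?s + c ! k" by (rule sum_list_take_Suc[OF k])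
  moreover have "?s + c ! k \<le> n"
    using sum_list_take_mono[of "Suc k" "length c" c] k sum_c Suc by simp
  ultimately show ?thesis
    by (simp add: block_values_def split_blocks_nth[OF k] drop_map take_map drop_upt take_upt add.commute del: upt_Suc)
qed

context
  fixes w
  assumes min: "minimal_rep c w"
begin

lemma minimal_rep_permutes: "w permutes {1..n}" using min sum_c by (simp add: minimal_rep_def)

lemma block_values_sorted:
  assumes k: "k < length c" shows "sorted_wrt (<) (block_values w k)"
proof -
  have m: "strict_mono_on (block c k) w" using min k by (simp add: minimal_rep_def)
  have "sorted_wrt (\<lambda>x y. w x < w y) [sum_list (take k c) + 1..<sum_list (take (Suc k) c) + 1]"
  proof (rule sorted_wrt_mono_rel[of _ "(<)"])
    fix x y assume "x \<in> set [sum_list (take k c) + 1..<sum_list (take (Suc k) c) + 1]"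
      "y \<in> set [sum_list (take k c) + 1..<sum_list (take (Suc k) c) + 1]" "x < y"
    then show "w x < w y" using m by (auto simp: block_def strict_mono_on_def)
  qed (rule sorted_wrt_upt)
  then show ?thesis by (simp add: block_values_eq[OF k] sorted_wrt_map)
qed

lemma set_block_values:
  assumes k: "k < length c" shows "set (block_values w k) = {v\<in>{1..n}. blk w (idx nu v) = k}"
proof -
  have "set (block_values w k) = w ` block c k"
    by (auto simp: block_values_eq[OF k] block_def image_iff Bex_def)
  also have "\<dots> = {v\<in>{1..n}. blk w (idx nu v) = k}"
  proof (intro equalityI subsetI)
    fix v assume "v \<in> w ` block c k"
    then obtain i where i: "i \<in> block c k" "v = w i" by blast
    then have "i \<in> {1..n}" using block_subset[OF k] sum_c by auto
    then show "v \<in> {v\<in>{1..n}. blk w (idx nu v) = k}"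
      using i in_block_iff[of i c k] k sum_c blk_idx[OF minimal_rep_permutes, of i] w_in[OF minimal_rep_permutes, of i] by simp
  next
    fix v assume v: "v \<in> {v\<in>{1..n}. blk w (idx nu v) = k}"
    define i where "i = inv w v"
    have i: "i \<in> {1..n}" "v = w i" using inv_w_in[OF minimal_rep_permutes, of v] v permutes_inverses(1)[OF minimal_rep_permutes] by (auto simp: i_def)
    then have "i \<in> block c k" using v in_block_iff[of i c k] k sum_c blk_idx[OF minimal_rep_permutes, of i] by simp
    then show "v \<in> w ` block c k" using i by blast
  qed
  finally show ?thesis .
qed

context
  assumes sym: "rev c = c" and gen: "generic (flag_of c (ubasis nu \<circ> w))"
    and lr: "\<And>i. blk w (Inl i) \<le> blk w (Inr i)"
begin

lemma blk_odd:
  assumes "v \<in> {1..n}" "odd v"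
  shows "blk w (idx nu v) \<le> blk w (idx nu (Suc v))" "blk w (idx nu (Suc v)) = length c - 1 - blk w (idx nu v)"
proof -
  obtain i where i: "idx nu v = Inl i" using star_idx_odd(3)[OF assms] by blast
  then have "idx nu (Suc v) = Inr i" using star_idx_odd(1)[OF assms] by simp
  then show "blk w (idx nu v) \<le> blk w (idx nu (Suc v))" using i lr by simp
  show "blk w (idx nu (Suc v)) = length c - 1 - blk w (idx nu v)"
    unfolding star_idx_odd(1)[OF assms, symmetric] by (rule blk_star[OF sym minimal_rep_permutes gen])
qed

lemma blk_even:
  assumes "v \<in> {1..n}" "even v"
  shows "blk w (idx nu (v - 1)) \<le> blk w (idx nu v)" "blk w (idx nu (v - 1)) = length c - 1 - blk w (idx nu v)"
proof -
  note e = star_idx_even[OF assms]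
  show "blk w (idx nu (v - 1)) \<le> blk w (idx nu v)" using blk_odd(1)[OF e(2,3)] e(4) by simp
  show "blk w (idx nu (v - 1)) = length c - 1 - blk w (idx nu v)"
    unfolding e(1)[symmetric] by (rule blk_star[OF sym minimal_rep_permutes gen])
qed

text \<open>An odd \<open>v\<close> and \<open>v + 1\<close> belong to partners, so they lie in
  mirrored blocks, the odd one not in the later. A block in the left half thus has only odd values,
  and its mirror image has exactly their successors; both lists are increasing because
  \<open>w\<close> is minimal, so they agree as lists.\<close>

lemma block_values_reflect:
  assumes k: "k < length c - 1 - k"
  shows "block_values w (length c - 1 - k) = map Suc (block_values w k)" "\<And>v. v \<in> set (block_values w k) \<Longrightarrow> odd v"
proof -
  let ?l = "length c - 1 - k"
  have kl: "k < length c" "?l < length c" "length c - 1 - ?l = k" using k by auto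
  have od: "odd v \<and> Suc v \<in> set (block_values w ?l)" if v: "v \<in> set (block_values w k)" for v
  proof -
    have v': "v \<in> {1..n}" "blk w (idx nu v) = k" using v set_block_values[OF kl(1)] by auto
    have "odd v"
    proof (rule ccontr)
      assume "\<not> odd v"
      then show False using blk_even[OF v'(1)] v'(2) k by simp
    qed
    then show ?thesis using blk_odd[OF v'(1)] star_idx_odd(2)[OF v'(1)] v'(2) set_block_values[OF kl(2)] by simp
  qed
  have ev: "v \<in> Suc ` set (block_values w k)" if v: "v \<in> set (block_values w ?l)" for v
  proof -
    have v': "v \<in> {1..n}" "blk w (idx nu v) = ?l" using v set_block_values[OF kl(2)] by auto
    have even: "even v"
    proof (rule ccontr)
      assume "\<not> even v"
      then show False using blk_odd[OF v'(1)] v'(2) k kl(3) by simp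
    qed
    then have "v - 1 \<in> set (block_values w k)"
      using blk_even[OF v'(1)] star_idx_even[OF v'(1)] v'(2) set_block_values[OF kl(1)] kl(3) by simp
    then show ?thesis using star_idx_even(4)[OF v'(1) even] by (metis imageI)
  qed
  show "\<And>v. v \<in> set (block_values w k) \<Longrightarrow> odd v" using od by blast
  show "block_values w ?l = map Suc (block_values w k)"
  proof (rule strict_sorted_equal)
    show "sorted_wrt (<) (block_values w ?l)" by (rule block_values_sorted[OF kl(2)])
    show "sorted_wrt (<) (map Suc (block_values w k))" using block_values_sorted[OF kl(1)] by (simp add: sorted_wrt_map)
    show "set (block_values w ?l) = set (map Suc (block_values w k))" using od ev by auto
  qed
qed

lemma block_values_middle:
  assumes k: "k < length c" "length c - 1 - k = k" and v: "v \<in> set (block_values w k)"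
  shows "(if odd v then Suc v else v - 1) \<in> set (block_values w k)"
proof -
  have v': "v \<in> {1..n}" "blk w (idx nu v) = k" using v set_block_values[OF k(1)] by auto
  show ?thesis
    using blk_odd[OF v'(1)] blk_even[OF v'(1)] star_idx_odd(2)[OF v'(1)] star_idx_even(2)[OF v'(1)] v'(2) k
      set_block_values[OF k(1)] by simp
qed

text \<open>Reversing the right blocks turns the mirrored successors into the left half read
  backwards. The middle block, if present, consists of pairs \<open>v, v + 1\<close> with
  \<open>v\<close> odd, which the alternating rearrangement splits into odd values ascending and
  their successors descending.\<close>

lemma w_hat_special:
  assumes c: "c = ds @ mid @ rev ds" and mid: "length mid \<le> 1"
  obtains K where "w_hat ds n w = K @ rev (map Suc K)" "\<And>v. v \<in> set K \<Longrightarrow> odd v"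
proof -
  define ws where "ws = map w [1..<Suc n]"
  define M where "M = drop (sum_list ds) (take (n - sum_list ds) ws)"
  define S where "S = split_blocks ds ws"
  define T where "T = split_blocks (rev ds) (drop (n - sum_list ds) ws)"
  note wh = w_hat_blocks[OF c mid sum_c, where w=w, folded ws_def, folded M_def, folded S_def T_def]
  have len: "length c = 2 * length ds + length mid" using c by simp
  have lS: "length S = length ds" "length T = length ds" by (simp_all add: S_def T_def)
  have bv: "block_values w k = (S @ (if mid = [] then [] else [M]) @ T) ! k" for k
    unfolding block_values_def ws_def[symmetric] wh(3) ..
  have lm: "length (if mid = [] then [] else [M]) = length mid" using mid by (cases mid) auto
  have Sk: "S ! k = block_values w k" if "k < length ds" for k using that lS by (simp add: bv nth_append)
  have Tk: "T ! k = block_values w (length ds + length mid + k)" if "k < length ds" for k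
    using that lS lm by (simp add: bv nth_append)
  have refl: "T ! j = map Suc (S ! (length ds - Suc j))" "\<And>v. v \<in> set (S ! j) \<Longrightarrow> odd v" if j: "j < length ds" for j
  proof -
    let ?k = "length ds - Suc j"
    have "?k < length c - 1 - ?k" "length c - 1 - ?k = length ds + length mid + j" "?k < length ds" using j len by auto
    then show "T ! j = map Suc (S ! ?k)" using block_values_reflect(1)[of ?k] Tk[OF j] Sk[of ?k] by simp
    have "j < length c - 1 - j" using j len by auto
    then show "\<And>v. v \<in> set (S ! j) \<Longrightarrow> odd v" using block_values_reflect(2)[of j] Sk[OF j] by simp
  qed
  have T: "T = rev (map (map Suc) S)"
    by (rule nth_equalityI) (auto simp: lS rev_nth refl(1))
  have cT: "concat (map rev T) = rev (map Suc (concat S))"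
    unfolding T by (simp add: rev_concat rev_map map_concat)
  have M: "nths M {i. odd i} = map Suc (nths M {i. even i}) \<and> (\<forall>v\<in>set (nths M {i. even i}). odd v)"
  proof (cases "mid = []")
    case True
    then show ?thesis using wh(2) by simp
  next
    case False
    then have "length mid = 1" using mid by (cases mid) auto
    then have k: "length ds < length c" "length c - 1 - length ds = length ds" using len by auto
    have Mb: "M = block_values w (length ds)" using False lS by (simp add: bv nth_append)
    show ?thesis unfolding Mb
    proof (rule nths_parity_pairs)
      show "sorted_wrt (<) (block_values w (length ds))" by (rule block_values_sorted[OF k(1)])
      show "0 \<notin> set (block_values w (length ds))" using set_block_values[OF k(1)] by simp
    qed (rule block_values_middle[OF k])
  qed
  let ?K = "concat S @ nths M {i. even i}"
  show thesis
  proof (rule that[of ?K])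
    show "w_hat ds n w = ?K @ rev (map Suc ?K)" unfolding wh(4) cT using M by simp
    fix v assume "v \<in> set ?K"
    then consider "v \<in> set (concat S)" | "v \<in> set (nths M {i. even i})" by auto
    then show "odd v"
    proof cases
      case 1
      then obtain xs where "xs \<in> set S" "v \<in> set xs" by auto
      then obtain j where "j < length ds" "v \<in> set (S ! j)" using lS by (metis in_set_conv_nth)
      then show ?thesis by (rule refl(2))
    next
      case 2
      then show ?thesis using M by blast
    qed
  qed
qed

lemma corresponds_exists:
  assumes c: "c = ds @ mid @ rev ds" and mid: "length mid \<le> 1"
  shows "\<exists>s. corresponds ds CARD('m) w s"
proof -
  let ?m = "CARD('m)"
  obtain K where K: "w_hat ds n w = K @ rev (map Suc K)" "\<And>v. v \<in> set K \<Longrightarrow> odd v"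
    by (rule w_hat_special[OF c mid]) (rule that)
  note wh = w_hat_blocks[OF c mid sum_c, where w=w]
  have lenK: "length K = ?m" using wh(6) K(1) n by simp
  have "set (w_hat ds n w) = set (map w [1..<Suc n])"
    using wh(5)[of "length c"] wh(6) sum_c by simp
  also have "\<dots> = w ` {1..n}" by (simp add: atLeastLessThanSuc_atLeastAtMost del: upt_Suc)
  also have "\<dots> = {1..n}" by (rule permutes_image[OF minimal_rep_permutes])
  finally have set: "set (w_hat ds n w) = {1..n}" .
  then have "distinct (w_hat ds n w)" using wh(6) by (intro card_distinct) simp
  then have dK: "distinct K" using K(1) by simp
  \<comment> \<open>\<open>K\<close> is indexed from 0, hence \<open>i - 1\<close>; being the
    identity outside the range is part of \<open>permutes\<close>.\<close>
  define s where "s i = (if i \<in> {1..?m} then (K ! (i - 1) + 1) div 2 else i)" for i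
  have Ki: "odd (K ! (i - 1))" "K ! (i - 1) \<in> {1..n}" if "i \<in> {1..?m}" for i
  proof -
    have "K ! (i - 1) \<in> set K" using that lenK by auto
    then show "odd (K ! (i - 1))" "K ! (i - 1) \<in> {1..n}" using K set by auto
  qed
  have "s permutes {1..?m}"
  proof (rule bij_imp_permutes)
    have inj: "inj_on s {1..?m}"
    proof (rule inj_onI)
      fix i j assume ij: "i \<in> {1..?m}" "j \<in> {1..?m}" "s i = s j"
      then have "(K ! (i - 1) + 1) div 2 = (K ! (j - 1) + 1) div 2" by (simp add: s_def)
      then have "K ! (i - 1) = K ! (j - 1)"
        using Ki(1)[OF ij(1)] Ki(1)[OF ij(2)] by (auto elim!: oddE)
      moreover have "i - 1 < length K" "j - 1 < length K" using ij lenK by auto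
      ultimately have "i - 1 = j - 1" using dK nth_eq_iff_index_eq by blast
      then show "i = j" using ij by auto
    qed
    have "s ` {1..?m} \<subseteq> {1..?m}"
    proof
      fix x assume "x \<in> s ` {1..?m}"
      then obtain i where i: "i \<in> {1..?m}" "x = (K ! (i - 1) + 1) div 2" by (auto simp: s_def)
      then show "x \<in> {1..?m}" using Ki[OF i(1)] n by (auto elim!: oddE)
    qed
    then have "s ` {1..?m} = {1..?m}" using inj by (intro endo_inj_surj) auto
    then show "bij_betw s {1..?m} {1..?m}" using inj by (simp add: bij_betw_def)
    show "s x = x" if "x \<notin> {1..?m}" for x using that unfolding s_def by (simp only: if_False)
  qed
  moreover have "let k = w_hat ds (2 * ?m) w ! (i - 1); l = w_hat ds (2 * ?m) w ! (2 * ?m - i)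
        in odd k \<and> l = k + 1 \<and> s i = (k + 1) div 2" if i: "i \<in> {1..?m}" for i
  proof -
    have "w_hat ds (2 * ?m) w ! (i - 1) = K ! (i - 1)" using i lenK K(1) n by (auto simp: nth_append)
    moreover have "w_hat ds (2 * ?m) w ! (2 * ?m - i) = rev (map Suc K) ! (?m - i)"
    proof -
      have "\<not> 2 * ?m - i < ?m" "2 * ?m - i - ?m = ?m - i" using i by auto
      then show ?thesis using lenK K(1) n by (simp add: nth_append)
    qed
    moreover have "rev (map Suc K) ! (?m - i) = Suc (K ! (i - 1))"
    proof -
      have "?m - i < ?m" "?m - Suc (?m - i) = i - 1" using i by auto
      then show ?thesis using lenK by (simp add: rev_nth)
    qed
    ultimately show ?thesis using Ki[OF i] i by (simp add: s_def)
  qed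
  ultimately have "corresponds ds ?m w s" unfolding corresponds_def by blast
  then show ?thesis by blast
qed

end

text \<open>\<open>sbasis\<close> lists the vectors of the Iwasawa basis in the order of
  \<open>w_hat\<close>, which differs from that of \<open>w\<close> only inside blocks.\<close>

lemma flag_of_sbasis:
  assumes c: "c = ds @ mid @ rev ds" and mid: "length mid \<le> 1" and s: "corresponds ds CARD('m) w s"
  shows "flag_of c (sbasis nu s) = flag_of c (ubasis nu \<circ> w)"
proof (rule nth_equalityI)
  let ?m = "CARD('m)"
  note wh = w_hat_blocks[OF c mid sum_c, where w=w]
  let ?h = "w_hat ds n w"
  have cor: "odd (?h ! (j - 1))" "?h ! (2 * ?m - j) = ?h ! (j - 1) + 1" "s j = (?h ! (j - 1) + 1) div 2"
    if "j \<in> {1..?m}" for j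
    using bspec[OF conjunct2[OF s[unfolded corresponds_def Let_def]] that] unfolding n[symmetric] by blast+
  have sb: "sbasis nu s i = ubasis nu (?h ! (i - 1))" if i: "i \<in> {1..n}" for i
  proof (cases "i \<le> ?m")
    case True
    then have "i \<in> {1..?m}" using i by simp
    from cor[OF this] show ?thesis using True by (simp add: sbasis_def ubasis_def)
  next
    case False
    define j where "j = 2 * ?m + 1 - i"
    have j: "j \<in> {1..?m}" "2 * ?m - j = i - 1" using i n False by (auto simp: j_def)
    have h: "odd (?h ! (j - 1))" "?h ! (i - 1) = ?h ! (j - 1) + 1" "s j = (?h ! (j - 1) + 1) div 2"
      using cor[OF j(1)] unfolding j(2) by blast+
    have "sbasis nu s i = jj (evec nu (s j))" using False by (simp add: sbasis_def j_def)
    moreover have "ubasis nu (?h ! (i - 1)) = jj (evec nu ((?h ! (j - 1) + 1) div 2))"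
      unfolding h(2) using h(1) by (simp add: ubasis_def)
    ultimately show ?thesis unfolding h(3) by simp
  qed
  fix k assume "k < length (flag_of c (sbasis nu s))"
  then have k: "k < length c" by simp
  let ?q = "sum_list (take (Suc k) c)"
  have q: "?q \<le> n" using sum_list_take_mono[of "Suc k" "length c" c] k sum_c by simp
  have "sbasis nu s ` {1..?q} = ubasis nu ` (\<lambda>i. ?h ! (i - 1)) ` {1..?q}"
    unfolding image_image using q by (intro image_cong sb) auto
  also have "(\<lambda>i. ?h ! (i - 1)) ` {1..?q} = set (take ?q ?h)" using q wh(6) by (simp only: set_take_image)
  also have "\<dots> = set (take ?q (map w [1..<Suc n]))" by (rule wh(5))
  also have "\<dots> = w ` {1..?q}" using q by (auto simp: take_map take_upt simp del: upt_Suc)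
  finally show "flag_of c (sbasis nu s) ! k = flag_of c (ubasis nu \<circ> w) ! k"
    using k by (simp add: flag_of_nth image_comp)
qed simp

end

end

theorem theorem31:
  fixes nu :: "nat \<Rightarrow> 'm::finite"
    and ds c :: "nat list"
    and w :: "nat \<Rightarrow> nat"
    and D C0 :: "'m flag set"
  assumes "bij_betw nu {1..CARD('m)} UNIV"
    and "c = ds @ rev ds \<or> (\<exists>e'. c = ds @ [e'] @ rev ds)"
    and "\<forall>d\<in>set c. 0 < d"
    and "sum_list c = 2 * CARD('m)"
    and "open_orbit c D"
    and "base_cycle c D C0"
    and "minimal_rep c w"
    and "analytic_dim c (schubert_variety nu c w) + analytic_dim c C0
           = analytic_dim c (flag_manifold c :: 'm flag set)"
    and "schubert_variety nu c w \<inter> C0 \<noteq> {}"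
  shows "(\<exists>!F. F \<in> schubert_variety nu c w \<inter> C0) \<and>
    (\<exists>s. corresponds ds CARD('m) w s) \<and>
    (\<forall>s. corresponds ds CARD('m) w s \<longrightarrow>
       schubert_variety nu c w \<inter> C0 = {flag_of c (sbasis nu s)})"
proof -
  interpret iwasawa_setup nu c "2 * CARD('m)"
    using assms(1,4) by unfold_locales auto
  obtain mid where c: "c = ds @ mid @ rev ds" "length mid \<le> 1"
  proof -
    show thesis using assms(2)
    proof
      assume "c = ds @ rev ds" then show thesis by (intro that[of "[]"]) auto
    next
      assume "\<exists>e'. c = ds @ [e'] @ rev ds" then show thesis by (elim exE) (rule that, auto)
    qed
  qed
  have "rev mid = mid" using c(2) by (cases mid) auto
  then have sym: "rev c = c" by (simp add: c(1))
  have w: "w permutes {1..2 * CARD('m)}" using assms(4,7) by (simp add: minimal_rep_def)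
  let ?S = "schubert_variety nu c w"
  let ?Fw = "flag_of c (ubasis nu \<circ> w)"
  obtain F0 d where F0: "F0 \<in> D" "C0 = orbit Sp_compact F0" and M: "complex_submanifold c d C0"
    using assms(6) unfolding base_cycle_def by blast
  obtain F1 where F1: "F1 \<in> flag_manifold c" "D = orbit SL_quat F1"
    using assms(5) unfolding open_orbit_def by blast
  have C_in: "C0 \<subseteq> flag_manifold c" using M by (simp add: complex_submanifold_def)
  \<comment> \<open>The Cayley transform of the zero matrix is the identity.\<close>
  have "mat 1 \<in> (Sp_compact :: 'm cmat set)"
    using cayley_in_Sp[of "0 :: 'm cmat" 0] cayley_0[of "0 :: 'm cmat"] by (simp add: skew_alg_def sp_alg_def)
  then have "F0 \<in> C0" unfolding F0(2) orbit_def by (metis act_one imageI)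
  then have F0_in: "F0 \<in> flag_manifold c" using C_in by blast
  have C_D: "F \<in> D" if "F \<in> C0" for F
  proof -
    obtain g0 where g0: "g0 \<in> SL_quat" "F0 = act g0 F1" using F0(1) F1(2) by (auto simp: orbit_def)
    obtain k where k: "k \<in> Sp_compact" "F = act k F0" using \<open>F \<in> C0\<close> F0(2) by (auto simp: orbit_def)
    have "k ** g0 \<in> SL_quat" using k(1) g0(1) by (intro SL_quat_mult) (auto simp: Sp_compact_def)
    then show ?thesis unfolding F1(2) k(2) g0(2) act_act orbit_def by blast
  qed
  have C_ne: "C0 \<noteq> {}" using \<open>F0 \<in> C0\<close> by blast
  have point: "F = ?Fw \<and> (\<forall>i. blk w (Inl i) \<le> blk w (Inr i))" if F: "F \<in> ?S \<inter> C0" for F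
  proof (rule schubert_cycle_point[OF w])
    show FS: "F \<in> ?S" and Fm: "F \<in> flag_manifold c" using F C_in by auto
    show "dim (sp_alg :: 'm cmat set) \<le> dim (sp_alg \<inter> stab F) + 2 * d"
      using compact_orbit_tangent[OF F0_in F0(2) M] F by blast
    \<comment> \<open>\<open>inversions w + d\<close> is at most the sum of the two analytic
      dimensions, which by hypothesis is the dimension of \<open>Z\<close>, and twice the latter is
      at most the real codimension of \<open>stab F\<close>.\<close>
    have "inversions w \<le> analytic_dim c ?S" by (rule inversions_le_analytic_dim[OF w])
    moreover have "d \<le> analytic_dim c C0" by (rule analytic_dim_ge[OF M C_ne subset_refl])
    moreover have "2 * analytic_dim c (flag_manifold c :: 'm flag set) + dim (stab F) \<le> DIM('m cmat)"
      by (rule analytic_dim_flag_manifold_le[OF Fm])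
    ultimately show "2 * inversions w + 2 * d + dim (stab F) \<le> DIM('m cmat)" using assms(8) by linarith
  qed
  obtain F where F: "F \<in> ?S \<inter> C0" using assms(9) by blast
  have eq: "?S \<inter> C0 = {?Fw}" using F point by blast
  have lr: "blk w (Inl i) \<le> blk w (Inr i)" for i using point[OF F] by blast
  have "?Fw \<in> C0" using eq by blast
  then have gen: "generic ?Fw" using open_orbit_generic[OF sym assms(5)] C_D by blast
  have "\<exists>s. corresponds ds CARD('m) w s" by (rule corresponds_exists[OF assms(7) sym gen lr c])
  moreover have "flag_of c (sbasis nu s) = ?Fw" if "corresponds ds CARD('m) w s" for s
    by (rule flag_of_sbasis[OF assms(7) c that])
  ultimately show ?thesis using eq by auto
qed

end
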